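(* Let $(\varphi,\vec\xi,\eta,g)$ be a contact metric structure on a smooth manifold $X$ of odd dimension $n$, let $D=\ker\eta$, and let $(\tilde D,J,\vec u,\lambda=\eta\circ\pi_*,\tilde g,D)$ be the prolonged almost contact metric structure on the total space of $D$ determined by the $N$-prolonged metric connection. Then the prolonged structure is almost K-contact (i.e. $L_{\vec u}\tilde g=0$) if and only if the initial structure is K-contact (i.e. $L_{\vec\xi}g=0$).
   Context: All objects are smooth. An almost contact metric structure $(\varphi,\vec\xi,\eta,g)$ on an odd-dimensional manifold $X$ consists of a $(1,1)$-tensor field $\varphi$, a vector field $\vec\xi$, a 1-form $\eta$ and a (pseudo-)Riemannian metric $g$ with $\eta(\vec\xi)=1$, $\varphi(\vec\xi)=0$, $\eta\circ\varphi=0$, $\varphi^2\vec X=-\vec X+\eta(\vec X)\vec\xi$, $g(\varphi\vec X,\varphi\vec Y)=g(\vec X,\vec Y)-\eta(\vec X)\eta(\vec Y)$ and $d\eta(\vec\xi,\vec X)=0$. It is a contact metric structure if $\Omega=d\eta$, where $\Omega(\vec X,\vec Y)=g(\vec X,\varphi\vec Y)$ and $2\,d\eta(\vec X,\vec Y)=\vec X\eta(\vec Y)-\vec Y\eta(\vec X)-\eta([\vec X,\vec Y])$. An almost contact metric structure is almost K-contact if the Lie derivative of its metric along its structure vector field is zero; when $d\eta$ has maximal rank one says K-contact. Adapted coordinates. Indices: $\alpha=1,\dots,n$; $a,b,c=1,\dots,n-1$. A chart $(x^\alpha)$ on $X$ is adapted if $\vec\xi=\partial_n$; then $D=\ker\eta$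 is spanned by $\vec e_a=\partial_a-\Gamma^n_a\partial_n$ for functions $\Gamma^n_a$ with $\partial_n\Gamma^n_a=0$, and $\eta=dx^n+\Gamma^n_adx^a$. The total space of $D$, with projection $\pi:D\to X$, is a smooth manifold of dimension $2n-1$ with coordinates $(x^\alpha,x^{n+a})$, where $x^{n+a}$ are the components of a vector of $D$ in the basis $(\vec e_a)$. $N$-prolonged metric connection. Let $p:TX\to D$ be the projection along $\vec\xi$. Let $\nabla:\Gamma D\times\Gamma D\to\Gamma D$ be the unique intrinsic linear connection ($C^\infty(X)$-linear in the first argument, additive and satisfying the Leibniz rule in the second) with $\vec Zg(\vec X,\vec Y)=g(\nabla_{\vec Z}\vec X,\vec Y)+g(\vec X,\nabla_{\vec Z}\vec Y)$ and $\nabla_{\vec X}\vec Y-\nabla_{\vec Y}\vec X=p[\vec X,\vec Y]$ for $\vec X,\vec Y,\vec Z\in\Gamma D$; write $\nabla_{\vec e_a}\vec e_b=\Gamma^c_{ab}\vec e_c$. Let $N:D\to D$ be the symmetric endomorphism given by $g(N\vec X,\vec Y)=\frac12(L_{\vec\xi}g)(\vec X,\vec Y)$ for $\vec X,\vec Y\in\Gamma D$; write $N\vec e_b=N^a_b\vec e_a$. Prolonged almost contact metric structure. On the manifold $D$ consider the local frame $$\vec\epsilon_a=\partial_a-\Gamma^n_a\partial_n-\Gamma^b_{ac}x^{n+c}\partial_{n+b},\qquad \vec u=\partial_n-N^a_bx^{n+b}\partial_{n+a},\qquad \partial_{n+a}.$$ Then $\tilde D=\pi_*^{-1}(D)=\mathrm{span}(\vec\epsilon_a,\partial_{n+a})=\ker\lambda$,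 where $\lambda=\eta\circ\pi_*$. The metric $\tilde g$ and endomorphism $J$ are defined by $$\tilde g(\vec\epsilon_a,\vec\epsilon_b)=\tilde g(\partial_{n+a},\partial_{n+b})=g(\vec e_a,\vec e_b),\quad \tilde g(\vec\epsilon_a,\partial_{n+b})=\tilde g(\vec\epsilon_a,\vec u)=\tilde g(\vec u,\partial_{n+b})=0,\quad \tilde g(\vec u,\vec u)=1,$$ $$J(\vec\epsilon_a)=\partial_{n+a},\quad J(\partial_{n+a})=-\vec\epsilon_a,\quad J(\vec u)=0.$$ These objects do not depend on the choice of adapted chart; $J$ is the structure endomorphism, $\vec u$ the structure vector field, and $\lambda$ the contact form. *)

theory Defs
  imports "HOL-Analysis.Analysis" "HOL-Library.Function_Algebras"
begin

section \<open>Smooth maps between open subsets of Euclidean spaces\<close>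

fun Ck_on :: "nat \<Rightarrow> 'a::real_normed_vector set \<Rightarrow> ('a \<Rightarrow> 'b::real_normed_vector) \<Rightarrow> bool" where
  "Ck_on 0 S f \<longleftrightarrow> continuous_on S f"
| "Ck_on (Suc k) S f \<longleftrightarrow> (\<forall>x\<in>S. f differentiable (at x)) \<and>
     (\<forall>v. Ck_on k S (\<lambda>x. frechet_derivative f (at x) v))"

definition smooth_on :: "'a::real_normed_vector set \<Rightarrow> ('a \<Rightarrow> 'b::real_normed_vector) \<Rightarrow> bool" where
  "smooth_on S f \<longleftrightarrow> (\<forall>k. Ck_on k S f)"

section \<open>Smooth manifolds\<close>

text \<open>A chart is a pair of its domain and its coordinate map; the values of the coordinate map
  outside the domain are irrelevant. The underlying set and the topology of a manifold are
  determined by its atlas.\<close>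

type_synonym ('m, 'i) chart = "'m set \<times> ('m \<Rightarrow> real ^ 'i)"

definition is_chart :: "('m, 'i::finite) chart \<Rightarrow> bool" where
  "is_chart c \<longleftrightarrow> inj_on (snd c) (fst c) \<and> open (snd c ` fst c)"

definition cinv :: "('m, 'i::finite) chart \<Rightarrow> real ^ 'i \<Rightarrow> 'm" where
  "cinv c = inv_into (fst c) (snd c)"

definition compatible :: "('m, 'i::finite) chart \<Rightarrow> ('m, 'i) chart \<Rightarrow> bool" where
  "compatible c c' \<longleftrightarrow> open (snd c ` (fst c \<inter> fst c')) \<and>
     smooth_on (snd c ` (fst c \<inter> fst c')) (snd c' \<circ> cinv c)"

definition atlas :: "('m, 'i::finite) chart set \<Rightarrow> bool" where
  "atlas A \<longleftrightarrow> (\<forall>c\<in>A. is_chart c) \<and> (\<forall>c\<in>A. \<forall>c'\<in>A. compatible c c')"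

definition mcarrier :: "('m, 'i::finite) chart set \<Rightarrow> 'm set" where
  "mcarrier A = (\<Union>c\<in>A. fst c)"

definition mtop :: "('m, 'i::finite) chart set \<Rightarrow> 'm topology" where
  "mtop A = topology (\<lambda>U. U \<subseteq> mcarrier A \<and> (\<forall>c\<in>A. open (snd c ` (U \<inter> fst c))))"

text \<open>The manifold is given by its maximal atlas, so that "a chart on the manifold" means an
  element of \<open>A\<close>.\<close>

definition smooth_manifold :: "('m, 'i::finite) chart set \<Rightarrow> bool" where
  "smooth_manifold A \<longleftrightarrow> atlas A \<and> Hausdorff_space (mtop A) \<and> second_countable (mtop A) \<and>
     (\<forall>c. is_chart c \<and> fst c \<subseteq> mcarrier A \<and> (\<forall>c'\<in>A. compatible c c' \<and> compatible c' c)
        \<longrightarrow> c \<in> A)"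

section \<open>Tangent vectors\<close>

text \<open>A tangent vector at \<open>p\<close> is the family of its coordinate vectors in all charts around \<open>p\<close>,
  related by the derivatives of the coordinate changes, and padded by \<open>0\<close> for the other charts.\<close>

type_synonym ('m, 'i) tvec = "('m, 'i) chart \<Rightarrow> real ^ 'i"

instantiation "fun" :: (type, real_vector) real_vector
begin

definition scaleR_fun :: "real \<Rightarrow> ('a \<Rightarrow> 'b) \<Rightarrow> 'a \<Rightarrow> 'b" where
  "scaleR_fun r f = (\<lambda>x. r *\<^sub>R f x)"

instance
  by standard (auto simp: scaleR_fun_def fun_eq_iff scaleR_add_right scaleR_add_left)

end

definition tspace :: "('m, 'i::finite) chart set \<Rightarrow> 'm \<Rightarrow> ('m, 'i) tvec set" where
  "tspace A p = {v.
     (\<forall>c\<in>A. \<forall>c'\<in>A. p \<in> fst c \<and> p \<in> fst c' \<longrightarrow>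
        v c' = frechet_derivative (snd c' \<circ> cinv c) (at (snd c p)) (v c)) \<and>
     (\<forall>c. c \<notin> A \<or> p \<notin> fst c \<longrightarrow> v c = 0)}"

text \<open>The coordinate vector \<open>\<partial>\<^sub>i\<close> of the chart \<open>c\<close> at \<open>p\<close>.\<close>

definition coord_vec :: "('m, 'i::finite) chart set \<Rightarrow> ('m, 'i) chart \<Rightarrow> 'i \<Rightarrow> 'm \<Rightarrow> ('m, 'i) tvec" where
  "coord_vec A c i p = (\<lambda>c'. if c' \<in> A \<and> p \<in> fst c'
     then frechet_derivative (snd c' \<circ> cinv c) (at (snd c p)) (axis i 1) else 0)"

definition chart_at :: "('m, 'i::finite) chart set \<Rightarrow> 'm \<Rightarrow> ('m, 'i) chart" where
  "chart_at A p = (SOME c. c \<in> A \<and> p \<in> fst c)"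

text \<open>The derivative \<open>v f\<close> of a function along a tangent vector at \<open>p\<close>, and the differential
  \<open>F\<^sub>*\<close> of a map; neither depends on the choice made by \<open>chart_at\<close>.\<close>

definition tderiv :: "('m, 'i::finite) chart set \<Rightarrow> ('m, 'i) tvec \<Rightarrow> ('m \<Rightarrow> real) \<Rightarrow> 'm \<Rightarrow> real" where
  "tderiv A v f p = (let c = chart_at A p in
     frechet_derivative (f \<circ> cinv c) (at (snd c p)) (v c))"

definition pushforward :: "('m, 'i::finite) chart set \<Rightarrow> ('k, 'j::finite) chart set \<Rightarrow> ('m \<Rightarrow> 'k) \<Rightarrow>
    'm \<Rightarrow> ('m, 'i) tvec \<Rightarrow> ('k, 'j) tvec" where
  "pushforward A B F p v = (let c = chart_at A p in
     (\<lambda>c'. if c' \<in> B \<and> F p \<in> fst c'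
        then frechet_derivative (snd c' \<circ> F \<circ> cinv c) (at (snd c p)) (v c) else 0))"

section \<open>Smooth functions, vector fields and tensor fields\<close>

text \<open>Vector fields are considered on arbitrary open subsets \<open>U\<close>, so that tensor identities can be
  tested on local frames.\<close>

definition smooth_fun :: "('m, 'i::finite) chart set \<Rightarrow> 'm set \<Rightarrow> ('m \<Rightarrow> real) \<Rightarrow> bool" where
  "smooth_fun A U f \<longleftrightarrow> (\<forall>c\<in>A. smooth_on (snd c ` (U \<inter> fst c)) (f \<circ> cinv c))"

definition vfield :: "('m, 'i::finite) chart set \<Rightarrow> 'm set \<Rightarrow> ('m \<Rightarrow> ('m, 'i) tvec) \<Rightarrow> bool" where
  "vfield A U X \<longleftrightarrow> (\<forall>p\<in>U. X p \<in> tspace A p) \<and>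
     (\<forall>c\<in>A. smooth_on (snd c ` (U \<inter> fst c)) (\<lambda>y. X (cinv c y) c))"

definition lie_bracket :: "('m, 'i::finite) chart set \<Rightarrow> ('m \<Rightarrow> ('m, 'i) tvec) \<Rightarrow>
    ('m \<Rightarrow> ('m, 'i) tvec) \<Rightarrow> 'm \<Rightarrow> ('m, 'i) tvec" where
  "lie_bracket A X Y p = (\<lambda>c. if c \<in> A \<and> p \<in> fst c
     then frechet_derivative (\<lambda>y. Y (cinv c y) c) (at (snd c p)) (X p c)
        - frechet_derivative (\<lambda>y. X (cinv c y) c) (at (snd c p)) (Y p c)
     else 0)"

definition one_form :: "('m, 'i::finite) chart set \<Rightarrow> ('m \<Rightarrow> ('m, 'i) tvec \<Rightarrow> real) \<Rightarrow> bool" where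
  "one_form A w \<longleftrightarrow>
     (\<forall>p\<in>mcarrier A. \<forall>v\<in>tspace A p. \<forall>v'\<in>tspace A p. \<forall>r.
        w p (v + v') = w p v + w p v' \<and> w p (r *\<^sub>R v) = r * w p v) \<and>
     (\<forall>U X. openin (mtop A) U \<and> vfield A U X \<longrightarrow> smooth_fun A U (\<lambda>p. w p (X p)))"

definition endo_field :: "('m, 'i::finite) chart set \<Rightarrow>
    ('m \<Rightarrow> ('m, 'i) tvec \<Rightarrow> ('m, 'i) tvec) \<Rightarrow> bool" where
  "endo_field A F \<longleftrightarrow>
     (\<forall>p\<in>mcarrier A. \<forall>v\<in>tspace A p. \<forall>v'\<in>tspace A p. \<forall>r.
        F p v \<in> tspace A p \<and> F p (v + v') = F p v + F p v' \<and> F p (r *\<^sub>R v) = r *\<^sub>R F p v) \<and>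
     (\<forall>U X. openin (mtop A) U \<and> vfield A U X \<longrightarrow> vfield A U (\<lambda>p. F p (X p)))"

text \<open>Definiteness is not required.\<close>

definition pseudo_metric :: "('m, 'i::finite) chart set \<Rightarrow>
    ('m \<Rightarrow> ('m, 'i) tvec \<Rightarrow> ('m, 'i) tvec \<Rightarrow> real) \<Rightarrow> bool" where
  "pseudo_metric A g \<longleftrightarrow>
     (\<forall>p\<in>mcarrier A. \<forall>v\<in>tspace A p. \<forall>v'\<in>tspace A p. \<forall>w\<in>tspace A p. \<forall>r.
        g p (v + v') w = g p v w + g p v' w \<and> g p (r *\<^sub>R v) w = r * g p v w \<and> g p v w = g p w v) \<and>
     (\<forall>p\<in>mcarrier A. \<forall>v\<in>tspace A p. (\<forall>w\<in>tspace A p. g p v w = 0) \<longrightarrow> v = 0) \<and>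
     (\<forall>U X Y. openin (mtop A) U \<and> vfield A U X \<and> vfield A U Y \<longrightarrow>
        smooth_fun A U (\<lambda>p. g p (X p) (Y p)))"

definition ext_deriv :: "('m, 'i::finite) chart set \<Rightarrow> ('m \<Rightarrow> ('m, 'i) tvec \<Rightarrow> real) \<Rightarrow>
    ('m \<Rightarrow> ('m, 'i) tvec) \<Rightarrow> ('m \<Rightarrow> ('m, 'i) tvec) \<Rightarrow> 'm \<Rightarrow> real" where
  "ext_deriv A w X Y p =
     (tderiv A (X p) (\<lambda>q. w q (Y q)) p - tderiv A (Y p) (\<lambda>q. w q (X q)) p
        - w p (lie_bracket A X Y p)) / 2"

definition lie_metric :: "('m, 'i::finite) chart set \<Rightarrow> ('m \<Rightarrow> ('m, 'i) tvec) \<Rightarrow>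
    ('m \<Rightarrow> ('m, 'i) tvec \<Rightarrow> ('m, 'i) tvec \<Rightarrow> real) \<Rightarrow>
    ('m \<Rightarrow> ('m, 'i) tvec) \<Rightarrow> ('m \<Rightarrow> ('m, 'i) tvec) \<Rightarrow> 'm \<Rightarrow> real" where
  "lie_metric A Z g X Y p = tderiv A (Z p) (\<lambda>q. g q (X q) (Y q)) p
     - g p (lie_bracket A Z X p) (Y p) - g p (X p) (lie_bracket A Z Y p)"

section \<open>Almost contact metric structures\<close>

definition almost_contact_metric :: "('m, 'i::finite) chart set \<Rightarrow>
    ('m \<Rightarrow> ('m, 'i) tvec \<Rightarrow> ('m, 'i) tvec) \<Rightarrow> ('m \<Rightarrow> ('m, 'i) tvec) \<Rightarrow>
    ('m \<Rightarrow> ('m, 'i) tvec \<Rightarrow> real) \<Rightarrow> ('m \<Rightarrow> ('m, 'i) tvec \<Rightarrow> ('m, 'i) tvec \<Rightarrow> real) \<Rightarrow> bool" where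
  "almost_contact_metric A \<phi> \<xi> \<eta> g \<longleftrightarrow>
     endo_field A \<phi> \<and> vfield A (mcarrier A) \<xi> \<and> one_form A \<eta> \<and> pseudo_metric A g \<and>
     (\<forall>p\<in>mcarrier A. \<eta> p (\<xi> p) = 1 \<and> \<phi> p (\<xi> p) = 0 \<and>
        (\<forall>v\<in>tspace A p. \<eta> p (\<phi> p v) = 0 \<and> \<phi> p (\<phi> p v) = - v + \<eta> p v *\<^sub>R \<xi> p \<and>
           (\<forall>w\<in>tspace A p. g p (\<phi> p v) (\<phi> p w) = g p v w - \<eta> p v * \<eta> p w))) \<and>
     (\<forall>U X. openin (mtop A) U \<and> vfield A U X \<longrightarrow> (\<forall>p\<in>U. ext_deriv A \<eta> \<xi> X p = 0))"

definition contact_metric :: "('m, 'i::finite) chart set \<Rightarrow>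
    ('m \<Rightarrow> ('m, 'i) tvec \<Rightarrow> ('m, 'i) tvec) \<Rightarrow> ('m \<Rightarrow> ('m, 'i) tvec) \<Rightarrow>
    ('m \<Rightarrow> ('m, 'i) tvec \<Rightarrow> real) \<Rightarrow> ('m \<Rightarrow> ('m, 'i) tvec \<Rightarrow> ('m, 'i) tvec \<Rightarrow> real) \<Rightarrow> bool" where
  "contact_metric A \<phi> \<xi> \<eta> g \<longleftrightarrow> almost_contact_metric A \<phi> \<xi> \<eta> g \<and>
     (\<forall>U X Y. openin (mtop A) U \<and> vfield A U X \<and> vfield A U Y \<longrightarrow>
        (\<forall>p\<in>U. g p (X p) (\<phi> p (Y p)) = ext_deriv A \<eta> X Y p))"

text \<open>The condition \<open>L\<^sub>Z g = 0\<close> for an almost contact metric structure with structure vector field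
  \<open>Z\<close> and metric \<open>g\<close>. For a contact metric structure \<open>d\<eta>\<close> has maximal rank, so there it is the
  K-contact condition.\<close>

definition almost_K_contact :: "('m, 'i::finite) chart set \<Rightarrow> ('m \<Rightarrow> ('m, 'i) tvec) \<Rightarrow>
    ('m \<Rightarrow> ('m, 'i) tvec \<Rightarrow> ('m, 'i) tvec \<Rightarrow> real) \<Rightarrow> bool" where
  "almost_K_contact A Z g \<longleftrightarrow>
     (\<forall>U X Y. openin (mtop A) U \<and> vfield A U X \<and> vfield A U Y \<longrightarrow>
        (\<forall>p\<in>U. lie_metric A Z g X Y p = 0))"

section \<open>The distribution D, the intrinsic metric connection, and N\<close>

definition Dsection :: "('m, 'i::finite) chart set \<Rightarrow> ('m \<Rightarrow> ('m, 'i) tvec \<Rightarrow> real) \<Rightarrow> 'm set \<Rightarrow>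
    ('m \<Rightarrow> ('m, 'i) tvec) \<Rightarrow> bool" where
  "Dsection A \<eta> U X \<longleftrightarrow> vfield A U X \<and> (\<forall>p\<in>U. \<eta> p (X p) = 0)"

text \<open>The connection acts on the sections of \<open>D\<close> over an open set \<open>U\<close>, so that it can be applied to
  the frame of an adapted chart. By uniqueness, the connections for different \<open>U\<close> are restrictions
  of each other.\<close>

definition intrinsic_metric_connection :: "('m, 'i::finite) chart set \<Rightarrow> ('m \<Rightarrow> ('m, 'i) tvec) \<Rightarrow>
    ('m \<Rightarrow> ('m, 'i) tvec \<Rightarrow> real) \<Rightarrow> ('m \<Rightarrow> ('m, 'i) tvec \<Rightarrow> ('m, 'i) tvec \<Rightarrow> real) \<Rightarrow> 'm set \<Rightarrow>
    (('m \<Rightarrow> ('m, 'i) tvec) \<Rightarrow> ('m \<Rightarrow> ('m, 'i) tvec) \<Rightarrow> 'm \<Rightarrow> ('m, 'i) tvec) \<Rightarrow> bool" where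
  "intrinsic_metric_connection A \<xi> \<eta> g U nab \<longleftrightarrow>
     (\<forall>X Y Z f. Dsection A \<eta> U X \<and> Dsection A \<eta> U Y \<and> Dsection A \<eta> U Z \<and> smooth_fun A U f \<longrightarrow>
        Dsection A \<eta> U (nab X Y) \<and>
        (\<forall>p\<in>U.
           nab (\<lambda>q. X q + Z q) Y p = nab X Y p + nab Z Y p \<and>
           nab (\<lambda>q. f q *\<^sub>R X q) Y p = f p *\<^sub>R nab X Y p \<and>
           nab X (\<lambda>q. Y q + Z q) p = nab X Y p + nab X Z p \<and>
           nab X (\<lambda>q. f q *\<^sub>R Y q) p = tderiv A (X p) f p *\<^sub>R Y p + f p *\<^sub>R nab X Y p \<and>
           tderiv A (Z p) (\<lambda>q. g q (X q) (Y q)) p = g p (nab Z X p) (Y p) + g p (X p) (nab Z Y p) \<and>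
           nab X Y p - nab Y X p =
             lie_bracket A X Y p - \<eta> p (lie_bracket A X Y p) *\<^sub>R \<xi> p))"

definition N_endomorphism :: "('m, 'i::finite) chart set \<Rightarrow> ('m \<Rightarrow> ('m, 'i) tvec) \<Rightarrow>
    ('m \<Rightarrow> ('m, 'i) tvec \<Rightarrow> real) \<Rightarrow> ('m \<Rightarrow> ('m, 'i) tvec \<Rightarrow> ('m, 'i) tvec \<Rightarrow> real) \<Rightarrow>
    ('m \<Rightarrow> ('m, 'i) tvec \<Rightarrow> ('m, 'i) tvec) \<Rightarrow> bool" where
  "N_endomorphism A \<xi> \<eta> g N \<longleftrightarrow>
     (\<forall>p\<in>mcarrier A. \<forall>v\<in>tspace A p. \<forall>w\<in>tspace A p. \<forall>r. \<eta> p v = 0 \<and> \<eta> p w = 0 \<longrightarrow>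
        N p v \<in> tspace A p \<and> \<eta> p (N p v) = 0 \<and>
        N p (v + w) = N p v + N p w \<and> N p (r *\<^sub>R v) = r *\<^sub>R N p v) \<and>
     (\<forall>U X. openin (mtop A) U \<and> Dsection A \<eta> U X \<longrightarrow> Dsection A \<eta> U (\<lambda>p. N p (X p))) \<and>
     (\<forall>U X Y. openin (mtop A) U \<and> Dsection A \<eta> U X \<and> Dsection A \<eta> U Y \<longrightarrow>
        (\<forall>p\<in>U. g p (N p (X p)) (Y p) = lie_metric A \<xi> g X Y p / 2))"

section \<open>Adapted charts and the total space of D\<close>

text \<open>The index \<open>n\<close> of the last coordinate.\<close>

definition last_idx :: "'i::{finite, linorder}" where
  "last_idx = Max UNIV"

definition adapted :: "('m, 'i::{finite, linorder}) chart set \<Rightarrow> ('m \<Rightarrow> ('m, 'i) tvec) \<Rightarrow>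
    ('m, 'i) chart \<Rightarrow> bool" where
  "adapted A \<xi> c \<longleftrightarrow> c \<in> A \<and> (\<forall>p\<in>fst c. \<xi> p = coord_vec A c last_idx p)"

text \<open>Since \<open>\<eta>(\<partial>\<^sub>n) = 1\<close> in an adapted chart, \<open>\<Gamma>\<^sup>n\<^sub>a = \<eta>(\<partial>\<^sub>a)\<close> is the function for which
  \<open>\<eta> = dx\<^sup>n + \<Gamma>\<^sup>n\<^sub>a dx\<^sup>a\<close> and \<open>\<partial>\<^sub>a - \<Gamma>\<^sup>n\<^sub>a \<partial>\<^sub>n\<close> lies in \<open>D\<close>.\<close>

definition Gamma_n :: "('m, 'i::{finite, linorder}) chart set \<Rightarrow> ('m \<Rightarrow> ('m, 'i) tvec \<Rightarrow> real) \<Rightarrow>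
    ('m, 'i) chart \<Rightarrow> 'i \<Rightarrow> 'm \<Rightarrow> real" where
  "Gamma_n A \<eta> c a p = \<eta> p (coord_vec A c a p)"

definition e_frame :: "('m, 'i::{finite, linorder}) chart set \<Rightarrow> ('m \<Rightarrow> ('m, 'i) tvec \<Rightarrow> real) \<Rightarrow>
    ('m, 'i) chart \<Rightarrow> 'i \<Rightarrow> 'm \<Rightarrow> ('m, 'i) tvec" where
  "e_frame A \<eta> c a p = coord_vec A c a p - Gamma_n A \<eta> c a p *\<^sub>R coord_vec A c last_idx p"

text \<open>For \<open>v = \<Sum>\<^sub>b v\<^sup>b e\<^sub>b\<close> in \<open>D\<close> and \<open>a \<noteq> n\<close>, the component \<open>v\<^sup>a\<close> in the basis \<open>e\<^sub>b\<close> is the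
  \<open>a\<close>-th coordinate component of \<open>v\<close>, because \<open>e\<^sub>b = \<partial>\<^sub>b - \<Gamma>\<^sup>n\<^sub>b \<partial>\<^sub>n\<close>.\<close>

definition e_comp :: "('m, 'i::finite) chart \<Rightarrow> 'i \<Rightarrow> ('m, 'i) tvec \<Rightarrow> real" where
  "e_comp c a v = v c $ a"

text \<open>\<open>Christoffel \<dots> d a b\<close> is \<open>\<Gamma>\<^sup>d\<^sub>a\<^sub>b\<close> and \<open>N_comp \<dots> a b\<close> is \<open>N\<^sup>a\<^sub>b\<close>.\<close>

definition Christoffel :: "('m, 'i::{finite, linorder}) chart set \<Rightarrow> ('m \<Rightarrow> ('m, 'i) tvec \<Rightarrow> real) \<Rightarrow>
    ('m set \<Rightarrow> ('m \<Rightarrow> ('m, 'i) tvec) \<Rightarrow> ('m \<Rightarrow> ('m, 'i) tvec) \<Rightarrow> 'm \<Rightarrow> ('m, 'i) tvec) \<Rightarrow>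
    ('m, 'i) chart \<Rightarrow> 'i \<Rightarrow> 'i \<Rightarrow> 'i \<Rightarrow> 'm \<Rightarrow> real" where
  "Christoffel A \<eta> nab c d a b p = e_comp c d (nab (fst c) (e_frame A \<eta> c a) (e_frame A \<eta> c b) p)"

definition N_comp :: "('m, 'i::{finite, linorder}) chart set \<Rightarrow> ('m \<Rightarrow> ('m, 'i) tvec \<Rightarrow> real) \<Rightarrow>
    ('m \<Rightarrow> ('m, 'i) tvec \<Rightarrow> ('m, 'i) tvec) \<Rightarrow> ('m, 'i) chart \<Rightarrow> 'i \<Rightarrow> 'i \<Rightarrow> 'm \<Rightarrow> real" where
  "N_comp A \<eta> N c a b p = e_comp c a (N p (e_frame A \<eta> c b p))"

text \<open>The \<open>2n - 1\<close> coordinate indices of the total space: \<open>Base \<alpha>\<close> stands for \<open>\<alpha> = 1, \<dots>, n\<close>, and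
  \<open>Fib a\<close> stands for \<open>n + a\<close> with \<open>a = 1, \<dots>, n - 1\<close> (it is meaningless for \<open>a = n\<close>).\<close>

typedef (overloaded) ('i::"{finite, linorder}") tot_idx =
  "{k :: 'i + 'i. k \<noteq> Inr last_idx}"
  by (rule exI [of _ "Inl last_idx"]) simp

instance tot_idx :: ("{finite, linorder}") finite
proof
  have "finite (Rep_tot_idx ` (UNIV :: 'a tot_idx set))"
    by simp
  then show "finite (UNIV :: 'a tot_idx set)"
    by (rule finite_imageD) (simp add: inj_on_def Rep_tot_idx_inject)
qed

definition Base :: "'i::{finite, linorder} \<Rightarrow> 'i tot_idx" where
  "Base i = Abs_tot_idx (Inl i)"

definition Fib :: "'i::{finite, linorder} \<Rightarrow> 'i tot_idx" where
  "Fib a = Abs_tot_idx (Inr a)"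

definition D_total :: "('m, 'i::finite) chart set \<Rightarrow> ('m \<Rightarrow> ('m, 'i) tvec \<Rightarrow> real) \<Rightarrow>
    ('m \<times> ('m, 'i) tvec) set" where
  "D_total A \<eta> = {(p, v). p \<in> mcarrier A \<and> v \<in> tspace A p \<and> \<eta> p v = 0}"

definition D_chart :: "('m, 'i::{finite, linorder}) chart set \<Rightarrow> ('m \<Rightarrow> ('m, 'i) tvec \<Rightarrow> real) \<Rightarrow>
    ('m, 'i) chart \<Rightarrow> ('m \<times> ('m, 'i) tvec, 'i tot_idx) chart" where
  "D_chart A \<eta> c =
     ({z \<in> D_total A \<eta>. fst z \<in> fst c},
      \<lambda>z. \<chi> k. case Rep_tot_idx k of Inl i \<Rightarrow> snd c (fst z) $ i | Inr a \<Rightarrow> e_comp c a (snd z))"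

definition D_atlas :: "('m, 'i::{finite, linorder}) chart set \<Rightarrow> ('m \<Rightarrow> ('m, 'i) tvec) \<Rightarrow>
    ('m \<Rightarrow> ('m, 'i) tvec \<Rightarrow> real) \<Rightarrow> ('m \<times> ('m, 'i) tvec, 'i tot_idx) chart set" where
  "D_atlas A \<xi> \<eta> = D_chart A \<eta> ` {c. adapted A \<xi> c}"

section \<open>The prolonged almost contact metric structure\<close>

text \<open>The frame \<open>\<epsilon>\<^sub>a\<close>, \<open>u\<close>, \<open>\<partial>\<^sub>n\<^sub>+\<^sub>a\<close> of the total space over the adapted chart \<open>c\<close>, at the point
  \<open>z\<close>.\<close>

definition vert_frame :: "('m, 'i::{finite, linorder}) chart set \<Rightarrow> ('m \<Rightarrow> ('m, 'i) tvec) \<Rightarrow>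
    ('m \<Rightarrow> ('m, 'i) tvec \<Rightarrow> real) \<Rightarrow> ('m, 'i) chart \<Rightarrow> 'i \<Rightarrow>
    'm \<times> ('m, 'i) tvec \<Rightarrow> ('m \<times> ('m, 'i) tvec, 'i tot_idx) tvec" where
  "vert_frame A \<xi> \<eta> c a z = coord_vec (D_atlas A \<xi> \<eta>) (D_chart A \<eta> c) (Fib a) z"

definition eps_frame :: "('m, 'i::{finite, linorder}) chart set \<Rightarrow> ('m \<Rightarrow> ('m, 'i) tvec) \<Rightarrow>
    ('m \<Rightarrow> ('m, 'i) tvec \<Rightarrow> real) \<Rightarrow>
    ('m set \<Rightarrow> ('m \<Rightarrow> ('m, 'i) tvec) \<Rightarrow> ('m \<Rightarrow> ('m, 'i) tvec) \<Rightarrow> 'm \<Rightarrow> ('m, 'i) tvec) \<Rightarrow>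
    ('m, 'i) chart \<Rightarrow> 'i \<Rightarrow>
    'm \<times> ('m, 'i) tvec \<Rightarrow> ('m \<times> ('m, 'i) tvec, 'i tot_idx) tvec" where
  "eps_frame A \<xi> \<eta> nab c a z =
     coord_vec (D_atlas A \<xi> \<eta>) (D_chart A \<eta> c) (Base a) z
     - Gamma_n A \<eta> c a (fst z) *\<^sub>R coord_vec (D_atlas A \<xi> \<eta>) (D_chart A \<eta> c) (Base last_idx) z
     - (\<Sum>b\<in>- {last_idx}. \<Sum>d\<in>- {last_idx}.
          (Christoffel A \<eta> nab c b a d (fst z) * snd (D_chart A \<eta> c) z $ Fib d)
            *\<^sub>R vert_frame A \<xi> \<eta> c b z)"

definition u_frame :: "('m, 'i::{finite, linorder}) chart set \<Rightarrow> ('m \<Rightarrow> ('m, 'i) tvec) \<Rightarrow>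
    ('m \<Rightarrow> ('m, 'i) tvec \<Rightarrow> real) \<Rightarrow> ('m \<Rightarrow> ('m, 'i) tvec \<Rightarrow> ('m, 'i) tvec) \<Rightarrow> ('m, 'i) chart \<Rightarrow>
    'm \<times> ('m, 'i) tvec \<Rightarrow> ('m \<times> ('m, 'i) tvec, 'i tot_idx) tvec" where
  "u_frame A \<xi> \<eta> N c z =
     coord_vec (D_atlas A \<xi> \<eta>) (D_chart A \<eta> c) (Base last_idx) z
     - (\<Sum>a\<in>- {last_idx}. \<Sum>b\<in>- {last_idx}.
          (N_comp A \<eta> N c a b (fst z) * snd (D_chart A \<eta> c) z $ Fib b)
            *\<^sub>R vert_frame A \<xi> \<eta> c a z)"

text \<open>The prolonged structure consists of the smooth tensor fields on the total space which have
  the prescribed values on the frame of every adapted chart; these values determine the fields,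
  and agree on the overlaps of adapted charts.\<close>

definition prolonged_structure :: "('m, 'i::{finite, linorder}) chart set \<Rightarrow> ('m \<Rightarrow> ('m, 'i) tvec) \<Rightarrow>
    ('m \<Rightarrow> ('m, 'i) tvec \<Rightarrow> real) \<Rightarrow> ('m \<Rightarrow> ('m, 'i) tvec \<Rightarrow> ('m, 'i) tvec \<Rightarrow> real) \<Rightarrow>
    ('m set \<Rightarrow> ('m \<Rightarrow> ('m, 'i) tvec) \<Rightarrow> ('m \<Rightarrow> ('m, 'i) tvec) \<Rightarrow> 'm \<Rightarrow> ('m, 'i) tvec) \<Rightarrow>
    ('m \<Rightarrow> ('m, 'i) tvec \<Rightarrow> ('m, 'i) tvec) \<Rightarrow>
    ('m \<times> ('m, 'i) tvec \<Rightarrow> ('m \<times> ('m, 'i) tvec, 'i tot_idx) tvec \<Rightarrow>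
       ('m \<times> ('m, 'i) tvec, 'i tot_idx) tvec) \<Rightarrow>
    ('m \<times> ('m, 'i) tvec \<Rightarrow> ('m \<times> ('m, 'i) tvec, 'i tot_idx) tvec) \<Rightarrow>
    ('m \<times> ('m, 'i) tvec \<Rightarrow> ('m \<times> ('m, 'i) tvec, 'i tot_idx) tvec \<Rightarrow> real) \<Rightarrow>
    ('m \<times> ('m, 'i) tvec \<Rightarrow> ('m \<times> ('m, 'i) tvec, 'i tot_idx) tvec \<Rightarrow>
       ('m \<times> ('m, 'i) tvec, 'i tot_idx) tvec \<Rightarrow> real) \<Rightarrow> bool" where
  "prolonged_structure A \<xi> \<eta> g nab N J u lam G \<longleftrightarrow>
     endo_field (D_atlas A \<xi> \<eta>) J \<and> vfield (D_atlas A \<xi> \<eta>) (D_total A \<eta>) u \<and>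
     one_form (D_atlas A \<xi> \<eta>) lam \<and> pseudo_metric (D_atlas A \<xi> \<eta>) G \<and>
     (\<forall>z\<in>D_total A \<eta>. \<forall>V\<in>tspace (D_atlas A \<xi> \<eta>) z.
        lam z V = \<eta> (fst z) (pushforward (D_atlas A \<xi> \<eta>) A fst z V)) \<and>
     (\<forall>c z. adapted A \<xi> c \<and> z \<in> fst (D_chart A \<eta> c) \<longrightarrow>
        u z = u_frame A \<xi> \<eta> N c z \<and>
        J z (u_frame A \<xi> \<eta> N c z) = 0 \<and>
        G z (u_frame A \<xi> \<eta> N c z) (u_frame A \<xi> \<eta> N c z) = 1 \<and>
        (\<forall>a\<in>- {last_idx}.
           J z (eps_frame A \<xi> \<eta> nab c a z) = vert_frame A \<xi> \<eta> c a z \<and>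
           J z (vert_frame A \<xi> \<eta> c a z) = - eps_frame A \<xi> \<eta> nab c a z \<and>
           G z (eps_frame A \<xi> \<eta> nab c a z) (u_frame A \<xi> \<eta> N c z) = 0 \<and>
           G z (u_frame A \<xi> \<eta> N c z) (vert_frame A \<xi> \<eta> c a z) = 0 \<and>
           (\<forall>b\<in>- {last_idx}.
              G z (eps_frame A \<xi> \<eta> nab c a z) (eps_frame A \<xi> \<eta> nab c b z) =
                g (fst z) (e_frame A \<eta> c a (fst z)) (e_frame A \<eta> c b (fst z)) \<and>
              G z (vert_frame A \<xi> \<eta> c a z) (vert_frame A \<xi> \<eta> c b z) =
                g (fst z) (e_frame A \<eta> c a (fst z)) (e_frame A \<eta> c b (fst z)) \<and>
              G z (eps_frame A \<xi> \<eta> nab c a z) (vert_frame A \<xi> \<eta> c b z) = 0)))"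

end

(* In an adapted chart the structure field is the last coordinate field, so L_xi g = 0 says that
   the coefficients g_ij do not depend on the last coordinate x^n; such charts cover X because a
   nonvanishing smooth vector field can be straightened by its flow.

   On the zero section of D the field u is again a coordinate field, with vanishing first
   derivatives in the base directions, and the base coefficients of the prolonged metric are the
   g_ij. Hence L_u of the prolonged metric, evaluated there, is L_xi g. Conversely, if the g_ij do
   not depend on x^n, then N = 0, so u is a coordinate field on all of D; the functions Gamma^n_a,
   and by the Koszul formula the Christoffel symbols, do not depend on x^n either, so neither does
   any coefficient of the prolonged metric. *)

theory Submission
  imports Defs
begin

section \<open>Calculus of maps of class Ck\<close>

text \<open>Most of the work lies in the straightening. A flow map yields a chart of the atlas only
  if it is smooth in the starting point to every order; its derivatives in the parameters solve a
  linearised equation, to which the same result applies one order lower. Since \<open>Ck_on\<close>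
  speaks of derivatives at fixed vectors, derivatives at moving vectors are expanded in a basis
  throughout. Off the zero section \<open>u\<close> need not be a coordinate field, so its Lie
  derivative is not simply a derivative of coefficients. The reduction to coefficients therefore
  requires only that the derivative of the field vanish at one point along the two arguments, and
  base directions on the zero section provide this. In the other direction the coefficients of the
  prolonged metric are not computed. At a point and at its translate along the last coordinate the
  frame of \<open>eps_frame\<close>, \<open>u\<close> and \<open>vert_frame\<close> has the same
  components and the same inner products; as it spans, the coefficients agree. The metric may be
  indefinite, so nondegeneracy on D has to be derived from its orthogonal complement
  \<open>\<xi>\<close>.\<close>

lemma Ck_on_subset: "Ck_on k S f \<Longrightarrow> T \<subseteq> S \<Longrightarrow> Ck_on k T f"
  by (induction k arbitrary: f) (auto intro: continuous_on_subset)

abbreviation fderiv :: "('a::real_normed_vector \<Rightarrow> 'b::real_normed_vector) \<Rightarrow> 'a \<Rightarrow> 'a \<Rightarrow> 'b"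
  where "fderiv f x \<equiv> frechet_derivative f (at x)"

lemma has_derivative_cong_open:
  assumes "open S" "x \<in> S" "\<And>x. x \<in> S \<Longrightarrow> f x = g x"
  shows "(f has_derivative D) (at x) \<longleftrightarrow> (g has_derivative D) (at x)"
  using assms has_derivative_transform_within_open[of f D x UNIV S g]
    has_derivative_transform_within_open[of g D x UNIV S f] by auto

lemma fderiv_cong:
  assumes "open S" "x \<in> S" "\<And>x. x \<in> S \<Longrightarrow> f x = g x"
  shows "fderiv f x = fderiv g x"
  unfolding frechet_derivative_def using has_derivative_cong_open[OF assms] by simp

lemma differentiable_cong_open:
  assumes "open S" "x \<in> S" "\<And>x. x \<in> S \<Longrightarrow> f x = g x"
  shows "f differentiable (at x) \<longleftrightarrow> g differentiable (at x)"
  unfolding differentiable_def using has_derivative_cong_open[OF assms] by simp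

lemma Ck_on_cong:
  assumes "open S" "\<And>x. x \<in> S \<Longrightarrow> f x = g x"
  shows "Ck_on k S f \<longleftrightarrow> Ck_on k S g"
  using assms(2)
proof (induction k arbitrary: f g)
  case 0
  then show ?case by (simp cong: continuous_on_cong)
next
  case (Suc k)
  have "Ck_on k S (\<lambda>x. fderiv f x v) \<longleftrightarrow> Ck_on k S (\<lambda>x. fderiv g x v)" for v
  proof (rule Suc.IH)
    show "fderiv f x v = fderiv g x v" if "x \<in> S" for x
      using fderiv_cong[OF assms(1) that Suc.prems] by simp
  qed
  moreover have "\<forall>x\<in>S. f differentiable (at x) \<longleftrightarrow> g differentiable (at x)"
    using differentiable_cong_open[OF assms(1)] Suc.prems by blast
  ultimately show ?case by auto
qed

lemma Ck_on_fderiv: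
  assumes "Ck_on (Suc k) S f" "x \<in> S"
  shows "(f has_derivative fderiv f x) (at x)"
  using assms frechet_derivative_works by auto

lemma Ck_on_SucI:
  assumes "open S" "\<And>x. x \<in> S \<Longrightarrow> (f has_derivative f' x) (at x)"
    and "\<And>v. Ck_on k S (\<lambda>x. f' x v)"
  shows "Ck_on (Suc k) S f"
proof -
  have eq: "fderiv f x = f' x" if "x \<in> S" for x
    using assms(2)[OF that] frechet_derivative_at by metis
  have "Ck_on k S (\<lambda>x. fderiv f x v)" for v
    using Ck_on_cong[OF assms(1), of "\<lambda>x. fderiv f x v" "\<lambda>x. f' x v"] eq assms(3)
    by auto
  then show ?thesis
    using assms(2) by (auto simp: differentiable_def)
qed

lemma Ck_on_imp_continuous_on: "Ck_on k S f \<Longrightarrow> continuous_on S f"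
  by (cases k) (auto intro!: differentiable_imp_continuous_on
      simp: differentiable_on_def differentiable_at_withinI)

lemma Ck_on_SucD: "Ck_on (Suc k) S f \<Longrightarrow> Ck_on k S f"
proof (induction k arbitrary: f)
  case 0
  then show ?case using Ck_on_imp_continuous_on[OF 0] by (simp only: Ck_on.simps)
next
  case (Suc k)
  then have "\<forall>v. Ck_on (Suc k) S (\<lambda>x. fderiv f x v)"
    using Ck_on.simps(2)[of "Suc k" S f] by blast
  then have "\<forall>v. Ck_on k S (\<lambda>x. fderiv f x v)"
    using Suc.IH by blast
  then show ?case using Suc.prems by auto
qed

lemma Ck_on_Suc_imp_Suc_0: "Ck_on (Suc k) S f \<Longrightarrow> Ck_on (Suc 0) S f"
proof (induction k)
  case (Suc k)
  show ?case by (rule Suc.IH[OF Ck_on_SucD[OF Suc.prems]])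
qed

lemma Ck_on_const: "open S \<Longrightarrow> Ck_on k S (\<lambda>x. c)"
proof (induction k arbitrary: c)
  case (Suc k)
  show ?case by (rule Ck_on_SucI[where f'="\<lambda>x v. 0"]) (use Suc in auto)
qed auto

lemma Ck_on_linear:
  assumes "open S" "bounded_linear L" "Ck_on k S f"
  shows "Ck_on k S (\<lambda>x. L (f x))"
  using assms(3)
proof (induction k arbitrary: f)
  case 0
  then show ?case using assms(2) by (simp add: bounded_linear.continuous_on)
next
  case (Suc k)
  show ?case
  proof (rule Ck_on_SucI[OF assms(1)])
    show "((\<lambda>x. L (f x)) has_derivative (\<lambda>v. L (fderiv f x v))) (at x)" if "x \<in> S" for x
      using bounded_linear.has_derivative[OF assms(2) Ck_on_fderiv[OF Suc.prems that]] .
    show "Ck_on k S (\<lambda>x. L (fderiv f x v))" for v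
      using Suc by simp
  qed
qed

lemma Ck_on_id: "open S \<Longrightarrow> Ck_on k S (\<lambda>x. x)"
proof (cases k)
  case (Suc j)
  assume "open S"
  then show ?thesis unfolding Suc
    by (intro Ck_on_SucI[where f'="\<lambda>x v. v"] Ck_on_const) auto
qed auto

lemma Ck_on_add:
  assumes "open S" "Ck_on k S f" "Ck_on k S g"
  shows "Ck_on k S (\<lambda>x. f x + g x)"
  using assms(2,3)
proof (induction k arbitrary: f g)
  case (Suc k)
  show ?case
    by (rule Ck_on_SucI[OF assms(1) has_derivative_add[OF
          Ck_on_fderiv[OF Suc.prems(1)] Ck_on_fderiv[OF Suc.prems(2)]]])
      (use Suc.prems in \<open>auto intro!: Suc.IH\<close>)
qed (auto intro: continuous_on_add)

lemma Ck_on_bilinear: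
  assumes "open S" "bounded_bilinear B" "Ck_on k S f" "Ck_on k S g"
  shows "Ck_on k S (\<lambda>x. B (f x) (g x))"
  using assms(3,4)
proof (induction k arbitrary: f g)
  case 0
  then show ?case using assms(2) by (simp add: bounded_bilinear.continuous_on)
next
  case (Suc k)
  have fg: "Ck_on k S f" "Ck_on k S g" using Suc.prems Ck_on_SucD by blast+
  show ?case
    by (rule Ck_on_SucI[OF assms(1) bounded_bilinear.FDERIV[OF assms(2)
          Ck_on_fderiv[OF Suc.prems(1)] Ck_on_fderiv[OF Suc.prems(2)]]])
      (use Suc.prems fg in \<open>auto intro!: Ck_on_add[OF assms(1)] Suc.IH\<close>)
qed

lemmas Ck_on_scaleR = Ck_on_bilinear[OF _ bounded_bilinear_scaleR]
lemmas Ck_on_inner_left = Ck_on_linear[OF _ bounded_linear_inner_left]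

lemma Ck_on_sum:
  assumes "open S" "\<And>i. i \<in> I \<Longrightarrow> Ck_on k S (f i)"
  shows "Ck_on k S (\<lambda>x. \<Sum>i\<in>I. f i x)"
  using assms(2)
  by (induction I rule: infinite_finite_induct)
    (auto intro!: Ck_on_const Ck_on_add assms(1))

lemma Ck_on_componentwise:
  fixes f :: "'a::real_normed_vector \<Rightarrow> 'b::euclidean_space"
  assumes "open S" "\<And>b. b \<in> Basis \<Longrightarrow> Ck_on k S (\<lambda>x. f x \<bullet> b)"
  shows "Ck_on k S f"
proof -
  have "Ck_on k S (\<lambda>x. \<Sum>b\<in>Basis. (f x \<bullet> b) *\<^sub>R b)"
    by (intro Ck_on_sum Ck_on_scaleR Ck_on_const assms)
  then show ?thesis by (simp add: euclidean_representation)
qed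

lemma linear_expand:
  fixes v :: "'a::euclidean_space"
  assumes "linear D"
  shows "D v = (\<Sum>b\<in>Basis. (v \<bullet> b) *\<^sub>R D b)"
  using assms by (metis (no_types, lifting) euclidean_representation linear_scale linear_sum sum.cong)

text \<open>\<open>Ck_on\<close> gives continuity and bounds of a derivative only for each fixed
  vector. Summing the bounds over the basis turns them into the operator bounds that mean value
  estimates need.\<close>

lemma norm_linear_le:
  fixes D :: "'a::euclidean_space \<Rightarrow> 'b::real_normed_vector"
  assumes "linear D" "\<And>b. b \<in> Basis \<Longrightarrow> norm (D b) \<le> m b"
  shows "norm (D v) \<le> (\<Sum>b\<in>Basis. m b) * norm v"
proof -
  have "norm (D v) \<le> (\<Sum>b\<in>Basis. m b * norm v)"
    unfolding linear_expand[OF assms(1), of v]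
  proof (rule sum_norm_le)
    fix b :: 'a assume b: "b \<in> Basis"
    have "\<bar>v \<bullet> b\<bar> * norm (D b) \<le> norm v * m b"
      using Basis_le_norm[OF b, of v] assms(2)[OF b] by (intro mult_mono) auto
    then show "norm ((v \<bullet> b) *\<^sub>R D b) \<le> m b * norm v" by (simp add: mult.commute)
  qed
  then show ?thesis by (simp add: sum_distrib_right)
qed

text \<open>The chain rule applies \<open>fderiv f (g x)\<close> to the vector
  \<open>fderiv g x v\<close>, which moves with \<open>x\<close>, whereas \<open>Ck_on\<close>
  controls only fixed vectors. Expanding that vector in \<open>Basis\<close> separates the two
  dependences; this is why the middle space is Euclidean.\<close>

lemma Ck_on_compose:
  fixes g :: "'a::real_normed_vector \<Rightarrow> 'b::euclidean_space" and f :: "'b \<Rightarrow> 'c::real_normed_vector"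
  assumes "open S" "open T" "Ck_on k T f" "Ck_on k S g" "\<And>x. x \<in> S \<Longrightarrow> g x \<in> T"
  shows "Ck_on k S (\<lambda>x. f (g x))"
  using assms(3,4)
proof (induction k arbitrary: f)
  case 0
  then show ?case using assms(5)
    by (auto intro: continuous_on_compose2)
next
  case (Suc k)
  have g: "Ck_on k S g" using Suc.prems Ck_on_SucD by blast
  have der: "((\<lambda>x. f (g x)) has_derivative
     (\<lambda>v. \<Sum>b\<in>Basis. (fderiv g x v \<bullet> b) *\<^sub>R fderiv f (g x) b)) (at x)"
    if "x \<in> S" for x
  proof -
    note f = Ck_on_fderiv[OF Suc.prems(1) assms(5)[OF that]]
    show ?thesis
      by (rule has_derivative_eq_rhs[OF has_derivative_compose[OF Ck_on_fderiv[OF Suc.prems(2) that] f]])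
        (rule ext, rule linear_expand[OF has_derivative_linear[OF f]])
  qed
  show ?case
  proof (rule Ck_on_SucI[OF assms(1) der])
    fix v
    show "Ck_on k S (\<lambda>x. \<Sum>b\<in>Basis. (fderiv g x v \<bullet> b) *\<^sub>R fderiv f (g x) b)"
    proof (intro Ck_on_sum Ck_on_scaleR Ck_on_inner_left assms(1))
      show "Ck_on k S (\<lambda>x. fderiv g x v)" using Suc.prems(2) by simp
      show "Ck_on k S (\<lambda>x. fderiv f (g x) b)" for b
        by (rule Suc.IH) (use Suc.prems(1) g in simp_all)
    qed
  qed
qed

lemma Ck_on_Pair:
  assumes "open S" "Ck_on k S f" "Ck_on k S g"
  shows "Ck_on k S (\<lambda>x. (f x, g x))"
proof -
  have L: "bounded_linear (\<lambda>y. (y, 0))" "bounded_linear (\<lambda>y. (0, y))"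
    by (intro bounded_linear_intros)+
  have "Ck_on k S (\<lambda>x. (f x, 0) + (0, g x))"
    by (intro Ck_on_add assms(1) Ck_on_linear[OF assms(1) L(1) assms(2)] Ck_on_linear[OF assms(1) L(2) assms(3)])
  then show ?thesis by simp
qed

lemma smooth_onD: "smooth_on S f \<Longrightarrow> Ck_on k S f"
  by (simp add: smooth_on_def)

lemma smooth_on_fderiv:
  assumes "smooth_on S f" "x \<in> S"
  shows "(f has_derivative fderiv f x) (at x)"
  using Ck_on_fderiv[OF smooth_onD[OF assms(1)] assms(2)] .

lemma smooth_on_frechet: "smooth_on S f \<Longrightarrow> smooth_on S (\<lambda>x. fderiv f x v)"
  by (metis smooth_on_def Ck_on.simps(2))

lemma smooth_on_cong:
  assumes "open S" "\<And>x. x \<in> S \<Longrightarrow> f x = g x"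
  shows "smooth_on S f \<longleftrightarrow> smooth_on S g"
  unfolding smooth_on_def using Ck_on_cong[OF assms] by auto

lemma smooth_on_subset: "smooth_on S f \<Longrightarrow> T \<subseteq> S \<Longrightarrow> smooth_on T f"
  unfolding smooth_on_def using Ck_on_subset by blast

lemma smooth_on_continuous: "smooth_on S f \<Longrightarrow> continuous_on S f"
  using Ck_on_imp_continuous_on smooth_onD by blast

lemma smooth_on_linear: "open S \<Longrightarrow> bounded_linear L \<Longrightarrow> smooth_on S f \<Longrightarrow> smooth_on S (\<lambda>x. L (f x))"
  by (simp add: smooth_on_def Ck_on_linear)
lemma smooth_on_id: "open S \<Longrightarrow> smooth_on S (\<lambda>x. x)"
  by (simp add: smooth_on_def Ck_on_id)
lemma smooth_on_add: "open S \<Longrightarrow> smooth_on S f \<Longrightarrow> smooth_on S g \<Longrightarrow> smooth_on S (\<lambda>x. f x + g x)"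
  by (simp add: smooth_on_def Ck_on_add)
lemma smooth_on_scaleR: "open S \<Longrightarrow> smooth_on S f \<Longrightarrow> smooth_on S g \<Longrightarrow> smooth_on S (\<lambda>x. f x *\<^sub>R g x)"
  by (simp add: smooth_on_def Ck_on_scaleR)
lemma smooth_on_sum: "open S \<Longrightarrow> (\<And>i. i \<in> I \<Longrightarrow> smooth_on S (f i)) \<Longrightarrow> smooth_on S (\<lambda>x. \<Sum>i\<in>I. f i x)"
  by (simp add: smooth_on_def Ck_on_sum)
lemma smooth_on_compose:
  fixes g :: "'a::real_normed_vector \<Rightarrow> 'b::euclidean_space"
  shows "open S \<Longrightarrow> open T \<Longrightarrow> smooth_on T f \<Longrightarrow> smooth_on S g \<Longrightarrow> (\<And>x. x \<in> S \<Longrightarrow> g x \<in> T)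
    \<Longrightarrow> smooth_on S (\<lambda>x. f (g x))"
  by (simp add: smooth_on_def Ck_on_compose[of S T])
lemma smooth_on_frechet_apply:
  fixes f :: "'a::euclidean_space \<Rightarrow> 'b::real_normed_vector"
    and h :: "'c::real_normed_vector \<Rightarrow> 'a"
  assumes "open S" "open T" "smooth_on T f" "smooth_on S h" "\<And>x. x \<in> S \<Longrightarrow> h x \<in> T" "smooth_on S g"
  shows "smooth_on S (\<lambda>x. fderiv f (h x) (g x))"
proof -
  have "smooth_on S (\<lambda>x. \<Sum>b\<in>Basis. (g x \<bullet> b) *\<^sub>R fderiv f (h x) b)"
    by (intro smooth_on_sum smooth_on_scaleR assms(1) smooth_on_compose[OF assms(1,2) smooth_on_frechet[OF assms(3)] assms(4)]
        smooth_on_linear[OF assms(1) bounded_linear_inner_left] assms(5,6))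
  moreover have "(\<Sum>b\<in>Basis. (g x \<bullet> b) *\<^sub>R fderiv f (h x) b) = fderiv f (h x) (g x)"
    if "x \<in> S" for x
    using linear_expand[OF has_derivative_linear[OF smooth_on_fderiv[OF assms(3) assms(5)[OF that]]]]
    by metis
  ultimately show ?thesis using smooth_on_cong[OF assms(1)] by (metis (no_types, lifting))
qed

text \<open>The mean value theorem, applied once along \<open>v\<close> and once along
  \<open>w\<close>. The left side is symmetric in \<open>v\<close> and \<open>w\<close> while the
  right side depends on the order of differentiation, so exchanging them compares the two mixed
  derivatives.\<close>

lemma second_difference_mvt:
  fixes f :: "'a::real_normed_vector \<Rightarrow> real"
  assumes "0 < s" "\<And>a b. 0 \<le> a \<Longrightarrow> a \<le> s \<Longrightarrow> 0 \<le> b \<Longrightarrow> b \<le> s \<Longrightarrow> x + a *\<^sub>R v + b *\<^sub>R w \<in> S"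
    and "Ck_on (Suc (Suc 0)) S f"
  shows "\<exists>a b. 0 \<le> a \<and> a \<le> s \<and> 0 \<le> b \<and> b \<le> s \<and>
     f (x + s *\<^sub>R v + s *\<^sub>R w) - f (x + s *\<^sub>R v) - f (x + s *\<^sub>R w) + f x
     = s * s * fderiv (\<lambda>y. fderiv f y v) (x + a *\<^sub>R v + b *\<^sub>R w) w"
proof -
  have f: "(f has_derivative fderiv f y) (at y)" if "y \<in> S" for y
    using assms(3) that Ck_on_fderiv by blast
  have fv: "((\<lambda>y. fderiv f y v) has_derivative
       fderiv (\<lambda>y. fderiv f y v) y) (at y)" if "y \<in> S" for y
    using frechet_derivative_works[of "\<lambda>y. fderiv f y v" "at y"] assms(3) that by simp
  define h where "h a = f (x + a *\<^sub>R v + s *\<^sub>R w) - f (x + a *\<^sub>R v)" for a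
  have hd: "(h has_real_derivative (fderiv f (x + a *\<^sub>R v + s *\<^sub>R w) v
       - fderiv f (x + a *\<^sub>R v) v)) (at a)" if "0 \<le> a" "a \<le> s" for a
  proof -
    have 1: "x + a *\<^sub>R v + s *\<^sub>R w \<in> S" "x + a *\<^sub>R v \<in> S"
      using assms(2)[of a s] assms(2)[of a 0] that assms(1) by auto
    have "((\<lambda>a. x + a *\<^sub>R v + s *\<^sub>R w) has_derivative (\<lambda>r. r *\<^sub>R v)) (at a)"
      "((\<lambda>a. x + a *\<^sub>R v) has_derivative (\<lambda>r. r *\<^sub>R v)) (at a)"
      by (auto intro!: derivative_eq_intros)
    from has_derivative_compose[OF this(1) f[OF 1(1)]] has_derivative_compose[OF this(2) f[OF 1(2)]]
    have "(h has_derivative (\<lambda>r. fderiv f (x + a *\<^sub>R v + s *\<^sub>R w) (r *\<^sub>R v)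
       - fderiv f (x + a *\<^sub>R v) (r *\<^sub>R v))) (at a)"
      unfolding h_def by (intro has_derivative_diff)
    then show ?thesis
      using linear_scale[OF has_derivative_linear[OF f[OF 1(1)]]] linear_scale[OF has_derivative_linear[OF f[OF 1(2)]]]
      unfolding has_field_derivative_def
      by (elim has_derivative_eq_rhs) (auto simp: fun_eq_iff algebra_simps)
  qed
  obtain a where a: "0 < a" "a < s" "h s - h 0 = (s - 0) * (fderiv f (x + a *\<^sub>R v + s *\<^sub>R w) v
       - fderiv f (x + a *\<^sub>R v) v)"
    using MVT2[OF assms(1) hd] by auto
  define k where "k b = fderiv f (x + a *\<^sub>R v + b *\<^sub>R w) v" for b
  have kd: "(k has_real_derivative fderiv (\<lambda>y. fderiv f y v) (x + a *\<^sub>R v + b *\<^sub>R w) w) (at b)"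
    if "0 \<le> b" "b \<le> s" for b
  proof -
    have 1: "x + a *\<^sub>R v + b *\<^sub>R w \<in> S"
      using assms(2)[of a b] that a by auto
    have "((\<lambda>b. x + a *\<^sub>R v + b *\<^sub>R w) has_derivative (\<lambda>r. r *\<^sub>R w)) (at b)"
      by (auto intro!: derivative_eq_intros)
    from has_derivative_compose[OF this fv[OF 1]]
    show ?thesis
      using linear_scale[OF has_derivative_linear[OF fv[OF 1]]]
      unfolding has_field_derivative_def k_def
      by (elim has_derivative_eq_rhs) (auto simp: fun_eq_iff)
  qed
  obtain b where b: "0 < b" "b < s" "k s - k 0 = (s - 0) *
       fderiv (\<lambda>y. fderiv f y v) (x + a *\<^sub>R v + b *\<^sub>R w) w"
    using MVT2[OF assms(1) kd] by auto
  have "f (x + s *\<^sub>R v + s *\<^sub>R w) - f (x + s *\<^sub>R v) - f (x + s *\<^sub>R w) + f x = h s - h 0"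
    by (simp add: h_def)
  also have "\<dots> = s * (k s - k 0)" using a(3) by (simp add: k_def)
  finally show ?thesis using a b by (intro exI[of _ a] exI[of _ b]) auto
qed

lemma fderiv_symmetric_real:
  fixes f :: "'a::real_normed_vector \<Rightarrow> real"
  assumes "open S" "x \<in> S" "Ck_on (Suc (Suc 0)) S f"
  shows "fderiv (\<lambda>y. fderiv f y v) x w
       = fderiv (\<lambda>y. fderiv f y w) x v" (is "?A x = ?B x")
proof (rule ccontr)
  assume ne: "?A x \<noteq> ?B x"
  define e where "e = \<bar>?A x - ?B x\<bar> / 2"
  have e: "0 < e" using ne by (simp add: e_def)
  have "continuous_on S ?A" "continuous_on S ?B" using assms(3) by auto
  then have "isCont ?A x" "isCont ?B x" using assms(1,2) continuous_on_eq_continuous_at by blast+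
  then obtain d1 d2 where d: "0 < d1" "\<And>y. dist y x < d1 \<Longrightarrow> dist (?A y) (?A x) < e"
     "0 < d2" "\<And>y. dist y x < d2 \<Longrightarrow> dist (?B y) (?B x) < e"
    using e unfolding continuous_at_eps_delta by (metis dist_commute)
  obtain d3 where d3: "0 < d3" "ball x d3 \<subseteq> S" using assms(1,2) openE by blast
  define d where "d = min d1 (min d2 d3)"
  have d0: "0 < d" using d d3 by (simp add: d_def)
  \<comment> \<open>The summand 1 keeps the denominator positive when \<open>v\<close> and
    \<open>w\<close> vanish, and makes the parallelogram with sides \<open>s *\<^sub>R v\<close> and
    \<open>s *\<^sub>R w\<close> lie strictly inside the ball of radius \<open>d\<close>.\<close>
  define s where "s = d / (norm v + norm w + 1)"
  have s0: "0 < s" using d0 by (simp add: s_def add_nonneg_pos)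
  have sd: "s * (norm v + norm w) < d"
  proof -
    have "s * (norm v + norm w + 1) = d"
      using add_nonneg_pos[of "norm v + norm w" 1] by (simp add: s_def)
    then show ?thesis using s0 by (simp add: algebra_simps)
  qed
  have near: "dist (x + a *\<^sub>R v + b *\<^sub>R w) x < d" if "0 \<le> a" "a \<le> s" "0 \<le> b" "b \<le> s" for a b
  proof -
    have "dist (x + a *\<^sub>R v + b *\<^sub>R w) x = norm (a *\<^sub>R v + b *\<^sub>R w)" by (simp add: dist_norm algebra_simps)
    also have "\<dots> \<le> a * norm v + b * norm w"
      using norm_triangle_ineq[of "a *\<^sub>R v" "b *\<^sub>R w"] that by simp
    also have "\<dots> \<le> s * norm v + s * norm w"
      using that by (intro add_mono mult_right_mono) auto
    finally show ?thesis using sd by (simp add: algebra_simps)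
  qed
  have near': "dist (x + b *\<^sub>R w + a *\<^sub>R v) x < d" if "0 \<le> a" "a \<le> s" "0 \<le> b" "b \<le> s" for a b
    using near[OF that] by (simp add: algebra_simps)
  have inS: "y \<in> S" if "dist y x < d" for y
    using that d3 by (auto simp: d_def dist_commute)
  obtain a b where ab: "0 \<le> a" "a \<le> s" "0 \<le> b" "b \<le> s"
    "f (x + s *\<^sub>R v + s *\<^sub>R w) - f (x + s *\<^sub>R v) - f (x + s *\<^sub>R w) + f x = s * s * ?A (x + a *\<^sub>R v + b *\<^sub>R w)"
    using second_difference_mvt[OF s0 _ assms(3), of x v w] near inS by blast
  obtain a' b' where ab': "0 \<le> a'" "a' \<le> s" "0 \<le> b'" "b' \<le> s"
    "f (x + s *\<^sub>R w + s *\<^sub>R v) - f (x + s *\<^sub>R w) - f (x + s *\<^sub>R v) + f x = s * s * ?B (x + a' *\<^sub>R w + b' *\<^sub>R v)"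
    using second_difference_mvt[OF s0 _ assms(3), of x w v] near' inS by blast
  have "x + s *\<^sub>R w + s *\<^sub>R v = x + s *\<^sub>R v + s *\<^sub>R w" by (simp add: algebra_simps)
  then have "s * s * ?A (x + a *\<^sub>R v + b *\<^sub>R w) = s * s * ?B (x + a' *\<^sub>R w + b' *\<^sub>R v)"
    using ab(5) ab'(5)[unfolded \<open>x + s *\<^sub>R w + s *\<^sub>R v = _\<close>] by linarith
  then have eq: "?A (x + a *\<^sub>R v + b *\<^sub>R w) = ?B (x + a' *\<^sub>R w + b' *\<^sub>R v)"
    using s0 mult_cancel_left[of "s * s"] by simp
  have "dist (?A (x + a *\<^sub>R v + b *\<^sub>R w)) (?A x) < e"
    by (rule d(2)) (use near[OF ab(1-4)] in \<open>auto simp: d_def\<close>)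
  moreover have "dist (?B (x + a' *\<^sub>R w + b' *\<^sub>R v)) (?B x) < e"
    by (rule d(4)) (use near'[OF ab'(3,4,1,2)] in \<open>auto simp: d_def\<close>)
  ultimately show False using eq unfolding e_def dist_real_def by (simp add: abs_if split: if_splits)
qed

lemma fderiv_inner_left:
  assumes "f differentiable (at x)"
  shows "fderiv (\<lambda>y. f y \<bullet> b) x v = fderiv f x v \<bullet> b"
proof -
  have "((\<lambda>y. f y \<bullet> b) has_derivative (\<lambda>v. fderiv f x v \<bullet> b)) (at x)"
    using assms frechet_derivative_works by (auto intro!: has_derivative_inner_left)
  then show ?thesis using frechet_derivative_at by metis
qed

lemma fderiv_symmetric:
  fixes f :: "'a::real_normed_vector \<Rightarrow> 'b::euclidean_space"
  assumes "open S" "x \<in> S" "Ck_on (Suc (Suc 0)) S f"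
  shows "fderiv (\<lambda>y. fderiv f y v) x w
       = fderiv (\<lambda>y. fderiv f y w) x v"
proof (rule euclidean_eqI)
  fix b :: 'b assume "b \<in> Basis"
  have k: "Ck_on (Suc (Suc 0)) S (\<lambda>y. f y \<bullet> b)" by (rule Ck_on_inner_left[OF assms(1,3)])
  have 1: "fderiv (\<lambda>y. fderiv (\<lambda>y. f y \<bullet> b) y v) x w
      = fderiv (\<lambda>y. fderiv f y v) x w \<bullet> b" for v w
  proof -
    have "fderiv (\<lambda>y. fderiv (\<lambda>y. f y \<bullet> b) y v) x
       = fderiv (\<lambda>y. fderiv f y v \<bullet> b) x"
      by (rule fderiv_cong[OF assms(1,2)])
        (use assms(3) in \<open>auto intro!: fderiv_inner_left\<close>)
    then show ?thesis
      using assms by (auto intro!: fderiv_inner_left)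
  qed
  show "fderiv (\<lambda>y. fderiv f y v) x w \<bullet> b
       = fderiv (\<lambda>y. fderiv f y w) x v \<bullet> b"
    using fderiv_symmetric_real[OF assms(1,2) k, of v w] 1 by simp
qed

section \<open>Ordinary differential equations\<close>

text \<open>At a maximum \<open>m\<close> of \<open>norm (d t)\<close> the mean value inequality
  bounds \<open>norm (d m)\<close> by its initial value plus
  \<open>S * (L * norm (d m) + e)\<close>. Since \<open>S * L \<le> 1 / 2\<close>, the term with
  \<open>norm (d m)\<close> is absorbed into the left side, which explains the factor 2.\<close>

lemma growth_bound:
  fixes d :: "real \<Rightarrow> 'e::real_normed_vector"
  assumes "0 \<le> S" "0 \<le> L" "0 \<le> e" "S * L \<le> 1 / 2"
    and der: "\<And>t. t \<in> {-S..S} \<Longrightarrow> (d has_vector_derivative d' t) (at t)"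
    and bound: "\<And>t. t \<in> {-S..S} \<Longrightarrow> norm (d' t) \<le> L * norm (d t) + e"
    and t: "t \<in> {-S..S}"
  shows "norm (d t) \<le> 2 * (norm (d 0) + S * e)"
proof -
  have "continuous_on {-S..S} d"
    using der has_vector_derivative_continuous continuous_at_imp_continuous_on by blast
  then have "continuous_on {-S..S} (\<lambda>t. norm (d t))" by (rule continuous_on_norm)
  then obtain m where m: "m \<in> {-S..S}" "\<And>t. t \<in> {-S..S} \<Longrightarrow> norm (d t) \<le> norm (d m)"
    using continuous_attains_sup[of "{-S..S}" "\<lambda>t. norm (d t)"] assms(1) by auto
  have "norm (d m - d 0) \<le> (L * norm (d m) + e) * norm (m - 0)"
  proof (rule differentiable_bound[of "{-S..S}" d "\<lambda>t h. h *\<^sub>R d' t"])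
    show "(d has_derivative (\<lambda>h. h *\<^sub>R d' t)) (at t within {-S..S})" if "t \<in> {-S..S}" for t
      using der[OF that] by (simp add: has_vector_derivative_def has_derivative_at_withinI)
    show "onorm (\<lambda>h. h *\<^sub>R d' t) \<le> L * norm (d m) + e" if "t \<in> {-S..S}" for t
    proof (rule onorm_le)
      fix h :: real
      have "norm (d' t) \<le> L * norm (d m) + e"
        using bound[OF that] mult_left_mono[OF m(2)[OF that] assms(2)] by linarith
      then show "norm (h *\<^sub>R d' t) \<le> (L * norm (d m) + e) * norm h"
        by (simp add: mult.commute[of _ "\<bar>h\<bar>"] mult_left_mono)
    qed
  qed (use m assms in auto)
  also have "\<dots> \<le> (L * norm (d m) + e) * S"
    using m(1) assms by (intro mult_left_mono) auto
  also have "\<dots> = (S * L) * norm (d m) + S * e" by (simp add: algebra_simps)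
  also have "\<dots> \<le> 1 / 2 * norm (d m) + S * e"
    using mult_right_mono[OF assms(4), of "norm (d m)"] by simp
  finally have "norm (d m) \<le> 2 * (norm (d 0) + S * e)"
    using norm_triangle_ineq2[of "d m" "d 0"] by simp
  then show ?thesis using m(2)[OF t] by linarith
qed

lemma antiderivative_open_interval:
  fixes h :: "real \<Rightarrow> 'e::banach"
  assumes "continuous_on {-T<..<T} h"
  shows "\<exists>H. H 0 = y \<and> (\<forall>t\<in>{-T<..<T}. (H has_vector_derivative h t) (at t))"
proof -
  \<comment> \<open>The integral over an empty interval is 0, so the difference is the oriented
    integral from 0 to \<open>t\<close> for either sign of \<open>t\<close>.\<close>
  define H where "H t = y + (integral {0..t} h - integral {t..0} h)" for t
  have "(H has_vector_derivative h t) (at t)" if t: "t \<in> {-T<..<T}" for t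
  proof -
    have "\<bar>t\<bar> < T" using t by auto
    from dense[OF this] obtain S where S: "\<bar>t\<bar> < S" "S < T" by blast
    have c: "continuous_on {-S..S} h" using assms by (rule continuous_on_subset) (use S in auto)
    have i: "h integrable_on {-S..S}" by (rule integrable_continuous_real[OF c])
    have eq: "H u = y + (integral {-S..u} h - integral {-S..0} h)" if "u \<in> {-S..S}" for u
    proof (cases "0 \<le> u")
      case True
      have "integral {-S..0} h + integral {0..u} h = integral {-S..u} h"
        by (rule Henstock_Kurzweil_Integration.integral_combine)
          (use True that in \<open>auto intro: integrable_subinterval_real[OF i]\<close>)
      then have "integral {0..u} h = integral {-S..u} h - integral {-S..0} h"
        by (metis add_diff_cancel_left')
      moreover have "integral {u..0} h = 0" using True by (cases "u = 0") auto
      ultimately show ?thesis by (simp add: H_def)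
    next
      case False
      have "integral {-S..u} h + integral {u..0} h = integral {-S..0} h"
        by (rule Henstock_Kurzweil_Integration.integral_combine)
          (use False that in \<open>auto intro: integrable_subinterval_real[OF i]\<close>)
      then have "integral {u..0} h = integral {-S..0} h - integral {-S..u} h"
        by (metis add_diff_cancel_left')
      then show ?thesis using False by (simp add: H_def)
    qed
    have "((\<lambda>u. integral {-S..u} h) has_vector_derivative h t) (at t within {-S..S})"
      by (rule integral_has_vector_derivative[OF c]) (use S in auto)
    then have "((\<lambda>u. integral {-S..u} h) has_vector_derivative h t) (at t within {-S<..<S})"
      by (rule has_vector_derivative_within_subset) auto
    then have "((\<lambda>u. integral {-S..u} h) has_vector_derivative h t) (at t)"
      using S by (subst (asm) at_within_open) auto
    then have "((\<lambda>u. y + (integral {-S..u} h - integral {-S..0} h)) has_vector_derivative h t) (at t)"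
      by (auto intro!: derivative_eq_intros)
    then show ?thesis
      by (rule has_vector_derivative_transform_within_open[of _ _ _ "{-S<..<S}"]) (use S eq in auto)
  qed
  moreover have "H 0 = y" by (simp add: H_def)
  ultimately show ?thesis by blast
qed

text \<open>Picard iteration. The hypothesis \<open>inv\<close> says that the integral operator
  keeps curves in the closed set \<open>C\<close>: for the flow, \<open>C\<close> is a small ball
  around the starting point; for the linearised equation it is the whole space and
  \<open>inv\<close> is trivial. By \<open>growth_bound\<close> one step multiplies distances by at
  most \<open>2 * T * K \<le> 1 / 2\<close>, which is the origin of the bound
  \<open>1 / 4\<close>.\<close>

lemma ode_exists:
  fixes G :: "real \<Rightarrow> 'e::banach \<Rightarrow> 'e"
  assumes T: "0 < T" "0 \<le> K" "T * K \<le> 1 / 4"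
    and C: "closed C" "y \<in> C"
    and cont: "continuous_on ({-T<..<T} \<times> C) (\<lambda>(t, x). G t x)"
    and Lip: "\<And>t x x'. t \<in> {-T<..<T} \<Longrightarrow> x \<in> C \<Longrightarrow> x' \<in> C \<Longrightarrow> norm (G t x - G t x') \<le> K * norm (x - x')"
    and inv: "\<And>f h t. f 0 = y \<Longrightarrow> \<forall>t\<in>{-T<..<T}. h t \<in> C \<and> (f has_vector_derivative G t (h t)) (at t)
      \<Longrightarrow> t \<in> {-T<..<T} \<Longrightarrow> f t \<in> C"
  shows "\<exists>x. x 0 = y \<and> (\<forall>t\<in>{-T<..<T}. x t \<in> C \<and> (x has_vector_derivative G t (x t)) (at t))"
proof -
  let ?J = "{-T<..<T}"
  define step where "step h = (SOME f. f 0 = y \<and> (\<forall>t\<in>?J. (f has_vector_derivative G t (h t)) (at t)))" for h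
  have step: "step h 0 = y \<and> (\<forall>t\<in>?J. (step h has_vector_derivative G t (h t)) (at t))"
    if "continuous_on ?J h" "\<forall>t\<in>?J. h t \<in> C" for h
  proof -
    have "continuous_on ?J (\<lambda>t. (t, h t))" using that by (intro continuous_intros)
    then have "continuous_on ?J (\<lambda>t. G t (h t))"
      using continuous_on_compose2[OF cont, of ?J "\<lambda>t. (t, h t)"] that by auto
    from antiderivative_open_interval[OF this] show ?thesis
      unfolding step_def by (rule someI_ex)
  qed
  define xs where "xs n = (step ^^ n) (\<lambda>_. y)" for n
  have xs0: "xs 0 t = y" for t by (simp add: xs_def)
  have xsS: "xs (Suc n) = step (xs n)" for n by (simp add: xs_def)
  have xs: "continuous_on ?J (xs n) \<and> (\<forall>t\<in>?J. xs n t \<in> C) \<and> xs n 0 = y" for n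
  proof (induction n)
    case 0
    then show ?case using C by (simp add: xs_def)
  next
    case (Suc n)
    note s = step[of "xs n", folded xsS]
    have "isCont (xs (Suc n)) t" if "t \<in> ?J" for t
      using s Suc that has_vector_derivative_continuous[of "xs (Suc n)"] by blast
    then have "continuous_on ?J (xs (Suc n))" by (simp add: continuous_at_imp_continuous_on)
    moreover have "xs (Suc n) t \<in> C" if "t \<in> ?J" for t
      using inv[of "xs (Suc n)" "xs n" t] s Suc that by blast
    ultimately show ?case using s Suc by blast
  qed
  have der: "(xs (Suc n) has_vector_derivative G t (xs n t)) (at t)" if "t \<in> ?J" for n t
    using step[of "xs n", folded xsS] xs that by blast
  \<comment> \<open>Convergence is claimed only on compact subintervals: nothing bounds
    \<open>G\<close> near the ends of the open interval, so the first increment of the iteration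
    need not be bounded there.\<close>
  have near: "uniform_limit {-S..S} xs (\<lambda>t. lim (\<lambda>n. xs n t)) sequentially" if S: "0 < S" "S < T" for S
  proof -
    have SJ: "{-S..S} \<subseteq> ?J" using S by auto
    have "continuous_on {-S..S} (\<lambda>t. norm (xs (Suc 0) t - xs 0 t))"
      using xs continuous_on_subset[OF _ SJ] by (intro continuous_intros) blast+
    from compact_imp_bounded[OF compact_continuous_image[OF this compact_Icc]]
    obtain M where "\<forall>r\<in>(\<lambda>t. norm (xs (Suc 0) t - xs 0 t)) ` {-S..S}. norm r \<le> M"
      unfolding bounded_iff by blast
    then have M: "\<And>t. t \<in> {-S..S} \<Longrightarrow> norm (xs (Suc 0) t - xs 0 t) \<le> M" by simp
    have M0: "0 \<le> M" using M[of 0] S norm_ge_zero order_trans by (metis atLeastAtMost_iff less_imp_le neg_le_0_iff_le)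
    have dist: "norm (xs (Suc n) t - xs n t) \<le> M * (1/2)^n" if "t \<in> {-S..S}" for n t
      using that
    proof (induction n arbitrary: t)
      case 0
      then show ?case using M by simp
    next
      case (Suc n)
      have "norm (xs (Suc (Suc n)) t - xs (Suc n) t)
          \<le> 2 * (norm (xs (Suc (Suc n)) 0 - xs (Suc n) 0) + S * (K * (M * (1/2)^n)))"
      proof (rule growth_bound[where L=0 and d'="\<lambda>t. G t (xs (Suc n) t) - G t (xs n t)"])
        show "((\<lambda>t. xs (Suc (Suc n)) t - xs (Suc n) t) has_vector_derivative
           G t (xs (Suc n) t) - G t (xs n t)) (at t)" if "t \<in> {-S..S}" for t
          using der that SJ by (intro has_vector_derivative_diff) auto
        show "norm (G t (xs (Suc n) t) - G t (xs n t)) \<le> 0 * norm (xs (Suc (Suc n)) t - xs (Suc n) t) + K * (M * (1/2)^n)"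
          if "t \<in> {-S..S}" for t
        proof -
          have "norm (G t (xs (Suc n) t) - G t (xs n t)) \<le> K * norm (xs (Suc n) t - xs n t)"
            using Lip xs that SJ by blast
          also have "\<dots> \<le> K * (M * (1/2)^n)" using Suc.IH[OF that] T by (intro mult_left_mono)
          finally show ?thesis by simp
        qed
      qed (use S T M0 Suc.prems in auto)
      also have "\<dots> = 2 * (S * K) * (M * (1/2)^n)" using xs by simp
      also have "\<dots> \<le> 2 * (1/4) * (M * (1/2)^n)"
      proof -
        have "S * K \<le> T * K" using S T by (intro mult_right_mono) auto
        then show ?thesis using T M0 by (intro mult_right_mono) auto
      qed
      finally show ?case by simp
    qed
    have "uniform_limit {-S..S} (\<lambda>n t. \<Sum>i<n. xs (Suc i) t - xs i t)
        (\<lambda>t. suminf (\<lambda>i. xs (Suc i) t - xs i t)) sequentially"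
      by (rule Weierstrass_m_test[where M="\<lambda>n. M * (1/2)^n"]) (use dist in \<open>auto intro: summable_mult\<close>)
    then have "uniform_limit {-S..S} (\<lambda>n t. y + (\<Sum>i<n. xs (Suc i) t - xs i t))
        (\<lambda>t. y + suminf (\<lambda>i. xs (Suc i) t - xs i t)) sequentially"
      by (intro uniform_limit_add uniform_limit_const)
    then have u: "uniform_limit {-S..S} xs (\<lambda>t. y + suminf (\<lambda>i. xs (Suc i) t - xs i t)) sequentially"
      by (simp add: sum_lessThan_telescope[of "\<lambda>i. xs i t" for t] xs0)
    have "lim (\<lambda>n. xs n t) = y + suminf (\<lambda>i. xs (Suc i) t - xs i t)" if "t \<in> {-S..S}" for t
      using tendsto_uniform_limitI[OF u that] by (rule limI)
    then show ?thesis using u by (metis (no_types, lifting) uniform_limit_cong')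
  qed
  define x where "x t = lim (\<lambda>n. xs n t)" for t
  have main: "x t \<in> C \<and> (x has_vector_derivative G t (x t)) (at t)" if t: "t \<in> ?J" for t
  proof -
    have "\<bar>t\<bar> < T" using t by auto
    from dense[OF this] obtain S where S: "\<bar>t\<bar> < S" "S < T" by blast
    let ?S = "{-S<..<S}"
    have SJ: "?S \<subseteq> ?J" "?S \<subseteq> {-S..S}" using S by auto
    have u: "uniform_limit ?S xs x sequentially"
      using uniform_limit_on_subset[OF near SJ(2)] S unfolding x_def by auto
    have xl: "(\<lambda>n. xs n t) \<longlonglongrightarrow> x t" if "t \<in> ?S" for t using tendsto_uniform_limitI[OF u that] .
    have xC: "x t \<in> C" if "t \<in> ?S" for t
      using closed_sequentially[OF C(1) _ xl[OF that]] xs SJ that by blast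
    \<comment> \<open>Termwise differentiation takes the place of a limit under the integral: the
      derivatives \<open>G t (xs n t)\<close> converge uniformly by the Lipschitz condition. The
      index is shifted because the derivative of \<open>xs (Suc n)\<close> is expressed through
      \<open>xs n\<close>.\<close>
    have "\<exists>g. \<forall>t\<in>?S. (\<lambda>n. xs (Suc n) t) \<longlonglongrightarrow> g t \<and> (g has_derivative (\<lambda>h. h *\<^sub>R G t (x t))) (at t within ?S)"
    proof (rule has_derivative_sequence[where f'="\<lambda>n t h. h *\<^sub>R G t (xs n t)"])
      show "(xs (Suc n) has_derivative (\<lambda>h. h *\<^sub>R G t (xs n t))) (at t within ?S)" if "t \<in> ?S" for n t
      proof (rule has_derivative_at_withinI)
        have "t \<in> ?J" using that SJ by blast
        from der[OF this] show "(xs (Suc n) has_derivative (\<lambda>h. h *\<^sub>R G t (xs n t))) (at t)"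
          by (simp add: has_vector_derivative_def)
      qed
      show "\<forall>\<^sub>F n in sequentially. \<forall>t\<in>?S. \<forall>h. norm (h *\<^sub>R G t (xs n t) - h *\<^sub>R G t (x t)) \<le> e * norm h"
        if "0 < e" for e
      proof -
        have "0 < e / (K + 1)" using that T by simp
        from uniform_limitD[OF u this] show ?thesis
        proof eventually_elim
          case (elim n)
          show ?case
          proof (intro ballI allI)
            fix t h assume t: "t \<in> ?S"
            have "norm (G t (xs n t) - G t (x t)) \<le> K * norm (xs n t - x t)"
              using Lip xs xC t SJ by blast
            also have "\<dots> \<le> K * (e / (K + 1))"
              using elim t T by (intro mult_left_mono) (auto simp: dist_norm intro: less_imp_le)
            also have "\<dots> \<le> e" using T that by (simp add: field_simps)
            finally show "norm (h *\<^sub>R G t (xs n t) - h *\<^sub>R G t (x t)) \<le> e * norm h"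
              by (simp add: scaleR_right_diff_distrib[symmetric] mult.commute[of e] mult_left_mono)
          qed
        qed
      qed
      show "0 \<in> ?S" using S by auto
      show "(\<lambda>n. xs (Suc n) 0) \<longlonglongrightarrow> y" using xs by simp
    qed auto
    then obtain g where g: "\<And>t. t \<in> ?S \<Longrightarrow> (\<lambda>n. xs (Suc n) t) \<longlonglongrightarrow> g t"
        "\<And>t. t \<in> ?S \<Longrightarrow> (g has_derivative (\<lambda>h. h *\<^sub>R G t (x t))) (at t within ?S)" by blast
    have gx: "g t = x t" if "t \<in> ?S" for t
      using LIMSEQ_unique[OF g(1)[OF that]] LIMSEQ_Suc[OF xl[OF that]] by blast
    have tS: "t \<in> ?S" using S by auto
    have "(g has_derivative (\<lambda>h. h *\<^sub>R G t (x t))) (at t)"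
      using g(2)[OF tS] tS by (subst (asm) at_within_open) auto
    then have "(x has_derivative (\<lambda>h. h *\<^sub>R G t (x t))) (at t)"
      using has_derivative_cong_open[of ?S t g x] gx tS by auto
    then show ?thesis using xC[OF tS] by (simp add: has_vector_derivative_def)
  qed
  moreover have "x 0 = y" using xs by (simp add: x_def)
  ultimately show ?thesis by blast
qed


subsection \<open>Smooth dependence on parameters\<close>

text \<open>The derivative is uniformly continuous on a closed neighbourhood of the compact set
  \<open>Q\<close>, and the mean value inequality is applied on balls around the points of
  \<open>Q\<close>. The result serves to linearise an equation simultaneously at all points of a
  solution curve.\<close>

lemma Ck_on_uniform_differentiability:
  fixes F :: "'a::euclidean_space \<Rightarrow> 'b::real_normed_vector"
  assumes "open Om" "compact Q" "Q \<noteq> {}" "Q \<subseteq> Om" "Ck_on (Suc 0) Om F" "0 < e"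
  shows "\<exists>d>0. \<forall>q\<in>Q. \<forall>k. norm k < d \<longrightarrow> q + k \<in> Om \<and>
    norm (F (q + k) - F q - fderiv F q k) \<le> e * norm k"
proof -
  obtain r where r: "0 < r" "{x. infdist x Q \<le> r} \<subseteq> Om"
    using compact_in_open_separated[OF assms(3,2,1,4)] by blast
  let ?R = "{x. infdist x Q \<le> r}"
  let ?D = "\<lambda>q. fderiv F q"
  have R: "compact ?R" using compact_infdist_le assms r by blast
  \<comment> \<open>\<open>norm_linear_le\<close> adds one such error for each basis vector.\<close>
  define e' where "e' = e / (DIM('a) + 1)"
  have e': "0 < e'" using assms by (simp add: e'_def add_nonneg_pos)
  have "\<exists>d>0. \<forall>x\<in>?R. \<forall>y\<in>?R. dist y x < d \<longrightarrow> dist (?D y b) (?D x b) < e'" for b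
  proof -
    have "continuous_on Om (\<lambda>q. ?D q b)" using assms(5) by simp
    then have "continuous_on ?R (\<lambda>q. ?D q b)" using r(2) by (rule continuous_on_subset)
    from compact_uniformly_continuous[OF this R] show ?thesis
      using e' unfolding uniformly_continuous_on_def by blast
  qed
  then obtain d where d: "\<And>b. 0 < d b" "\<And>b x y. x \<in> ?R \<Longrightarrow> y \<in> ?R \<Longrightarrow> dist y x < d b \<Longrightarrow> dist (?D y b) (?D x b) < e'"
    by metis
  define d0 where "d0 = Min (insert r (d ` Basis))"
  have d0: "0 < d0" "d0 \<le> r" "\<And>b. b \<in> Basis \<Longrightarrow> d0 \<le> d b"
    unfolding d0_def using r d by (auto simp del: Min_insert intro!: Min_le)
  have der: "(F has_derivative ?D q) (at q)" if "q \<in> Om" for q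
    using Ck_on_fderiv[OF assms(5) that] .
  have "q + k \<in> Om \<and> norm (F (q + k) - F q - ?D q k) \<le> e * norm k" if q: "q \<in> Q" and k: "norm k < d0" for q k
  proof -
    have inR: "x \<in> ?R" if "dist q x < d0" for x
      using infdist_le[OF q, of x] that d0 by (simp add: dist_commute)
    have qR: "q \<in> ?R" using inR[of q] d0 by simp
    have seg: "q + t *\<^sub>R (q + k - q) \<in> ball q d0" if "t \<in> {0..1}" for t
    proof -
      have "\<bar>t\<bar> * norm k \<le> 1 * norm k" using that by (intro mult_right_mono) auto
      then show ?thesis using k by (simp add: dist_norm)
    qed
    have bound: "onorm (?D x - ?D q) \<le> e" if x: "x \<in> ball q d0" for x
    proof (rule onorm_le)
      fix v :: 'a
      have "linear (?D x)" "linear (?D q)"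
        using inR[of x] r x q assms(4) by (auto intro!: has_derivative_linear[OF der])
      then have "linear (\<lambda>v. ?D x v - ?D q v)" by (rule linear_compose_sub)
      moreover have "norm (?D x b - ?D q b) \<le> e'" if "b \<in> Basis" for b
        using d(2)[OF qR inR, of x b] x d0(3)[OF that] by (auto simp: dist_commute dist_norm norm_minus_commute)
      ultimately have "norm (?D x v - ?D q v) \<le> (\<Sum>b\<in>(Basis::'a set). e') * norm v"
        by (rule norm_linear_le)
      also have "(\<Sum>b\<in>(Basis::'a set). e') = e * (DIM('a) / (DIM('a) + 1))" by (simp add: e'_def)
      also have "e * (DIM('a) / (DIM('a) + 1)) * norm v \<le> (e * 1) * norm v"
        using assms(6) by (intro mult_left_mono mult_right_mono) (auto simp: field_simps)
      finally show "norm ((?D x - ?D q) v) \<le> e * norm v" by (simp add: fun_diff_def)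
    qed
    have "norm (F (q + k) - F q - ?D q (q + k - q)) \<le> norm (q + k - q) * e"
    proof (rule differentiable_bound_linearization[where S="ball q d0"])
      show "(F has_derivative ?D x) (at x within ball q d0)" if "x \<in> ball q d0" for x
        using inR[of x] r that 
        by (auto intro!: has_derivative_at_withinI[OF der])
      show "q \<in> ball q d0" using d0 by simp
      show "onorm (?D x - ?D q) \<le> e" if "x \<in> ball q d0" for x by (rule bound[OF that])
      show "q + t *\<^sub>R (q + k - q) \<in> ball q d0" if "t \<in> {0..1}" for t by (rule seg[OF that])
    qed
    then have "norm (F (q + k) - F q - ?D q k) \<le> e * norm k" by (simp add: mult.commute)
    moreover have "q + k \<in> Om" using inR[of "q + k"] k r by (auto simp: dist_norm)
    ultimately show ?thesis by blast
  qed
  then show ?thesis using d0 by blast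
qed

text \<open>The slack in \<open>T * (K + 1) \<le> 1 / 4\<close> lets \<open>growth_bound\<close> take the place of Gronwall's inequality.\<close>

locale param_ode =
  fixes T K :: real and P :: "'q::euclidean_space set" and Om :: "'e::euclidean_space set"
    and F :: "(real \<times> 'q) \<times> 'e \<Rightarrow> 'e" and x0 :: "'q \<Rightarrow> 'e" and x :: "real \<times> 'q \<Rightarrow> 'e"
  assumes T: "0 < T" "0 \<le> K" "T * (K + 1) \<le> 1 / 4"
    and opn: "open P" "open Om"
    and contF: "continuous_on (({-T<..<T} \<times> P) \<times> Om) F"
    and Lip: "\<And>t p y z. t \<in> {-T<..<T} \<Longrightarrow> p \<in> P \<Longrightarrow> y \<in> Om \<Longrightarrow> z \<in> Om \<Longrightarrow>
        norm (F ((t, p), y) - F ((t, p), z)) \<le> K * norm (y - z)"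
    and contx0: "continuous_on P x0"
    and init: "\<And>p. p \<in> P \<Longrightarrow> x (0, p) = x0 p"
    and dom: "\<And>t p. t \<in> {-T<..<T} \<Longrightarrow> p \<in> P \<Longrightarrow> x (t, p) \<in> Om"
    and sol: "\<And>t p. t \<in> {-T<..<T} \<Longrightarrow> p \<in> P \<Longrightarrow>
        ((\<lambda>s. x (s, p)) has_vector_derivative F ((t, p), x (t, p))) (at t)"
begin

abbreviation "J \<equiv> {-T<..<T}"
abbreviation "Dom \<equiv> ({-T<..<T} \<times> P) \<times> Om"

lemma open_domain: "open Dom" "open (J \<times> P)"
  using opn by (auto intro!: open_Times)

lemma cont_curve:
  assumes "p \<in> P" "S \<subseteq> J"
  shows "continuous_on S (\<lambda>s. x (s, p))"
  using sol[OF _ assms(1)] assms(2)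
  by (meson continuous_at_imp_continuous_on has_vector_derivative_continuous subsetD)

lemma radius: assumes "0 < S" "S < T"
  shows "{-S..S} \<subseteq> J" "S * (K + 1) \<le> 1 / 4" "S * K \<le> 1 / 4"
proof -
  show "{-S..S} \<subseteq> J" using assms by auto
  have "S * (K + 1) \<le> T * (K + 1)" using assms T by (intro mult_right_mono) auto
  then show "S * (K + 1) \<le> 1 / 4" using T by linarith
  then show "S * K \<le> 1 / 4" using assms by (simp add: algebra_simps)
qed

text \<open>The difference of the solutions for \<open>p\<close> and \<open>p0\<close> obeys
  \<open>growth_bound\<close>: its derivative is at most \<open>K\<close> times itself plus the
  change of \<open>F\<close> in the parameter alone, along the fixed curve of \<open>p0\<close>.
  That change is uniformly small by compactness.\<close>

lemma uniform_continuity: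
  assumes p0: "p0 \<in> P" and S: "0 < S" "S < T" and e: "0 < e"
  shows "\<exists>d>0. \<forall>p. dist p p0 < d \<longrightarrow> p \<in> P \<and> (\<forall>s\<in>{-S..S}. norm (x (s, p) - x (s, p0)) < e)"
proof -
  note SJ = radius[OF S]
  obtain r where r: "0 < r" "cball p0 r \<subseteq> P" using opn p0 open_contains_cball by blast
  define H where "H = (\<lambda>(s, p). F ((s, p), x (s, p0)))"
  let ?C = "{-S..S} \<times> cball p0 r"
  have "continuous_on ?C (\<lambda>(s, p). x (s, p0))"
    unfolding split_beta
    by (rule continuous_on_compose2[OF cont_curve[OF p0 SJ(1)]]) (auto intro!: continuous_intros)
  then have "continuous_on ?C (\<lambda>z. ((fst z, snd z), x (fst z, p0)))"
    by (intro continuous_intros) (simp add: split_beta)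
  then have "continuous_on ?C H"
    unfolding H_def split_beta
    by (rule continuous_on_compose2[OF contF]) (use SJ r p0 dom in \<open>auto simp: subset_iff\<close>)
  then have uc: "uniformly_continuous_on ?C H"
    by (rule compact_uniformly_continuous) (auto intro: compact_Times)
  \<comment> \<open>Chosen so that \<open>2 * (e' + S * e') = e / 2\<close>, where the first
    \<open>e'\<close> bounds the change of the initial value and the second the change of
    \<open>F\<close>.\<close>
  define e' where "e' = (e / 4) / (1 + S)"
  have e': "0 < e'" using e S by (simp add: e'_def)
  have "\<exists>d>0. \<forall>z\<in>?C. \<forall>z'\<in>?C. dist z' z < d \<longrightarrow> dist (H z') (H z) < e'"
    using uc e' unfolding uniformly_continuous_on_def by (simp only:)
  then obtain d1 where d1: "0 < d1" "\<forall>z\<in>?C. \<forall>z'\<in>?C. dist z' z < d1 \<longrightarrow> dist (H z') (H z) < e'"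
    by (elim exE conjE)
  have "isCont x0 p0" using contx0 opn p0 continuous_on_eq_continuous_at by blast
  then obtain d2 where d2: "0 < d2" "\<And>p. dist p p0 < d2 \<Longrightarrow> dist (x0 p) (x0 p0) < e'"
    using e' unfolding continuous_at_eps_delta by (metis dist_commute)
  define d where "d = min r (min d1 d2)"
  have "p \<in> P \<and> (\<forall>s\<in>{-S..S}. norm (x (s, p) - x (s, p0)) < e)" if p: "dist p p0 < d" for p
  proof -
    have pr: "p \<in> cball p0 r" using p by (simp add: d_def dist_commute)
    then have pP: "p \<in> P" using r by blast
    have "norm (x (s, p) - x (s, p0)) < e" if s: "s \<in> {-S..S}" for s
    proof -
      have "norm (x (s, p) - x (s, p0)) \<le> 2 * (norm (x (0, p) - x (0, p0)) + S * e')"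
      proof (rule growth_bound[where L=K and d'="\<lambda>s. F ((s, p), x (s, p)) - F ((s, p0), x (s, p0))"])
        show "((\<lambda>s. x (s, p) - x (s, p0)) has_vector_derivative
           F ((s, p), x (s, p)) - F ((s, p0), x (s, p0))) (at s)" if "s \<in> {-S..S}" for s
          using sol pP p0 that SJ(1) by (intro has_vector_derivative_diff) auto
        show "norm (F ((s, p), x (s, p)) - F ((s, p0), x (s, p0))) \<le> K * norm (x (s, p) - x (s, p0)) + e'"
          if s: "s \<in> {-S..S}" for s
        proof -
          have sJ: "s \<in> J" using s SJ by blast
          have "norm (F ((s, p), x (s, p)) - F ((s, p), x (s, p0))) \<le> K * norm (x (s, p) - x (s, p0))"
            using Lip[OF sJ pP] dom sJ pP p0 by blast
          moreover have "dist (H (s, p)) (H (s, p0)) < e'"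
          proof (rule d1(2)[rule_format])
            show "(s, p0) \<in> ?C" "(s, p) \<in> ?C" using s pr r by simp_all
            show "dist (s, p) (s, p0) < d1" using p by (simp add: d_def dist_Pair_Pair)
          qed
          ultimately show ?thesis
            using norm_triangle_ineq[of "F ((s, p), x (s, p)) - F ((s, p), x (s, p0))"
                "F ((s, p), x (s, p0)) - F ((s, p0), x (s, p0))"]
            by (simp add: H_def dist_norm)
        qed
      qed (use SJ S T e' s in auto)
      moreover have "norm (x (0, p) - x (0, p0)) < e'"
        using d2(2)[of p] p init pP p0 by (simp add: d_def dist_norm)
      moreover have "e' * (1 + S) = e / 4"
        using S nonzero_divide_eq_eq[of "1 + S" "e / 4" e'] unfolding e'_def by linarith
      ultimately show ?thesis using e by (simp add: algebra_simps)
    qed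
    then show ?thesis using pP by blast
  qed
  moreover have "0 < d" using r d1 d2 by (simp add: d_def)
  ultimately show ?thesis by blast
qed

lemma continuous_solution: "continuous_on (J \<times> P) x"
proof -
  have "isCont x (t0, p0)" if t0: "t0 \<in> J" and p0: "p0 \<in> P" for t0 p0
    unfolding continuous_at_eps_delta
  proof (intro allI impI)
    fix e :: real assume "0 < e"
    then have e: "0 < e / 2" by simp
    have "\<bar>t0\<bar> < T" using t0 by auto
    from dense[OF this] obtain S where S: "\<bar>t0\<bar> < S" "S < T" by blast
    then have S0: "0 < S" by linarith
    obtain d1 where d1: "0 < d1" "\<And>p s. dist p p0 < d1 \<Longrightarrow> s \<in> {-S..S} \<Longrightarrow> norm (x (s, p) - x (s, p0)) < e / 2"
      using uniform_continuity[OF p0 S0 S(2) e] by blast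
    have "isCont (\<lambda>s. x (s, p0)) t0"
      using sol[OF t0 p0] has_vector_derivative_continuous by blast
    then obtain d2 where d2: "0 < d2" "\<And>s. dist s t0 < d2 \<Longrightarrow> dist (x (s, p0)) (x (t0, p0)) < e / 2"
      using e unfolding continuous_at_eps_delta by (metis dist_commute)
    define d where "d = min d1 (min d2 (S - \<bar>t0\<bar>))"
    have "dist (x z) (x (t0, p0)) < e" if z: "dist z (t0, p0) < d" for z
    proof -
      obtain s p where sp: "z = (s, p)" by fastforce
      have "dist s t0 < d" "dist p p0 < d"
        using z dist_fst_le[of z "(t0, p0)"] dist_snd_le[of z "(t0, p0)"] by (auto simp: sp)
      moreover from this have "s \<in> {-S..S}" by (auto simp: d_def dist_real_def)
      ultimately have "norm (x (s, p) - x (s, p0)) < e / 2" "dist (x (s, p0)) (x (t0, p0)) < e / 2"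
        using d1(2)[of p s] d2(2)[of s] by (auto simp: d_def)
      then show ?thesis
        using dist_triangle[of "x (s, p)" "x (t0, p0)" "x (s, p0)"] by (simp add: sp dist_norm)
    qed
    moreover have "0 < d" using d1 d2 S by (simp add: d_def)
    ultimately show "\<exists>d>0. \<forall>z. dist z (t0, p0) < d \<longrightarrow> dist (x z) (x (t0, p0)) < e" by blast
  qed
  then show ?thesis by (auto intro!: continuous_at_imp_continuous_on)
qed

text \<open>The Lipschitz constant in the last argument bounds the difference quotients in the
  direction \<open>(0, w)\<close> and therefore, up to an arbitrarily small error, the derivative.
  The 0 is that of \<open>real \<times> 'q\<close>: time and parameter stay fixed.\<close>

lemma derivative_bound:
  assumes "Ck_on (Suc 0) Dom F" "t \<in> J" "p \<in> P" "y \<in> Om"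
  shows "norm (fderiv F ((t, p), y) (0, w)) \<le> K * norm w"
proof -
  let ?q = "((t, p), y)"
  let ?D = "fderiv F ?q"
  have q: "?q \<in> Dom" using assms by auto
  have lin: "linear ?D" by (rule has_derivative_linear[OF Ck_on_fderiv[OF assms(1) q]])
  have "norm (?D (0, w)) \<le> K * norm w + e" if "0 < e" for e
  proof -
    define e' where "e' = e / (norm w + 1)"
    have e': "0 < e'" using that by (simp add: e'_def add_nonneg_pos)
    obtain d where d: "0 < d" "\<And>k. norm k < d \<Longrightarrow> ?q + k \<in> Dom \<and>
        norm (F (?q + k) - F ?q - ?D k) \<le> e' * norm k"
      using Ck_on_uniform_differentiability[OF open_domain(1) _ _ _ assms(1) e', of "{?q}"] q by auto
    \<comment> \<open>A step length for which \<open>r *\<^sub>R w\<close> is shorter than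
      \<open>d\<close>; the summand 1 covers \<open>w = 0\<close>.\<close>
    define r where "r = d / 2 / (norm w + 1)"
    have r: "0 < r" using d by (simp add: r_def add_nonneg_pos)
    have nw: "norm w + 1 > 0" by (simp add: add_nonneg_pos)
    have rw: "norm (r *\<^sub>R w) < d"
    proof -
      have "r * (norm w + 1) = d / 2"
        using nonzero_divide_eq_eq[of "norm w + 1" "d / 2" r] nw unfolding r_def by linarith
      then show ?thesis using r d by (simp add: algebra_simps)
    qed
    let ?k = "((0::real, 0::'q), r *\<^sub>R w)"
    have nk: "norm ?k = r * norm w" using r by (simp add: norm_Pair zero_prod_def[symmetric])
    have k: "norm ?k < d" using rw r nk by simp
    have mem: "y + r *\<^sub>R w \<in> Om" using d(2)[OF k] by auto
    have "norm (F (?q + ?k) - F ?q) \<le> K * (r * norm w)"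
      using Lip[OF assms(2,3) mem assms(4)] r by simp
    moreover have "norm (F (?q + ?k) - F ?q - ?D ?k) \<le> e' * (r * norm w)"
      using d(2)[OF k] nk by simp
    ultimately have "norm (?D ?k) \<le> K * (r * norm w) + e' * (r * norm w)"
      using norm_triangle_ineq4[of "F (?q + ?k) - F ?q" "F (?q + ?k) - F ?q - ?D ?k"] by simp
    moreover have "?D ?k = r *\<^sub>R ?D (0, w)"
      using linear_scale[OF lin, of r "(0, w)"] by (simp add: zero_prod_def)
    ultimately have "r * norm (?D (0, w)) \<le> r * (K * norm w + e' * norm w)"
      using r by (simp add: algebra_simps)
    then have "norm (?D (0, w)) \<le> K * norm w + e' * norm w"
      using r mult_le_cancel_left_pos by blast
    moreover have "e' * (norm w + 1) = e"
      using nonzero_divide_eq_eq[of "norm w + 1" e e'] nw unfolding e'_def by linarith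
    ultimately show ?thesis using e' by (simp add: algebra_simps)
  qed
  then show ?thesis by (rule field_le_epsilon)
qed

text \<open>The right side of the equation satisfied by the derivative of \<open>x\<close> in the
  parameter direction \<open>b\<close>, as a function of \<open>((t, p), w)\<close>. It is affine in
  \<open>w\<close>, and the time component of the direction is 0. One order is lost because it
  contains the derivative of \<open>F\<close>.\<close>

lemma Ck_on_linearised:
  assumes "Ck_on (Suc k) Dom F" "Ck_on k (J \<times> P) x"
  shows "Ck_on k ((J \<times> P) \<times> UNIV)
    (\<lambda>z. fderiv F (fst z, x (fst z)) ((0, b), snd z))"
proof -
  let ?S = "(J \<times> P) \<times> (UNIV :: 'e set)"
  let ?D = "\<lambda>z. fderiv F (fst z, x (fst z))"
  have S: "open ?S" "open (J \<times> P)" using open_domain by (auto intro!: open_Times)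
  have fst: "Ck_on k ?S (\<lambda>z. fst z)" and snd: "Ck_on k ?S (\<lambda>z. snd z)"
    using Ck_on_linear[OF S(1) bounded_linear_fst Ck_on_id[OF S(1)]]
      Ck_on_linear[OF S(1) bounded_linear_snd Ck_on_id[OF S(1)]] by auto
  have "Ck_on k ?S (\<lambda>z. x (fst z))"
    by (rule Ck_on_compose[OF S assms(2) fst]) auto
  then have pair: "Ck_on k ?S (\<lambda>z. (fst z, x (fst z)))"
    by (intro Ck_on_Pair S fst)
  have mem: "(fst z, x (fst z)) \<in> Dom" if "z \<in> ?S" for z
    using that dom by auto
  have D: "Ck_on k ?S (\<lambda>z. ?D z v)" for v
    by (rule Ck_on_compose[OF S(1) open_domain(1) _ pair mem])
      (rule assms(1)[unfolded Ck_on.simps, THEN conjunct2, rule_format])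
  have "Ck_on k ?S (\<lambda>z. ?D z ((0, b), 0) + (\<Sum>e\<in>Basis. (snd z \<bullet> e) *\<^sub>R ?D z (0, e)))"
    by (intro Ck_on_add Ck_on_sum Ck_on_scaleR Ck_on_inner_left S D snd)
  moreover have "?D z ((0, b), 0) + (\<Sum>e\<in>Basis. (snd z \<bullet> e) *\<^sub>R ?D z (0, e)) = ?D z ((0, b), snd z)"
    if "z \<in> ?S" for z
  proof -
    have lin: "linear (?D z)"
      by (rule has_derivative_linear[OF Ck_on_fderiv[OF assms(1) mem[OF that]]])
    have lin': "linear (\<lambda>w. ?D z (0, w))"
      using linear_compose[of "\<lambda>w. (0, w)", OF _ lin] by (simp add: o_def linear_iff)
    have "?D z (0, snd z) = (\<Sum>e\<in>Basis. (snd z \<bullet> e) *\<^sub>R ?D z (0, e))"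
      by (rule linear_expand[OF lin'])
    moreover have "?D z ((0, b), snd z) = ?D z ((0, b), 0) + ?D z (0, snd z)"
      using linear_add[OF lin, of "((0, b), 0)" "(0, snd z)"] by (simp add: zero_prod_def)
    ultimately show ?thesis by simp
  qed
  ultimately show ?thesis
    using Ck_on_cong[OF S(1)] by (metis (no_types, lifting))
qed

abbreviation variation where "variation b \<equiv> param_ode T K P UNIV (\<lambda>z. fderiv F (fst z, x (fst z)) ((0, b), snd z))
    (\<lambda>p. fderiv x0 p b)"

text \<open>The linearised equation is globally Lipschitz in \<open>w\<close>, so
  \<open>ode_exists\<close> applies with the whole space as invariant set and gives solutions on all
  of \<open>J\<close>, the same interval as for \<open>x\<close>.\<close>

lemma variational_solution:
  assumes F: "Ck_on (Suc 0) Dom F" and x0: "Ck_on (Suc 0) P x0"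
  shows "\<exists>v. variation b v"
proof -
  let ?L = "\<lambda>z. fderiv F (fst z, x (fst z)) ((0, b), snd z)"
  have contL: "continuous_on ((J \<times> P) \<times> UNIV) ?L"
    using Ck_on_linearised[of 0 b] F continuous_solution by simp
  have LipL: "norm (?L ((t, p), w) - ?L ((t, p), w')) \<le> K * norm (w - w')"
    if "t \<in> J" "p \<in> P" for t p w w'
  proof -
    have q: "((t, p), x (t, p)) \<in> Dom" using that dom by auto
    have "linear (fderiv F ((t, p), x (t, p)))"
      by (rule has_derivative_linear[OF Ck_on_fderiv[OF F q]])
    from linear_diff[OF this, of "((0, b), w)" "((0, b), w')"]
    have "?L ((t, p), w) - ?L ((t, p), w') = fderiv F ((t, p), x (t, p)) (0, w - w')"
      by (simp add: zero_prod_def)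
    then show ?thesis using derivative_bound[OF F that dom[OF that]] by simp
  qed
  have TK: "T * K \<le> 1 / 4" using T by (simp add: algebra_simps)
  have "\<exists>y. p \<in> P \<longrightarrow> y 0 = fderiv x0 p b \<and>
      (\<forall>t\<in>J. y t \<in> UNIV \<and> (y has_vector_derivative ?L ((t, p), y t)) (at t))" for p
  proof (cases "p \<in> P")
    case True
    have "continuous_on (J \<times> UNIV) (\<lambda>z. ?L ((fst z, p), snd z))"
      by (rule continuous_on_compose2[OF contL, of _ "\<lambda>z. ((fst z, p), snd z)"])
        (use True in \<open>auto intro!: continuous_intros\<close>)
    then have "continuous_on (J \<times> UNIV) (\<lambda>(t, w). ?L ((t, p), w))"
      by (simp add: split_beta)
    from ode_exists[OF T(1,2) TK closed_UNIV UNIV_I this LipL]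
    show ?thesis using True by blast
  qed auto
  then obtain y where y: "\<And>p. p \<in> P \<Longrightarrow> y p 0 = fderiv x0 p b"
     "\<And>p t. p \<in> P \<Longrightarrow> t \<in> J \<Longrightarrow> (y p has_vector_derivative ?L ((t, p), y p t)) (at t)"
    by metis
  have "param_ode T K P UNIV ?L (\<lambda>p. fderiv x0 p b) (\<lambda>(t, p). y p t)"
    by unfold_locales (use T opn contL LipL x0 y in auto)
  then show ?thesis by blast
qed

text \<open>Compares the increment \<open>\<Delta>\<close> of the solution in the parameter with the
  candidate \<open>W h\<close>, a combination of the \<open>V b\<close> that solves the linearised
  equation with initial value \<open>fderiv x0 p0 h\<close>. A first use of
  \<open>growth_bound\<close> shows that \<open>\<Delta>\<close> is at most
  \<open>A * norm h\<close>; a second one, fed with this, that \<open>\<Delta> - W h\<close> is of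
  smaller order.\<close>

lemma partial_derivative:
  assumes F: "Ck_on (Suc 0) Dom F" and x0: "Ck_on (Suc 0) P x0"
    and V: "\<And>b. variation b (V b)"
    and t0: "t0 \<in> J" and p0: "p0 \<in> P"
  shows "((\<lambda>p. x (t0, p)) has_derivative (\<lambda>h. \<Sum>b\<in>Basis. (h \<bullet> b) *\<^sub>R V b (t0, p0))) (at p0)"
proof -
  have "\<bar>t0\<bar> < T" using t0 by auto
  from dense[OF this] obtain S where S: "\<bar>t0\<bar> < S" "S < T" by blast
  then have S0: "0 < S" by linarith
  note SJ = radius[OF S0 S(2)]
  define q where "q s = ((s, p0), x (s, p0))" for s
  define D where "D s = fderiv F (q s)" for s
  define W where "W h s = (\<Sum>b\<in>Basis. (h \<bullet> b) *\<^sub>R V b (s, p0))" for h s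
  have qd: "q s \<in> Dom" if "s \<in> J" for s using that p0 dom by (simp add: q_def)
  have linD: "linear (D s)" if "s \<in> J" for s
    unfolding D_def by (rule has_derivative_linear[OF Ck_on_fderiv[OF F qd[OF that]]])
  have W0: "W h 0 = fderiv x0 p0 h" for h
  proof -
    have "linear (fderiv x0 p0)"
      by (rule has_derivative_linear[OF Ck_on_fderiv[OF x0 p0]])
    from linear_expand[OF this, of h] show ?thesis
      using param_ode.init[OF V p0] by (simp add: W_def)
  qed
  have W: "(W h has_vector_derivative D s ((0, h), W h s)) (at s)" if s: "s \<in> J" for h s
  proof -
    have "(W h has_vector_derivative (\<Sum>b\<in>Basis. (h \<bullet> b) *\<^sub>R D s ((0, b), V b (s, p0)))) (at s)"
      unfolding W_def
      using param_ode.sol[OF V s p0]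
      by (intro has_vector_derivative_sum bounded_linear.has_vector_derivative[OF bounded_linear_scaleR_right])
        (simp add: D_def q_def)
    moreover have "(\<Sum>b\<in>Basis. (h \<bullet> b) *\<^sub>R D s ((0, b), V b (s, p0)))
       = D s (\<Sum>b\<in>Basis. (h \<bullet> b) *\<^sub>R ((0, b), V b (s, p0)))"
      by (simp only: linear_sum[OF linD[OF s]] linear_scale[OF linD[OF s]])
    moreover have "(\<Sum>b\<in>Basis. (h \<bullet> b) *\<^sub>R ((0::real, b), V b (s, p0))) = ((0, h), W h s)"
      by (simp add: prod_eq_iff fst_sum snd_sum W_def euclidean_representation)
    ultimately show ?thesis by simp
  qed
  have contq: "continuous_on {-S..S} q"
    unfolding q_def using cont_curve[OF p0 SJ(1)] by (intro continuous_intros)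
  have "\<exists>M. \<forall>s\<in>{-S..S}. norm (D s ((0, b), 0)) \<le> M" for b
  proof -
    have "continuous_on Dom (\<lambda>z. fderiv F z ((0, b), 0))"
      using F by simp
    from continuous_on_compose2[OF this contq] have "continuous_on {-S..S} (\<lambda>s. D s ((0, b), 0))"
      unfolding D_def using qd SJ by blast
    from compact_imp_bounded[OF compact_continuous_image[OF this compact_Icc]]
    show ?thesis unfolding bounded_iff by simp
  qed
  then obtain m where m: "\<And>b s. s \<in> {-S..S} \<Longrightarrow> norm (D s ((0, b), 0)) \<le> m b" by metis
  define M where "M = (\<Sum>b\<in>Basis. m b)"
  have m0: "0 \<le> m b" for b
  proof -
    have "norm (D 0 ((0, b), 0)) \<le> m b" using S0 by (intro m) auto
    then show ?thesis using norm_ge_zero order_trans by blast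
  qed
  have M0: "0 \<le> M" using m0 by (simp add: M_def sum_nonneg)
  have M: "norm (D s ((0, h), 0)) \<le> M * norm h" if s: "s \<in> {-S..S}" for s h
  proof -
    have lin: "linear (\<lambda>h. D s ((0, h), 0))"
    proof -
      have "s \<in> J" using s SJ(1) by blast
      from linear_compose[OF _ linD[OF this], of "\<lambda>h. ((0, h), 0)"] show ?thesis
        by (simp add: o_def linear_iff)
    qed
    show ?thesis
      unfolding M_def by (rule norm_linear_le[OF lin]) (rule m[OF s])
  qed
  have Dk: "norm (D s (0, w)) \<le> K * norm w" if "s \<in> {-S..S}" for s w
    unfolding D_def q_def using derivative_bound[OF F _ p0 dom[OF _ p0]] that SJ by blast
  have x0d: "(x0 has_derivative fderiv x0 p0) (at p0)"
    by (rule Ck_on_fderiv[OF x0 p0])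
  obtain M1 where M1: "0 < M1" "\<And>h. norm (fderiv x0 p0 h) \<le> norm h * M1"
    using bounded_linear.pos_bounded[OF has_derivative_bounded_linear[OF x0d]] by blast
  \<comment> \<open>\<open>M1\<close> bounds the derivative of \<open>x0\<close> and
    \<open>M\<close> that of \<open>F\<close> in the parameter; the two summands 1 account for the
    remainder terms, which carry a factor \<open>e1 \<le> 1\<close>.\<close>
  define A where "A = 2 * ((M1 + 1) + S * (M + 1))"
  have A0: "0 \<le> A" using M1 M0 S0 by (simp add: A_def)
  have "\<exists>d>0. \<forall>p. norm (p - p0) < d \<longrightarrow>
      norm (x (t0, p) - x (t0, p0) - W (p - p0) t0) \<le> e * norm (p - p0)" if e: "0 < e" for e
  proof -
    \<comment> \<open>\<open>e1 * B\<close> is the total error of the second estimate: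
      \<open>e1\<close> from the initial value and \<open>S * e1 * (1 + A)\<close> from the
      remainder of \<open>F\<close>, doubled by \<open>growth_bound\<close>.\<close>
    define B where "B = 2 * (1 + S * (1 + A))"
    have B: "0 < B" using S0 A0 by (simp add: B_def add_pos_nonneg)
    define e1 where "e1 = min 1 (e / B)"
    have e1: "0 < e1" "e1 \<le> 1" "e1 * B \<le> e"
      using e B by (auto simp: e1_def min_mult_distrib_right)
    have cQ: "compact (q ` {-S..S})" by (rule compact_continuous_image[OF contq compact_Icc])
    have sQ: "q ` {-S..S} \<subseteq> Dom" using qd SJ(1) by blast
    have nQ: "q ` {-S..S} \<noteq> {}" using S0 by simp
    have "\<exists>d>0. \<forall>z\<in>q ` {-S..S}. \<forall>k. norm k < d \<longrightarrow> z + k \<in> Dom \<and>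
        norm (F (z + k) - F z - fderiv F z k) \<le> e1 * norm k"
      by (rule Ck_on_uniform_differentiability[OF open_domain(1) cQ nQ sQ F e1(1)])
    then obtain d1 where d1: "0 < d1" "\<And>s k. s \<in> {-S..S} \<Longrightarrow> norm k < d1 \<Longrightarrow>
        norm (F (q s + k) - F (q s) - D s k) \<le> e1 * norm k"
      unfolding D_def by blast
    have d1': "0 < d1 / 2" using d1 by simp
    obtain d2 where d2: "0 < d2" "\<And>p. dist p p0 < d2 \<Longrightarrow> p \<in> P"
        "\<And>p s. dist p p0 < d2 \<Longrightarrow> s \<in> {-S..S} \<Longrightarrow> norm (x (s, p) - x (s, p0)) < d1 / 2"
      using uniform_continuity[OF p0 S0 S(2) d1'] by blast
    obtain d3 where d3: "0 < d3" "\<And>p. norm (p - p0) < d3 \<Longrightarrow>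
        norm (x0 p - x0 p0 - fderiv x0 p0 (p - p0)) \<le> e1 * norm (p - p0)"
      using x0d e1(1) unfolding has_derivative_at_alt by blast
    define d where "d = min (d1 / 2) (min d2 d3)"
    have d0: "0 < d" using d1 d2 d3 by (simp add: d_def)
    moreover have "norm (x (t0, p) - x (t0, p0) - W (p - p0) t0) \<le> e * norm (p - p0)"
      if p: "norm (p - p0) < d" for p
    proof -
      define h where "h = p - p0"
      have hp: "p = p0 + h" by (simp add: h_def)
      have hd: "norm h < d1 / 2" "dist p p0 < d2" "norm (p - p0) < d3"
        using p by (auto simp: h_def d_def dist_norm)
      have pP: "p \<in> P" using d2 hd by blast
      define \<Delta> where "\<Delta> s = x (s, p) - x (s, p0)" for s
      define R where "R s = F ((s, p), x (s, p)) - F (q s)" for s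
      have \<Delta>: "(\<Delta> has_vector_derivative R s) (at s)" if "s \<in> {-S..S}" for s
        unfolding \<Delta>_def R_def q_def using sol p0 pP that SJ(1)
        by (intro has_vector_derivative_diff) auto
      have R: "norm (R s - D s ((0, h), \<Delta> s)) \<le> e1 * (norm h + norm (\<Delta> s))" if s: "s \<in> {-S..S}" for s
      proof -
        let ?k = "((0::real, h), \<Delta> s)"
        have k: "norm ?k \<le> norm h + norm (\<Delta> s)"
          using norm_Pair_le[of "(0::real, h)" "\<Delta> s"] by (simp add: norm_Pair)
        have "norm (\<Delta> s) < d1 / 2" unfolding \<Delta>_def by (rule d2(3)[OF hd(2) s])
        then have "norm ?k < d1" using k hd(1) by linarith
        from d1(2)[OF s this] have "norm (F (q s + ?k) - F (q s) - D s ?k) \<le> e1 * norm ?k" .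
        moreover have "q s + ?k = ((s, p), x (s, p))" by (simp add: q_def hp \<Delta>_def)
        ultimately have "norm (R s - D s ?k) \<le> e1 * norm ?k" unfolding R_def by (simp only:)
        also have "\<dots> \<le> e1 * (norm h + norm (\<Delta> s))"
          using e1 by (intro mult_left_mono[OF k]) simp
        finally show ?thesis .
      qed
      have x0h: "norm (x0 p - x0 p0 - fderiv x0 p0 h) \<le> e1 * norm h"
        using d3(2)[OF hd(3)] by (simp add: h_def)
      have \<Delta>0: "\<Delta> 0 = x0 p - x0 p0" using init p0 pP by (simp add: \<Delta>_def)
      have e1h: "e1 * norm h \<le> 1 * norm h" using e1 by (intro mult_right_mono) auto
      have Dsplit: "D s ((0, h), w) = D s ((0, h), 0) + D s (0, w)" if "s \<in> {-S..S}" for s w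
        using linear_add[OF linD, of s "((0, h), 0)" "(0, w)"] that SJ(1) by (auto simp: zero_prod_def)
      have bound: "norm (\<Delta> s) \<le> A * norm h" if s: "s \<in> {-S..S}" for s
      proof -
        have "norm (\<Delta> s) \<le> 2 * (norm (\<Delta> 0) + S * ((M + 1) * norm h))"
        \<comment> \<open>The remainder contributes up to \<open>norm (\<Delta> s)\<close> to the
          growth, so the rate is \<open>K + 1\<close> here instead of \<open>K\<close>.\<close>
        proof (rule growth_bound[where L="K + 1" and d'=R])
          show "norm (R s) \<le> (K + 1) * norm (\<Delta> s) + (M + 1) * norm h" if s: "s \<in> {-S..S}" for s
          proof -
            have "norm (R s) \<le> norm (R s - D s ((0, h), \<Delta> s)) + norm (D s ((0, h), \<Delta> s))"
              using norm_triangle_ineq[of "R s - D s ((0, h), \<Delta> s)" "D s ((0, h), \<Delta> s)"] by simp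
            also have "norm (D s ((0, h), \<Delta> s)) \<le> M * norm h + K * norm (\<Delta> s)"
              unfolding Dsplit[OF s, of "\<Delta> s"]
              using norm_triangle_ineq[of "D s ((0, h), 0)" "D s (0, \<Delta> s)"] M[OF s, of h] Dk[OF s, of "\<Delta> s"]
              by linarith
            also have "norm (R s - D s ((0, h), \<Delta> s)) \<le> 1 * (norm h + norm (\<Delta> s))"
              using order_trans[OF R[OF s] mult_right_mono[OF e1(2)]] by simp
            finally show ?thesis by (simp add: algebra_simps)
          qed
        qed (use S0 T SJ \<Delta> s M0 in auto)
        moreover have "norm (\<Delta> 0) \<le> (M1 + 1) * norm h"
          unfolding \<Delta>0
          using norm_triangle_ineq[of "x0 p - x0 p0 - fderiv x0 p0 h" "fderiv x0 p0 h"]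
            x0h e1h M1(2)[of h] by (simp add: algebra_simps)
        ultimately show ?thesis by (simp add: A_def algebra_simps)
      qed
      have t0S: "t0 \<in> {-S..S}" using S by auto
      have "norm (\<Delta> t0 - W h t0) \<le> 2 * (norm (\<Delta> 0 - W h 0) + S * (e1 * (1 + A) * norm h))"
      proof (rule growth_bound[where L=K and d'="\<lambda>s. R s - D s ((0, h), W h s)" and d="\<lambda>s. \<Delta> s - W h s"])
        show "((\<lambda>s. \<Delta> s - W h s) has_vector_derivative R s - D s ((0, h), W h s)) (at s)"
          if "s \<in> {-S..S}" for s
          using \<Delta> W that SJ(1) by (intro has_vector_derivative_diff) auto
        show "norm (R s - D s ((0, h), W h s)) \<le> K * norm (\<Delta> s - W h s) + e1 * (1 + A) * norm h"
          if s: "s \<in> {-S..S}" for s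
        proof -
          have sJ: "s \<in> J" using s SJ by blast
          have "R s - D s ((0, h), W h s) = (R s - D s ((0, h), \<Delta> s)) + D s (0, \<Delta> s - W h s)"
            using linear_diff[OF linD[OF sJ], of "((0, h), \<Delta> s)" "((0, h), W h s)"]
            by (simp add: zero_prod_def)
          then have "norm (R s - D s ((0, h), W h s)) \<le> norm (R s - D s ((0, h), \<Delta> s)) + norm (D s (0, \<Delta> s - W h s))"
            using norm_triangle_ineq by metis
          also have "\<dots> \<le> e1 * (norm h + norm (\<Delta> s)) + K * norm (\<Delta> s - W h s)"
            using R[OF s] Dk[OF s] by (intro add_mono)
          also have "e1 * (norm h + norm (\<Delta> s)) \<le> e1 * (norm h + A * norm h)"
            using bound[OF s] e1 by (intro mult_left_mono add_left_mono) auto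
          finally show ?thesis by (simp add: algebra_simps)
        qed
      qed (use S0 T SJ t0S e1 A0 in auto)
      also have "\<dots> \<le> 2 * (e1 * norm h + S * (e1 * (1 + A) * norm h))"
        using x0h by (simp add: \<Delta>0 W0)
      also have "\<dots> = (e1 * B) * norm h" by (simp add: B_def algebra_simps)
      also have "\<dots> \<le> e * norm h" using e1 by (intro mult_right_mono) auto
      finally show ?thesis by (simp add: \<Delta>_def h_def)
    qed
    ultimately show ?thesis by blast
  qed
  moreover have "bounded_linear (\<lambda>h. W h t0)"
    unfolding W_def by (intro bounded_linear_sum bounded_linear_intros)
  ultimately show ?thesis unfolding has_derivative_at_alt by (simp add: W_def)
qed

text \<open>Joint differentiability in time and parameter follows from the two partial derivatives
  once the parameter derivative is continuous; it is, because each \<open>V b\<close> is itself a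
  solution depending continuously on its parameters. The criterion asks for a convex parameter set,
  so \<open>P\<close> is replaced by a ball.\<close>

lemma solution_derivative:
  assumes F: "Ck_on (Suc 0) Dom F" and x0: "Ck_on (Suc 0) P x0"
    and V: "\<And>b. variation b (V b)"
    and z: "z \<in> J \<times> P"
  shows "(x has_derivative (\<lambda>v. fst v *\<^sub>R F (z, x z) + (\<Sum>b\<in>Basis. (snd v \<bullet> b) *\<^sub>R V b z))) (at z)"
proof -
  obtain t0 p0 where z0: "z = (t0, p0)" "t0 \<in> J" "p0 \<in> P" using z by auto
  obtain r where r: "0 < r" "ball p0 r \<subseteq> P" using opn z0 openE by blast
  let ?B = "ball p0 r"
  define fy where "fy t p = Blinfun (\<lambda>h. \<Sum>b\<in>Basis. (h \<bullet> b) *\<^sub>R V b (t, p))" for t p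
  have bl: "bounded_linear (\<lambda>h. \<Sum>b\<in>Basis. (h \<bullet> b) *\<^sub>R V b (t, p))" for t p
    by (intro bounded_linear_sum bounded_linear_intros)
  have fy: "blinfun_apply (fy t p) = (\<lambda>h. \<Sum>b\<in>Basis. (h \<bullet> b) *\<^sub>R V b (t, p))" for t p
    unfolding fy_def by (rule bounded_linear_Blinfun_apply[OF bl])
  have JB: "(t0, p0) \<in> J \<times> ?B" "open (J \<times> ?B)" using z0 r by (auto intro!: open_Times)
  have "continuous_on (J \<times> ?B) (\<lambda>(t, p). fy t p)"
  proof (rule continuous_on_blinfun_componentwise)
    fix b :: 'q assume b: "b \<in> Basis"
    have "continuous_on (J \<times> P) (\<lambda>(t, p). blinfun_apply (fy t p) b)"
      unfolding fy split_beta using param_ode.continuous_solution[OF V]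
      by (intro continuous_intros) (simp add: )
    then show "continuous_on (J \<times> ?B) (\<lambda>z. blinfun_apply (case z of (t, p) \<Rightarrow> fy t p) b)"
      unfolding split_beta by (rule continuous_on_subset) (use r in auto)
  qed
  then have c: "continuous (at (t0, p0) within J \<times> ?B) (\<lambda>(t, p). fy t p)"
    using JB(1) unfolding continuous_on_eq_continuous_within by blast
  have "((\<lambda>(t, p). x (t, p)) has_derivative (\<lambda>(tx, ty). tx *\<^sub>R F ((t0, p0), x (t0, p0)) + blinfun_apply (fy t0 p0) ty))
      (at (t0, p0) within J \<times> ?B)"
  proof (rule has_derivative_partialsI[OF _ _ c])
    show "((\<lambda>t. x (t, p0)) has_derivative (\<lambda>tx. tx *\<^sub>R F ((t0, p0), x (t0, p0)))) (at t0 within J)"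
      using sol[OF z0(2,3)] by (simp add: has_vector_derivative_def has_derivative_at_withinI)
    show "((\<lambda>p. x (t, p)) has_derivative blinfun_apply (fy t p)) (at p within ?B)"
      if "t \<in> J" "p \<in> ?B" for t p
      unfolding fy using that r
      by (intro has_derivative_at_withinI[OF partial_derivative[OF F x0 V]]) auto
  qed (use r in auto)
  then have "((\<lambda>(t, p). x (t, p)) has_derivative (\<lambda>(tx, ty). tx *\<^sub>R F ((t0, p0), x (t0, p0)) + blinfun_apply (fy t0 p0) ty))
      (at (t0, p0))"
    using at_within_open[OF JB] by simp
  then have "(x has_derivative (\<lambda>(tx, ty). tx *\<^sub>R F ((t0, p0), x (t0, p0)) + blinfun_apply (fy t0 p0) ty)) (at z)"
    by (simp add: z0)
  then show ?thesis by (rule has_derivative_eq_rhs) (auto simp: z0 fy)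
qed

end

text \<open>The derivatives in the parameters solve the linearised equation, whose Lipschitz constant is
  again \<open>K\<close>, so the induction stays on the same time interval.\<close>

theorem Ck_on_solution:
  assumes "param_ode T K P Om F x0 x"
    and "Ck_on k (({-T<..<T} \<times> P) \<times> Om) F" "Ck_on k P x0"
  shows "Ck_on k ({-T<..<T} \<times> P) x"
  using assms
proof (induction k arbitrary: Om F x0 x)
  case 0
  then show ?case using param_ode.continuous_solution by auto
next
  case (Suc k)
  interpret param_ode T K P Om F x0 x by fact
  \<comment> \<open>The coefficients of the linearised equation contain \<open>x\<close>, so its
    class \<open>k\<close> is needed before the induction hypothesis can be applied to
    \<open>V b\<close>.\<close>
  have xk: "Ck_on k ({-T<..<T} \<times> P) x"
    by (rule Suc.IH[OF Suc.prems(1) Ck_on_SucD[OF Suc.prems(2)] Ck_on_SucD[OF Suc.prems(3)]])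
  note c1 = Ck_on_Suc_imp_Suc_0[OF Suc.prems(2)] Ck_on_Suc_imp_Suc_0[OF Suc.prems(3)]
  obtain V where V: "\<And>b. variation b (V b)"
    using choice[of "\<lambda>b v. variation b v"] variational_solution[OF c1] by blast
  have x0k: "Ck_on k P (\<lambda>p. fderiv x0 p b)" for b
    using Suc.prems(3)[unfolded Ck_on.simps] by blast
  have Vk: "Ck_on k ({-T<..<T} \<times> P) (V b)" for b
    by (rule Suc.IH[OF V Ck_on_linearised[OF Suc.prems(2) xk] x0k])
  have S: "open ({-T<..<T} \<times> P)" by (rule open_domain)
  have Fk: "Ck_on k ({-T<..<T} \<times> P) (\<lambda>z. F (z, x z))"
    by (rule Ck_on_compose[OF S open_domain(1) Ck_on_SucD[OF Suc.prems(2)] Ck_on_Pair[OF S Ck_on_id[OF S] xk]])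
      (use dom in auto)
  show ?case
  proof (rule Ck_on_SucI[OF S solution_derivative[OF c1 V]])
    show "Ck_on k ({-T<..<T} \<times> P) (\<lambda>z. fst v *\<^sub>R F (z, x z) + (\<Sum>b\<in>Basis. (snd v \<bullet> b) *\<^sub>R V b z))" for v
      by (intro Ck_on_add Ck_on_sum Ck_on_scaleR Ck_on_const S Vk Fk)
  qed
qed

subsection \<open>The smooth inverse function theorem\<close>

lemma Ck_on_mult:
  fixes f g :: "'a::real_normed_vector \<Rightarrow> real"
  shows "open S \<Longrightarrow> Ck_on k S f \<Longrightarrow> Ck_on k S g \<Longrightarrow> Ck_on k S (\<lambda>x. f x * g x)"
  using Ck_on_scaleR[of S k f g] by simp

lemma Ck_on_prod:
  fixes f :: "'i \<Rightarrow> 'a::real_normed_vector \<Rightarrow> real"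
  assumes "open S" "\<And>i. i \<in> I \<Longrightarrow> Ck_on k S (f i)"
  shows "Ck_on k S (\<lambda>x. \<Prod>i\<in>I. f i x)"
  using assms(2)
  by (induction I rule: infinite_finite_induct)
    (auto intro!: Ck_on_const Ck_on_mult assms(1))

lemma Ck_on_inverse:
  fixes f :: "'a::real_normed_vector \<Rightarrow> real"
  assumes "open S" "Ck_on k S f" "\<And>x. x \<in> S \<Longrightarrow> f x \<noteq> 0"
  shows "Ck_on k S (\<lambda>x. inverse (f x))"
  using assms(2)
proof (induction k)
  case 0
  then show ?case using assms(3) by (auto intro: continuous_on_inverse)
next
  case (Suc k)
  have i: "Ck_on k S (\<lambda>x. inverse (f x))" by (rule Suc.IH[OF Ck_on_SucD[OF Suc.prems]])
  have f: "Ck_on k S (\<lambda>x. fderiv f x v)" for v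
    using Suc.prems[unfolded Ck_on.simps] by blast
  show ?case
  proof (rule Ck_on_SucI[OF assms(1)])
    show "((\<lambda>x. inverse (f x)) has_derivative
       (\<lambda>v. (-1) * (inverse (f x) * fderiv f x v * inverse (f x)))) (at x)" if "x \<in> S" for x
      using Deriv.has_derivative_inverse[OF assms(3)[OF that] Ck_on_fderiv[OF Suc.prems that]] by simp
    show "Ck_on k S (\<lambda>x. (-1) * (inverse (f x) * fderiv f x v * inverse (f x)))" for v
      by (intro Ck_on_mult Ck_on_const assms(1) i f)
  qed
qed

lemma Ck_on_det:
  fixes A :: "'a::real_normed_vector \<Rightarrow> real ^ 'n ^ 'n"
  assumes "open S" "\<And>i j. Ck_on k S (\<lambda>x. A x $ i $ j)"
  shows "Ck_on k S (\<lambda>x. det (A x))"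
  unfolding det_def by (intro Ck_on_sum Ck_on_mult Ck_on_prod Ck_on_const assms)

lemma Ck_on_vec_lambda:
  fixes f :: "'a::real_normed_vector \<Rightarrow> 'n::finite \<Rightarrow> real"
  assumes "open S" "\<And>i. Ck_on k S (\<lambda>x. f x i)"
  shows "Ck_on k S (\<lambda>x. \<chi> i. f x i)"
proof (rule Ck_on_componentwise[OF assms(1)])
  fix b :: "real ^ 'n" assume "b \<in> Basis"
  then obtain i where "b = axis i 1" by (auto simp: Basis_vec_def)
  then show "Ck_on k S (\<lambda>x. (\<chi> i. f x i) \<bullet> b)" using assms(2) by (simp add: inner_axis)
qed

lemma Ck_on_nth:
  fixes f :: "'a::real_normed_vector \<Rightarrow> real ^ 'n"
  shows "open S \<Longrightarrow> Ck_on k S f \<Longrightarrow> Ck_on k S (\<lambda>x. f x $ i)"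
  by (rule Ck_on_linear[OF _ bounded_linear_vec_nth])

text \<open>Cramer's rule: the components of the solution are quotients of determinants of matrices
  whose entries are of class \<open>k\<close>. The matrix \<open>?N x l\<close> has its column
  \<open>l\<close> replaced by \<open>v\<close>.\<close>

lemma Ck_on_inv_linear:
  fixes A :: "'a::real_normed_vector \<Rightarrow> real ^ 'n \<Rightarrow> real ^ 'n"
  assumes "open S" "\<And>v. Ck_on k S (\<lambda>x. A x v)" "\<And>x. x \<in> S \<Longrightarrow> linear (A x)" "\<And>x. x \<in> S \<Longrightarrow> bij (A x)"
  shows "Ck_on k S (\<lambda>x. inv (A x) v)"
proof -
  let ?M = "\<lambda>x. matrix (A x)"
  let ?N = "\<lambda>x k. (\<chi> i j. if j = k then v $ i else ?M x $ i $ j) :: real ^ 'n ^ 'n"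
  have M: "Ck_on k S (\<lambda>x. ?M x $ i $ j)" for i j
    using Ck_on_nth[OF assms(1,2)] by (simp add: matrix_def)
  have d: "det (?M x) \<noteq> 0" if "x \<in> S" for x
    using assms(3,4)[OF that] det_nz_iff_inj[OF assms(3)[OF that]] bij_is_inj by blast
  have "Ck_on k S (\<lambda>x. ?N x l $ i $ j)" for l i j
    using M Ck_on_const[OF assms(1)] by (cases "j = l") auto
  then have "Ck_on k S (\<lambda>x. \<chi> l. det (?N x l) * inverse (det (?M x)))"
    by (intro Ck_on_vec_lambda Ck_on_mult Ck_on_inverse Ck_on_det assms(1) M d)
  moreover have "(\<chi> l. det (?N x l) * inverse (det (?M x))) = inv (A x) v" if "x \<in> S" for x
  proof -
    have "?M x *v inv (A x) v = v"
      using matrix_works[OF assms(3)[OF that, folded linear_matrix_vector_mul_eq]] assms(4)[OF that]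
      by (simp add: bij_is_surj surj_f_inv_f)
    then show ?thesis using cramer[OF d[OF that], of "inv (A x) v" v] by (simp add: divide_inverse)
  qed
  ultimately show ?thesis using Ck_on_cong[OF assms(1)] by (metis (no_types, lifting))
qed

text \<open>The inverse \<open>g\<close> is differentiable with derivative
  \<open>inv (fderiv f (g y))\<close>. If \<open>g\<close> is of class \<open>k\<close>, so is this
  expression, hence \<open>g\<close> is of class \<open>k + 1\<close>; the induction starts from the
  continuity of \<open>g\<close>.\<close>

theorem smooth_inverse_function:
  fixes f :: "real ^ 'n \<Rightarrow> real ^ 'n"
  assumes "open U" "smooth_on U f" "x0 \<in> U" "\<And>v. fderiv f x0 v = 0 \<Longrightarrow> v = 0"
  obtains U' V g where "open U'" "U' \<subseteq> U" "x0 \<in> U'" "open V" "homeomorphism U' V f g" "smooth_on V g"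
proof -
  let ?D = "\<lambda>x. fderiv f x"
  have der: "(f has_derivative ?D x) (at x)" if "x \<in> U" for x
    by (rule smooth_on_fderiv[OF assms(2) that])
  define f' where "f' x = (if x \<in> U then Blinfun (?D x) else 0)" for x
  have f': "blinfun_apply (f' x) = ?D x" if "x \<in> U" for x
    using bounded_linear_Blinfun_apply[OF has_derivative_bounded_linear[OF der[OF that]]] that
    by (simp add: f'_def)
  have lin: "linear (?D x)" if "x \<in> U" for x using has_derivative_linear[OF der[OF that]] .
  have "inj (?D x0)" using assms(4) linear_injective_0[OF lin[OF assms(3)]] by blast
  from linear_injective_left_inverse[OF lin[OF assms(3)] this]
  obtain h where h: "linear h" "h \<circ> ?D x0 = id" by blast
  have "blinfun_apply (Blinfun h) = h"
    using h(1) by (simp add: bounded_linear_Blinfun_apply linear_conv_bounded_linear)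
  then have inv: "Blinfun h o\<^sub>L f' x0 = id_blinfun"
    using h(2) f'[OF assms(3)] by (intro blinfun_eqI) (simp add: o_def fun_eq_iff)
  have "continuous_on U f'"
  proof (rule continuous_on_blinfun_componentwise)
    fix b :: "real ^ 'n"
    have "continuous_on U (\<lambda>x. ?D x b)"
      by (rule smooth_on_continuous[OF smooth_on_frechet[OF assms(2)]])
    then show "continuous_on U (\<lambda>x. blinfun_apply (f' x) b)"
      by (rule continuous_on_eq) (simp add: f')
  qed
  from inverse_function_theorem[OF assms(1) _ this assms(3) inv]
  obtain U' V g g' where g: "open U'" "U' \<subseteq> U" "x0 \<in> U'" "open V" "homeomorphism U' V f g"
    "\<And>y. y \<in> V \<Longrightarrow> (g has_derivative g' y) (at y)"
    "\<And>y. y \<in> V \<Longrightarrow> g' y = inv (blinfun_apply (f' (g y)))"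
    "\<And>y. y \<in> V \<Longrightarrow> bij (blinfun_apply (f' (g y)))"
    using der f' by metis
  have gU: "g y \<in> U" if "y \<in> V" for y
    using that g(2,5) by (auto simp: homeomorphism_def)
  have "Ck_on k V g" for k
  proof (induction k)
    case 0
    then show ?case using g(5) by (simp add: homeomorphism_def)
  next
    case (Suc k)
    show ?case
    proof (rule Ck_on_SucI[OF g(4)])
      show "(g has_derivative inv (?D (g y))) (at y)" if "y \<in> V" for y
        using g(6,7)[OF that] f'[OF gU[OF that]] by simp
      show "Ck_on k V (\<lambda>y. inv (?D (g y)) v)" for v
      proof (rule Ck_on_inv_linear[OF g(4)])
        show "Ck_on k V (\<lambda>y. ?D (g y) v)" for v
          by (rule Ck_on_compose[OF g(4) assms(1) smooth_onD[OF smooth_on_frechet[OF assms(2)]] Suc gU])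
        show "linear (?D (g y))" if "y \<in> V" for y using lin gU that by blast
        show "bij (?D (g y))" if "y \<in> V" for y using g(8)[OF that] f'[OF gU[OF that]] by simp
      qed
    qed
  qed
  then have "smooth_on V g" by (simp add: smooth_on_def)
  then show ?thesis using that g(1-5) by blast
qed

subsection \<open>Straightening of vector fields\<close>

text \<open>On a closed ball the field is bounded by some \<open>M\<close> and Lipschitz with some
  \<open>K\<close>. For short time a solution starting at \<open>p\<close> stays in
  \<open>cball p r\<close>, which gives existence; smoothness in \<open>p\<close> comes from viewing
  the starting point as the parameter of an equation on \<open>ball x0 R\<close>.\<close>

lemma local_flow:
  fixes X :: "'a::euclidean_space \<Rightarrow> 'a"
  assumes "open W" "smooth_on W X" "x0 \<in> W"
  obtains T r \<phi> where "0 < T" "0 < r" "smooth_on ({-T<..<T} \<times> ball x0 r) \<phi>"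
    "\<And>p. p \<in> ball x0 r \<Longrightarrow> \<phi> (0, p) = p"
    "\<And>t p. t \<in> {-T<..<T} \<Longrightarrow> p \<in> ball x0 r \<Longrightarrow> \<phi> (t, p) \<in> W"
    "\<And>t p. t \<in> {-T<..<T} \<Longrightarrow> p \<in> ball x0 r \<Longrightarrow>
        ((\<lambda>s. \<phi> (s, p)) has_vector_derivative X (\<phi> (t, p))) (at t)"
proof -
  obtain R where R: "0 < R" "cball x0 R \<subseteq> W" using assms(1,3) open_contains_cball by blast
  let ?C = "cball x0 R"
  let ?D = "\<lambda>x. fderiv X x"
  have cont: "continuous_on W X" "\<And>b. continuous_on W (\<lambda>x. ?D x b)"
    using smooth_on_continuous[OF assms(2)] smooth_on_continuous[OF smooth_on_frechet[OF assms(2)]]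
    by blast+
  have bd: "\<exists>M. \<forall>x\<in>?C. norm (h x) \<le> M" if "continuous_on W h" for h :: "'a \<Rightarrow> 'a"
    using compact_imp_bounded[OF compact_continuous_image[OF continuous_on_subset[OF that R(2)] compact_cball]]
    unfolding bounded_iff by simp
  obtain M where M: "\<And>x. x \<in> ?C \<Longrightarrow> norm (X x) \<le> M" using bd[OF cont(1)] by blast
  have M0: "0 \<le> M" using M[of x0] R norm_ge_zero order_trans by (metis centre_in_cball less_imp_le)
  obtain m where m: "\<And>b x. x \<in> ?C \<Longrightarrow> norm (?D x b) \<le> m b" using bd[OF cont(2)] by metis
  define K where "K = (\<Sum>b\<in>Basis. m b)"
  have K0: "0 \<le> K"
    unfolding K_def
  proof (rule sum_nonneg)
    show "0 \<le> m b" for b using order_trans[OF norm_ge_zero m[of x0 b]] R by simp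
  qed
  have der: "(X has_derivative ?D x) (at x)" if "x \<in> ?C" for x
    by (rule smooth_on_fderiv[OF assms(2)]) (use that R in auto)
  have Lip: "norm (X x - X y) \<le> K * norm (x - y)" if "x \<in> ?C" "y \<in> ?C" for x y
  proof (rule differentiable_bound[OF convex_cball _ _ that])
    show "(X has_derivative ?D x) (at x within ?C)" if "x \<in> ?C" for x
      by (rule has_derivative_at_withinI[OF der[OF that]])
    show "onorm (?D x) \<le> K" if x: "x \<in> ?C" for x
    proof (rule onorm_le)
      show "norm (?D x v) \<le> K * norm v" for v
        unfolding K_def by (rule norm_linear_le[OF has_derivative_linear[OF der[OF x]] m[OF x]])
    qed
  qed
  \<comment> \<open>Every point of \<open>cball p r\<close> with \<open>p\<close> in
    \<open>ball x0 r\<close> is then closer than \<open>2 * r < R\<close> to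
    \<open>x0\<close>.\<close>
  define r where "r = R / 3"
  have r: "0 < r" using R by (simp add: r_def)
  \<comment> \<open>The first bound makes the iteration contract; the second keeps the displacement,
    at most \<open>2 * (T * M)\<close> by \<open>growth_bound\<close>, within \<open>r\<close>. The
    summands 1 exclude division by 0.\<close>
  define T where "T = min (1 / (4 * (K + 1))) (r / (2 * (M + 1)))"
  have T: "0 < T" "T * (K + 1) \<le> 1 / 4" "2 * (T * M) \<le> r"
  proof -
    show "0 < T" using K0 M0 r by (simp add: T_def)
    have "T * (K + 1) \<le> 1 / (4 * (K + 1)) * (K + 1)" using K0 by (intro mult_right_mono) (auto simp: T_def)
    also have "\<dots> = 1 / 4" using K0 by simp
    finally show "T * (K + 1) \<le> 1 / 4" .
    have "T * (M + 1) \<le> r / (2 * (M + 1)) * (M + 1)" using M0 by (intro mult_right_mono) (auto simp: T_def)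
    also have "\<dots> = r / 2" using M0 by (simp add: field_simps)
    finally show "2 * (T * M) \<le> r" using \<open>0 < T\<close> by (simp add: algebra_simps)
  qed
  let ?J = "{-T<..<T}"
  have sub: "cball p r \<subseteq> ball x0 R" if "p \<in> ball x0 r" for p
  proof
    fix y assume "y \<in> cball p r"
    then show "y \<in> ball x0 R" using that dist_triangle[of x0 y p] R by (simp add: r_def)
  qed
  have ex: "\<exists>x. p \<in> ball x0 r \<longrightarrow> x 0 = p \<and> (\<forall>t\<in>?J. x t \<in> cball p r \<and> (x has_vector_derivative X (x t)) (at t))" for p
  proof (cases "p \<in> ball x0 r")
    case p: True
    have sub': "cball p r \<subseteq> ?C" "cball p r \<subseteq> W" using sub[OF p] R(2) ball_subset_cball by blast+
    have "\<exists>x. x 0 = p \<and> (\<forall>t\<in>?J. x t \<in> cball p r \<and> (x has_vector_derivative (\<lambda>t. X) t (x t)) (at t))"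
    proof (rule ode_exists[OF T(1) K0])
      show "T * K \<le> 1 / 4" using T by (simp add: algebra_simps)
      show "continuous_on (?J \<times> cball p r) (\<lambda>(t, x). X x)"
        unfolding split_beta
        by (rule continuous_on_compose2[OF cont(1) continuous_on_snd[OF continuous_on_id]]) (use sub' in auto)
      show "norm (X x - X x') \<le> K * norm (x - x')" if "x \<in> cball p r" "x' \<in> cball p r" for x x'
        using Lip sub' that by blast
      fix f h and t :: real
      assume f: "f 0 = p" "\<forall>t\<in>?J. h t \<in> cball p r \<and> (f has_vector_derivative X (h t)) (at t)" and t: "t \<in> ?J"
      have "\<bar>t\<bar> < T" using t by auto
      from dense[OF this] obtain S where S: "\<bar>t\<bar> < S" "S < T" by blast
      have "norm (f t - p) \<le> 2 * (norm (f 0 - p) + S * M)"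
      proof (rule growth_bound[where L=0 and d'="\<lambda>t. X (h t)" and d="\<lambda>t. f t - p"])
        show "((\<lambda>t. f t - p) has_vector_derivative X (h t)) (at t)" if "t \<in> {-S..S}" for t
          using f(2)[rule_format, of t] that S by (auto intro!: derivative_eq_intros)
        show "norm (X (h t)) \<le> 0 * norm (f t - p) + M" if "t \<in> {-S..S}" for t
          using M f(2)[rule_format, of t] that S sub' by auto
      qed (use S M0 in auto)
      also have "\<dots> = 2 * (S * M)" using f by simp
      also have "\<dots> \<le> 2 * (T * M)" using S M0 by (simp add: mult_right_mono)
      finally show "f t \<in> cball p r" using T(3) by (simp add: dist_norm norm_minus_commute)
    qed (use r in auto)
    then show ?thesis by blast
  qed auto
  then obtain x where x: "\<And>p. p \<in> ball x0 r \<Longrightarrow> x p 0 = p"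
    "\<And>p t. p \<in> ball x0 r \<Longrightarrow> t \<in> ?J \<Longrightarrow> x p t \<in> cball p r"
    "\<And>p t. p \<in> ball x0 r \<Longrightarrow> t \<in> ?J \<Longrightarrow> (x p has_vector_derivative X (x p t)) (at t)"
    by metis
  define \<phi> where "\<phi> = (\<lambda>(t, p). x p t)"
  let ?Om = "(?J \<times> ball x0 r) \<times> ball x0 R"
  have opn: "open ?Om" by (auto intro!: open_Times)
  have smF: "smooth_on ?Om (\<lambda>z. X (snd z))"
    by (rule smooth_on_compose[OF opn assms(1,2) smooth_on_linear[OF opn bounded_linear_snd smooth_on_id[OF opn]]])
      (use R in auto)
  have ode: "param_ode T K (ball x0 r) (ball x0 R) (\<lambda>z. X (snd z)) (\<lambda>p. p) \<phi>"
  proof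
    show "continuous_on ?Om (\<lambda>z. X (snd z))" by (rule smooth_on_continuous[OF smF])
    show "norm (X (snd ((t, p), y)) - X (snd ((t, p), z))) \<le> K * norm (y - z)"
      if "y \<in> ball x0 R" "z \<in> ball x0 R" for t y z and p :: 'a
      using Lip[of y z] that by simp
    show "\<phi> (t, p) \<in> ball x0 R" if "t \<in> ?J" "p \<in> ball x0 r" for t p
      using x(2)[OF that(2,1)] sub[OF that(2)] by (auto simp: \<phi>_def)
  qed (use T K0 x in \<open>auto simp: \<phi>_def\<close>)
  have smooth: "smooth_on (?J \<times> ball x0 r) \<phi>"
    unfolding smooth_on_def
    using Ck_on_solution[OF ode smooth_onD[OF smF] Ck_on_id[OF open_ball]] by blast
  show ?thesis
  proof (rule that[OF T(1) r smooth])
    show "\<phi> (t, p) \<in> W" if "t \<in> ?J" "p \<in> ball x0 r" for t p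
      using x(2)[OF that(2,1)] subset_trans[OF sub[OF that(2)] ball_subset_cball] R(2)
      unfolding \<phi>_def prod.case by blast
  qed (use x in \<open>auto simp: \<phi>_def\<close>)
qed

lemma has_vector_derivative_line:
  assumes "(f has_derivative D) (at y)"
  shows "((\<lambda>s. f (y + s *\<^sub>R v)) has_vector_derivative D v) (at 0)"
proof -
  have "((\<lambda>s. y + s *\<^sub>R v) has_derivative (\<lambda>s. s *\<^sub>R v)) (at 0)"
    by (auto intro!: derivative_eq_intros)
  moreover have "(f has_derivative D) (at (y + 0 *\<^sub>R v))" using assms by simp
  ultimately have "((\<lambda>s. f (y + s *\<^sub>R v)) has_derivative (\<lambda>s. D (s *\<^sub>R v))) (at 0)"
    by (rule has_derivative_compose)
  then show ?thesis
    unfolding has_vector_derivative_def using linear_scale[OF has_derivative_linear[OF assms]] by simp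
qed

text \<open>\<open>\<Phi> y\<close> follows the flow for time \<open>y $ n\<close> from the point
  \<open>x0 + L y\<close> of a hyperplane transversal to \<open>X x0\<close>. A step in the
  direction \<open>n\<close> only lengthens the time, so it is carried to \<open>X\<close>; at 0 the
  derivative is injective by transversality, and the inverse function theorem applies.\<close>

theorem flow_box:
  fixes X :: "real ^ 'n \<Rightarrow> real ^ 'n" and n :: 'n
  assumes "open W" "smooth_on W X" "x0 \<in> W" "X x0 \<noteq> 0"
  obtains U :: "(real ^ 'n) set" and V \<Phi> \<Psi> where "open U" "open V" "x0 \<in> V" "V \<subseteq> W" "homeomorphism U V \<Phi> \<Psi>"
    "smooth_on U \<Phi>" "smooth_on V \<Psi>" "\<And>y. y \<in> U \<Longrightarrow> fderiv \<Phi> y (axis n 1) = X (\<Phi> y)"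
proof -
  obtain T r \<phi> where T: "0 < T" "0 < r" and sm: "smooth_on ({-T<..<T} \<times> ball x0 r) \<phi>"
    and \<phi>0: "\<And>p. p \<in> ball x0 r \<Longrightarrow> \<phi> (0, p) = p"
    and \<phi>W: "\<And>t p. t \<in> {-T<..<T} \<Longrightarrow> p \<in> ball x0 r \<Longrightarrow> \<phi> (t, p) \<in> W"
    and \<phi>d: "\<And>t p. t \<in> {-T<..<T} \<Longrightarrow> p \<in> ball x0 r \<Longrightarrow>
        ((\<lambda>s. \<phi> (s, p)) has_vector_derivative X (\<phi> (t, p))) (at t)"
    using local_flow[OF assms(1-3)] by blast
  obtain j where j: "X x0 $ j \<noteq> 0" using assms(4) by (auto simp: vec_eq_iff)
  \<comment> \<open>\<open>L\<close> kills the direction \<open>n\<close> and maps the hyperplane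
    \<open>y $ n = 0\<close> onto \<open>y $ j = 0\<close>, to which \<open>X x0\<close> is
    transversal since its component \<open>j\<close> is nonzero. If \<open>j\<close> differs from
    \<open>n\<close>, the coordinate \<open>j\<close> is stored in the free slot
    \<open>n\<close>.\<close>
  define L :: "real ^ 'n \<Rightarrow> real ^ 'n"
    where "L v = (\<chi> k. if k = j then 0 else if k = n then v $ j else v $ k)" for v
  have linL: "linear L" by (rule linearI) (auto simp: L_def vec_eq_iff)
  then have blL: "bounded_linear L" by (simp add: linear_conv_bounded_linear)
  have Ln: "L (axis n 1) = 0" by (auto simp: L_def vec_eq_iff axis_def)
  define Q where "Q = {y. y $ n \<in> {-T<..<T}} \<inter> {y. x0 + L y \<in> ball x0 r}"
  have "open {y :: real ^ 'n. y $ n \<in> {-T<..<T}}"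
    using open_vimage[OF open_greaterThanLessThan, of "\<lambda>y :: real ^ 'n. y $ n" "-T" T]
    by (simp add: vimage_def continuous_on_component)
  moreover have "continuous_on UNIV (\<lambda>y. x0 + L y)"
    by (rule continuous_on_add[OF continuous_on_const bounded_linear.continuous_on[OF blL continuous_on_id]])
  then have "open {y. x0 + L y \<in> ball x0 r}"
    using open_vimage[of "ball x0 r" "\<lambda>y. x0 + L y"] by (simp add: vimage_def)
  ultimately have Q: "open Q" unfolding Q_def by blast
  define \<Phi> where "\<Phi> y = \<phi> (y $ n, x0 + L y)" for y
  have S: "open ({-T<..<T} \<times> ball x0 r)" by (auto intro!: open_Times)
  have sm\<Phi>: "smooth_on Q \<Phi>"
    unfolding smooth_on_def \<Phi>_def
  proof
    fix k
    show "Ck_on k Q (\<lambda>y. \<phi> (y $ n, x0 + L y))"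
      by (rule Ck_on_compose[OF Q S smooth_onD[OF sm]])
        (auto simp: Q_def[symmetric] intro!: Ck_on_Pair Ck_on_nth Ck_on_id Ck_on_add Ck_on_const Ck_on_linear[OF _ blL] Q,
         auto simp: Q_def)
  qed
  have line: "((\<lambda>s. \<Phi> (y + s *\<^sub>R v)) has_vector_derivative fderiv \<Phi> y v) (at 0)"
    if "y \<in> Q" for y v
    by (rule has_vector_derivative_line[OF smooth_on_fderiv[OF sm\<Phi> that]])
  have Dn: "fderiv \<Phi> y (axis n 1) = X (\<Phi> y)" if y: "y \<in> Q" for y
  proof -
    have "((\<lambda>s. \<phi> (s, x0 + L y)) has_vector_derivative X (\<phi> (y $ n, x0 + L y))) (at (y $ n + 0))"
      using \<phi>d[of "y $ n" "x0 + L y"] y by (auto simp: Q_def)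
    moreover have "((\<lambda>s. y $ n + s) has_vector_derivative 1) (at 0)"
      by (auto intro!: derivative_eq_intros)
    ultimately have "((\<lambda>s. \<phi> (y $ n + s, x0 + L y)) has_vector_derivative X (\<Phi> y)) (at 0)"
      using vector_diff_chain_at[of "\<lambda>s. y $ n + s" 1 0 "\<lambda>s. \<phi> (s, x0 + L y)"] by (simp add: o_def \<Phi>_def)
    moreover have "\<Phi> (y + s *\<^sub>R axis n 1) = \<phi> (y $ n + s, x0 + L y)" for s
      by (simp add: \<Phi>_def linear_add[OF linL] linear_scale[OF linL] Ln)
    ultimately show ?thesis using line[OF y, of "axis n 1"] vector_derivative_unique_at by auto
  qed
  have zQ: "0 \<in> Q" using T linear_0[OF linL] by (simp add: Q_def)
  have \<Phi>0: "\<Phi> 0 = x0" using T linear_0[OF linL] \<phi>0 by (simp add: \<Phi>_def)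
  have D0: "fderiv \<Phi> 0 v = v $ n *\<^sub>R X x0 + L v" for v
  proof -
    \<comment> \<open>\<open>w\<close> has no component \<open>n\<close>, so along it the time stays
      0 and the flow is the identity; \<open>\<Phi>\<close> is therefore affine on this line near
      0.\<close>
    define w where "w = v - v $ n *\<^sub>R axis n 1"
    have wn: "w $ n = 0" by (simp add: w_def)
    have Lw: "L w = L v" by (simp add: w_def linear_diff[OF linL] linear_scale[OF linL] Ln)
    have "((\<lambda>s. x0 + s *\<^sub>R L v) has_vector_derivative L v) (at 0)"
      by (auto intro!: derivative_eq_intros)
    moreover have "open {s. x0 + s *\<^sub>R L v \<in> ball x0 r}" (is "open ?I")
      using open_vimage[of "ball x0 r" "\<lambda>s. x0 + s *\<^sub>R L v"]
      by (simp add: vimage_def continuous_intros)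
    moreover have "0 \<in> ?I" using T by simp
    ultimately have "((\<lambda>s. \<Phi> (0 + s *\<^sub>R w)) has_vector_derivative L v) (at 0)"
      by (rule has_vector_derivative_transform_within_open)
        (use \<phi>0 in \<open>auto simp: \<Phi>_def wn linear_scale[OF linL] Lw\<close>)
    then have "fderiv \<Phi> 0 w = L v"
      using line[OF zQ, of w] vector_derivative_unique_at by blast
    moreover have "fderiv \<Phi> 0 v = v $ n *\<^sub>R fderiv \<Phi> 0 (axis n 1)
        + fderiv \<Phi> 0 w"
      using has_derivative_linear[OF smooth_on_fderiv[OF sm\<Phi> zQ]]
      by (simp add: w_def linear_diff linear_scale)
    ultimately show ?thesis using Dn[OF zQ] \<Phi>0 by simp
  qed
  have inj: "v = 0" if "fderiv \<Phi> 0 v = 0" for v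
  proof -
    have eq: "v $ n * X x0 $ k + L v $ k = 0" for k
      using that unfolding D0 by (metis vector_add_component vector_scaleR_component zero_index real_scaleR_def)
    have vn: "v $ n = 0" using eq[of j] j by (simp add: L_def)
    have L: "L v $ k = 0" for k using eq[of k] by (simp add: vn)
    have "v $ k = 0" for k
    proof (cases "k = n")
      case False
      show ?thesis
      proof (cases "k = j")
        case True
        then show ?thesis using L[of n] False by (simp add: L_def)
      next
        case kj: False
        then show ?thesis using L[of k] False by (simp add: L_def)
      qed
    qed (simp add: vn)
    then show ?thesis by (simp add: vec_eq_iff)
  qed
  obtain U V \<Psi> where UV: "open U" "U \<subseteq> Q" "0 \<in> U" "open V" "homeomorphism U V \<Phi> \<Psi>" "smooth_on V \<Psi>"
    using smooth_inverse_function[OF Q sm\<Phi> zQ inj] by blast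
  have V: "V = \<Phi> ` U" using UV(5) by (simp add: homeomorphism_def)
  show ?thesis
  proof (rule that[of U V \<Phi> \<Psi>])
    show "x0 \<in> V" using UV(3) \<Phi>0 by (force simp: V)
    show "V \<subseteq> W" using UV(2) \<phi>W by (auto simp: V \<Phi>_def Q_def)
    show "smooth_on U \<Phi>" by (rule smooth_on_subset[OF sm\<Phi> UV(2)])
    show "fderiv \<Phi> y (axis n 1) = X (\<Phi> y)" if "y \<in> U" for y
      using Dn UV(2) that by blast
  qed (rule UV)+
qed

section \<open>Tensor calculus on a manifold\<close>

lemma scaleR_fun_apply [simp]: "(r *\<^sub>R f) x = r *\<^sub>R f x"
  by (simp add: scaleR_fun_def)

lemma sum_apply: "(\<Sum>i\<in>I. f i) x = (\<Sum>i\<in>I. f i x)"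
  by (induction I rule: infinite_finite_induct) auto

text \<open>Product rule for a derivative evaluated at a moving vector: the first summand
  differentiates \<open>T\<close> once more with \<open>h y\<close> frozen, the second moves the
  vector. It is used to differentiate the transformation law of vector fields.\<close>

lemma has_derivative_frechet_apply:
  fixes T :: "'a::euclidean_space \<Rightarrow> 'b::real_normed_vector" and h :: "'a \<Rightarrow> 'a"
  assumes "open S" "smooth_on S T" "y \<in> S" "(h has_derivative h') (at y)"
  shows "((\<lambda>y. fderiv T y (h y)) has_derivative
    (\<lambda>w. fderiv (\<lambda>z. fderiv T z (h y)) y w
       + fderiv T y (h' w))) (at y)"
proof -
  let ?D = "\<lambda>y. fderiv T y"
  have lin: "linear (?D z)" if "z \<in> S" for z
    by (rule has_derivative_linear[OF smooth_on_fderiv[OF assms(2) that]])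
  have ex: "?D z v = (\<Sum>b\<in>Basis. (v \<bullet> b) *\<^sub>R ?D z b)" if "z \<in> S" for z v
    by (rule linear_expand[OF lin[OF that]])
  have Db: "((\<lambda>z. ?D z b) has_derivative fderiv (\<lambda>z. ?D z b) y) (at y)" for b
    by (rule smooth_on_fderiv[OF smooth_on_frechet[OF assms(2)] assms(3)])
  have "((\<lambda>z. \<Sum>b\<in>Basis. (h y \<bullet> b) *\<^sub>R ?D z b) has_derivative
      (\<lambda>w. \<Sum>b\<in>Basis. (h y \<bullet> b) *\<^sub>R fderiv (\<lambda>z. ?D z b) y w)) (at y)"
    by (intro has_derivative_sum bounded_linear.has_derivative[OF bounded_linear_scaleR_right] Db)
  then have "((\<lambda>z. ?D z (h y)) has_derivative
      (\<lambda>w. \<Sum>b\<in>Basis. (h y \<bullet> b) *\<^sub>R fderiv (\<lambda>z. ?D z b) y w)) (at y)"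
    by (rule has_derivative_cong_open[OF assms(1,3), THEN iffD1, rotated]) (rule ex[symmetric])
  then have D2: "fderiv (\<lambda>z. ?D z (h y)) y
      = (\<lambda>w. \<Sum>b\<in>Basis. (h y \<bullet> b) *\<^sub>R fderiv (\<lambda>z. ?D z b) y w)"
    by (rule frechet_derivative_at[symmetric])
  have "((\<lambda>z. \<Sum>b\<in>Basis. (h z \<bullet> b) *\<^sub>R ?D z b) has_derivative
      (\<lambda>w. \<Sum>b\<in>Basis. (h y \<bullet> b) *\<^sub>R fderiv (\<lambda>z. ?D z b) y w + (h' w \<bullet> b) *\<^sub>R ?D y b)) (at y)"
    by (intro has_derivative_sum has_derivative_scaleR Db has_derivative_inner_left assms(4))
  then have "((\<lambda>z. \<Sum>b\<in>Basis. (h z \<bullet> b) *\<^sub>R ?D z b) has_derivative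
      (\<lambda>w. fderiv (\<lambda>z. ?D z (h y)) y w + ?D y (h' w))) (at y)"
    by (rule has_derivative_eq_rhs) (simp add: D2 ex[OF assms(3), symmetric] sum.distrib)
  then show ?thesis
    by (rule has_derivative_cong_open[OF assms(1,3), THEN iffD1, rotated]) (rule ex[symmetric])
qed

locale smooth_atlas =
  fixes A :: "('m, 'i::finite) chart set"
  assumes atlas: "atlas A"
begin

lemma inj_chart: "c \<in> A \<Longrightarrow> inj_on (snd c) (fst c)"
  and open_chart: "c \<in> A \<Longrightarrow> open (snd c ` fst c)"
  using atlas by (auto simp: atlas_def is_chart_def)

lemma cinv_chart [simp]: "c \<in> A \<Longrightarrow> p \<in> fst c \<Longrightarrow> cinv c (snd c p) = p"
  unfolding cinv_def by (rule inv_into_f_f[OF inj_chart])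

lemma chart_cinv: "c \<in> A \<Longrightarrow> y \<in> snd c ` fst c \<Longrightarrow> snd c (cinv c y) = y \<and> cinv c y \<in> fst c"
  by auto

definition overlap :: "('m, 'i) chart \<Rightarrow> ('m, 'i) chart \<Rightarrow> (real ^ 'i) set" where
  "overlap c c' = snd c ` (fst c \<inter> fst c')"

definition trans :: "('m, 'i) chart \<Rightarrow> ('m, 'i) chart \<Rightarrow> real ^ 'i \<Rightarrow> real ^ 'i" where
  "trans c c' = snd c' \<circ> cinv c"

definition dtrans :: "('m, 'i) chart \<Rightarrow> ('m, 'i) chart \<Rightarrow> 'm \<Rightarrow> real ^ 'i \<Rightarrow> real ^ 'i" where
  "dtrans c c' p = fderiv (trans c c') (snd c p)"

lemma open_overlap: "c \<in> A \<Longrightarrow> c' \<in> A \<Longrightarrow> open (overlap c c')"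
  and smooth_trans: "c \<in> A \<Longrightarrow> c' \<in> A \<Longrightarrow> smooth_on (overlap c c') (trans c c')"
  using atlas by (auto simp: atlas_def compatible_def overlap_def trans_def)

lemma overlapI: "p \<in> fst c \<Longrightarrow> p \<in> fst c' \<Longrightarrow> snd c p \<in> overlap c c'"
  by (auto simp: overlap_def)

lemma trans_chart: "c \<in> A \<Longrightarrow> p \<in> fst c \<Longrightarrow> trans c c' (snd c p) = snd c' p"
  by (simp add: trans_def)

lemma has_derivative_trans:
  assumes "c \<in> A" "c' \<in> A" "p \<in> fst c" "p \<in> fst c'"
  shows "(trans c c' has_derivative dtrans c c' p) (at (snd c p))"
  unfolding dtrans_def
  by (rule smooth_on_fderiv[OF smooth_trans[OF assms(1,2)] overlapI[OF assms(3,4)]])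

lemma linear_dtrans:
  assumes "c \<in> A" "c' \<in> A" "p \<in> fst c" "p \<in> fst c'"
  shows "linear (dtrans c c' p)"
  by (rule has_derivative_linear[OF has_derivative_trans[OF assms]])

lemma dtrans_self: assumes "c \<in> A" "p \<in> fst c" shows "dtrans c c p = (\<lambda>v. v)"
proof -
  have "((\<lambda>y. y) has_derivative (\<lambda>v. v)) (at (snd c p))" by simp
  then have "(trans c c has_derivative (\<lambda>v. v)) (at (snd c p))"
    by (rule has_derivative_transform_within_open[OF _ open_chart[OF assms(1)]])
      (use assms in \<open>auto simp: trans_def\<close>)
  then show ?thesis using has_derivative_unique[OF has_derivative_trans] assms by blast
qed

lemma dtrans_dtrans:
  assumes "c \<in> A" "c' \<in> A" "c'' \<in> A" "p \<in> fst c" "p \<in> fst c'" "p \<in> fst c''"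
  shows "dtrans c' c'' p (dtrans c c' p v) = dtrans c c'' p v"
proof -
  have "(trans c' c'' has_derivative dtrans c' c'' p) (at (trans c c' (snd c p)))"
    using has_derivative_trans[OF assms(2,3,5,6)] assms by (simp add: trans_chart)
  from has_derivative_compose[OF has_derivative_trans[OF assms(1,2,4,5)] this]
  have "((\<lambda>y. trans c' c'' (trans c c' y)) has_derivative (\<lambda>v. dtrans c' c'' p (dtrans c c' p v))) (at (snd c p))" .
  then have "(trans c c'' has_derivative (\<lambda>v. dtrans c' c'' p (dtrans c c' p v))) (at (snd c p))"
    by (rule has_derivative_transform_within_open[OF _ open_overlap[OF assms(1,2)] overlapI[OF assms(4,5)]])
      (use assms in \<open>auto simp: trans_def overlap_def\<close>)
  from has_derivative_unique[OF this has_derivative_trans[OF assms(1,3,4,6)]]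
  show ?thesis by metis
qed

lemma tspace_dtrans:
  assumes "v \<in> tspace A p" "c \<in> A" "c' \<in> A" "p \<in> fst c" "p \<in> fst c'"
  shows "v c' = dtrans c c' p (v c)"
  using assms unfolding tspace_def dtrans_def trans_def by blast

lemma tspace_0: "v \<in> tspace A p \<Longrightarrow> c \<notin> A \<or> p \<notin> fst c \<Longrightarrow> v c = 0"
  unfolding tspace_def by blast

lemma tspaceI:
  assumes "\<And>c c'. c \<in> A \<Longrightarrow> c' \<in> A \<Longrightarrow> p \<in> fst c \<Longrightarrow> p \<in> fst c' \<Longrightarrow> v c' = dtrans c c' p (v c)"
    and "\<And>c. c \<notin> A \<or> p \<notin> fst c \<Longrightarrow> v c = 0"
  shows "v \<in> tspace A p"
  using assms unfolding tspace_def dtrans_def trans_def by blast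

lemma tspace_eqI:
  assumes "v \<in> tspace A p" "w \<in> tspace A p" "c \<in> A" "p \<in> fst c" "v c = w c"
  shows "v = w"
proof
  fix c'
  show "v c' = w c'"
    using tspace_dtrans[OF assms(1,3) _ assms(4)] tspace_dtrans[OF assms(2,3) _ assms(4)]
      tspace_0[OF assms(1), of c'] tspace_0[OF assms(2), of c'] assms(5)
    by (cases "c' \<in> A \<and> p \<in> fst c'") auto
qed

lemma tspace_add: "v \<in> tspace A p \<Longrightarrow> w \<in> tspace A p \<Longrightarrow> v + w \<in> tspace A p"
  and tspace_scaleR: "v \<in> tspace A p \<Longrightarrow> r *\<^sub>R v \<in> tspace A p"
  and tspace_zero: "0 \<in> tspace A p"
proof -
  show "v + w \<in> tspace A p" if v: "v \<in> tspace A p" and w: "w \<in> tspace A p"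
  proof (rule tspaceI)
    fix c c' assume c: "c \<in> A" "c' \<in> A" "p \<in> fst c" "p \<in> fst c'"
    show "(v + w) c' = dtrans c c' p ((v + w) c)"
      by (simp add: tspace_dtrans[OF v c] tspace_dtrans[OF w c] linear_add[OF linear_dtrans[OF c]])
  qed (simp add: tspace_0[OF v] tspace_0[OF w])
  show "r *\<^sub>R v \<in> tspace A p" if v: "v \<in> tspace A p"
  proof (rule tspaceI)
    fix c c' assume c: "c \<in> A" "c' \<in> A" "p \<in> fst c" "p \<in> fst c'"
    show "(r *\<^sub>R v) c' = dtrans c c' p ((r *\<^sub>R v) c)"
      by (simp add: tspace_dtrans[OF v c] linear_scale[OF linear_dtrans[OF c]])
  qed (simp add: tspace_0[OF v])
  show "0 \<in> tspace A p"
    by (rule tspaceI) (simp_all add: linear_0[OF linear_dtrans])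
qed

lemma tspace_diff: "v \<in> tspace A p \<Longrightarrow> w \<in> tspace A p \<Longrightarrow> v - w \<in> tspace A p"
proof -
  assume "v \<in> tspace A p" "w \<in> tspace A p"
  then have "v + (-1) *\<^sub>R w \<in> tspace A p" by (intro tspace_add tspace_scaleR)
  moreover have "v + (-1) *\<^sub>R w = v - w" by (simp add: fun_eq_iff)
  ultimately show ?thesis by simp
qed

lemma tspace_sum: "(\<And>i. i \<in> I \<Longrightarrow> f i \<in> tspace A p) \<Longrightarrow> (\<Sum>i\<in>I. f i) \<in> tspace A p"
  by (induction I rule: infinite_finite_induct) (auto intro: tspace_add tspace_zero)

lemma coord_vec_eq: "coord_vec A c i p =
    (\<lambda>c'. if c' \<in> A \<and> p \<in> fst c' then dtrans c c' p (axis i 1) else 0)"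
  unfolding coord_vec_def dtrans_def trans_def ..

lemma coord_vec_tspace:
  assumes "c \<in> A" "p \<in> fst c" shows "coord_vec A c i p \<in> tspace A p"
  by (rule tspaceI) (use assms in \<open>auto simp: coord_vec_eq dtrans_dtrans\<close>)

lemma coord_vec_self [simp]:
  "c \<in> A \<Longrightarrow> p \<in> fst c \<Longrightarrow> coord_vec A c i p c = axis i 1"
  by (simp add: coord_vec_eq dtrans_self)

lemma vec_expand: "(\<Sum>i\<in>UNIV. (v $ i) *\<^sub>R axis i (1::real)) = v"
  by (simp add: vec_eq_iff axis_def if_distrib[of "\<lambda>x. _ * x"] cong: if_cong)

lemma tspace_expand:
  assumes "v \<in> tspace A p" "c \<in> A" "p \<in> fst c"
  shows "v = (\<Sum>i\<in>UNIV. (v c $ i) *\<^sub>R coord_vec A c i p)"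
proof (rule tspace_eqI[OF assms(1) _ assms(2,3)])
  show "(\<Sum>i\<in>UNIV. (v c $ i) *\<^sub>R coord_vec A c i p) \<in> tspace A p"
    by (intro tspace_sum tspace_scaleR coord_vec_tspace assms)
  show "v c = (\<Sum>i\<in>UNIV. (v c $ i) *\<^sub>R coord_vec A c i p) c"
    using assms by (simp add: sum_apply vec_expand)
qed

lemma chart_at:
  assumes "c \<in> A" "p \<in> fst c"
  shows "chart_at A p \<in> A" "p \<in> fst (chart_at A p)"
  using someI[of "\<lambda>c. c \<in> A \<and> p \<in> fst c" c] assms unfolding chart_at_def by auto

text \<open>Frees \<open>tderiv\<close> from the chart chosen by \<open>chart_at\<close>: by the
  chain rule the coordinate change in the function is absorbed by the transformation law of
  \<open>v\<close>.\<close>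

lemma tderiv_eq:
  assumes "c \<in> A" "p \<in> fst c" "v \<in> tspace A p" "((f \<circ> cinv c) has_derivative f') (at (snd c p))"
  shows "tderiv A v f p = f' (v c)"
proof -
  let ?c = "chart_at A p"
  note ca = chart_at[OF assms(1,2)]
  have "((f \<circ> cinv c) has_derivative f') (at (trans ?c c (snd ?c p)))"
    using assms(4) ca by (simp add: trans_chart)
  from has_derivative_compose[OF has_derivative_trans[OF ca(1) assms(1) ca(2) assms(2)] this]
  have "((f \<circ> cinv ?c) has_derivative (\<lambda>v. f' (dtrans ?c c p v))) (at (snd ?c p))"
    by (rule has_derivative_transform_within_open[OF _ open_overlap[OF ca(1) assms(1)] overlapI[OF ca(2) assms(2)]])
      (use assms ca in \<open>auto simp: trans_def overlap_def\<close>)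
  then have "fderiv (f \<circ> cinv ?c) (snd ?c p) = (\<lambda>v. f' (dtrans ?c c p v))"
    by (rule frechet_derivative_at[symmetric])
  then show ?thesis
    using tspace_dtrans[OF assms(3) ca(1) assms(1) ca(2) assms(2)] by (simp add: tderiv_def Let_def)
qed

text \<open>\<open>topology\<close> returns its predicate only if that predicate is an
  \<open>istopology\<close>. For intersections this uses that coordinate maps are injective, so that
  images commute with intersections.\<close>

lemma openin_mtop: "openin (mtop A) U \<longleftrightarrow> U \<subseteq> mcarrier A \<and> (\<forall>c\<in>A. open (snd c ` (U \<inter> fst c)))"
proof -
  have "istopology (\<lambda>U. U \<subseteq> mcarrier A \<and> (\<forall>c\<in>A. open (snd c ` (U \<inter> fst c))))"
    unfolding istopology_def
  proof (intro conjI allI impI ballI)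
    fix S T c assume S: "S \<subseteq> mcarrier A \<and> (\<forall>c\<in>A. open (snd c ` (S \<inter> fst c)))"
      and T: "T \<subseteq> mcarrier A \<and> (\<forall>c\<in>A. open (snd c ` (T \<inter> fst c)))" and c: "c \<in> A"
    have "snd c ` (S \<inter> T \<inter> fst c) = snd c ` (S \<inter> fst c) \<inter> snd c ` (T \<inter> fst c)"
      using inj_chart[OF c] by (auto simp: inj_on_def)
    then show "open (snd c ` (S \<inter> T \<inter> fst c))" using S T c by auto
  next
    fix S T assume "S \<subseteq> mcarrier A \<and> (\<forall>c\<in>A. open (snd c ` (S \<inter> fst c)))"
    then show "S \<inter> T \<subseteq> mcarrier A" by blast
  next
    fix K c assume K: "\<forall>S\<in>K. S \<subseteq> mcarrier A \<and> (\<forall>c\<in>A. open (snd c ` (S \<inter> fst c)))" and c: "c \<in> A"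
    have "snd c ` (\<Union>K \<inter> fst c) = (\<Union>S\<in>K. snd c ` (S \<inter> fst c))" by auto
    then show "open (snd c ` (\<Union>K \<inter> fst c))" using K c by auto
  next
    fix K assume "\<forall>S\<in>K. S \<subseteq> mcarrier A \<and> (\<forall>c\<in>A. open (snd c ` (S \<inter> fst c)))"
    then show "\<Union>K \<subseteq> mcarrier A" by blast
  qed
  then show ?thesis unfolding mtop_def by (simp add: topology_inverse')
qed

lemma openin_image: "openin (mtop A) U \<Longrightarrow> c \<in> A \<Longrightarrow> open (snd c ` (U \<inter> fst c))"
  by (simp add: openin_mtop)

lemma openin_chart: "c \<in> A \<Longrightarrow> openin (mtop A) (fst c)"
  using open_overlap by (auto simp: openin_mtop mcarrier_def overlap_def Int_commute)

lemma vfield_tspace: "vfield A U X \<Longrightarrow> p \<in> U \<Longrightarrow> X p \<in> tspace A p"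
  by (simp add: vfield_def)

lemma vfield_smooth: "vfield A U X \<Longrightarrow> c \<in> A \<Longrightarrow> smooth_on (snd c ` (U \<inter> fst c)) (\<lambda>y. X (cinv c y) c)"
  by (simp add: vfield_def)

lemma vfield_subset: "vfield A U X \<Longrightarrow> V \<subseteq> U \<Longrightarrow> vfield A V X"
  unfolding vfield_def by (meson Int_mono image_mono order_refl smooth_on_subset subsetD)

lemma vfield_has_derivative:
  assumes "vfield A U X" "c \<in> A" "p \<in> U" "p \<in> fst c"
  shows "((\<lambda>y. X (cinv c y) c) has_derivative fderiv (\<lambda>y. X (cinv c y) c) (snd c p)) (at (snd c p))"
  by (rule smooth_on_fderiv[OF vfield_smooth[OF assms(1,2)]]) (use assms in auto)

lemma smooth_fun_has_derivative:
  assumes "smooth_fun A U f" "c \<in> A" "p \<in> U" "p \<in> fst c"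
  shows "((f \<circ> cinv c) has_derivative fderiv (f \<circ> cinv c) (snd c p)) (at (snd c p))"
  by (rule smooth_on_fderiv[of "snd c ` (U \<inter> fst c)"]) (use assms in \<open>auto simp: smooth_fun_def\<close>)

lemma vfield_add:
  assumes "openin (mtop A) U" "vfield A U X" "vfield A U Y"
  shows "vfield A U (\<lambda>p. X p + Y p)"
  unfolding vfield_def
proof (intro conjI ballI)
  show "X p + Y p \<in> tspace A p" if "p \<in> U" for p
    by (intro tspace_add vfield_tspace[OF assms(2) that] vfield_tspace[OF assms(3) that])
  show "smooth_on (snd c ` (U \<inter> fst c)) (\<lambda>y. (X (cinv c y) + Y (cinv c y)) c)" if "c \<in> A" for c
    unfolding plus_fun_apply
    by (intro smooth_on_add openin_image[OF assms(1) that] vfield_smooth[OF _ that] assms)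
qed

lemma vfield_scaleR:
  assumes "openin (mtop A) U" "smooth_fun A U f" "vfield A U X"
  shows "vfield A U (\<lambda>p. f p *\<^sub>R X p)"
  unfolding vfield_def
proof (intro conjI ballI)
  fix c assume c: "c \<in> A"
  have "smooth_on (snd c ` (U \<inter> fst c)) (\<lambda>y. (f \<circ> cinv c) y *\<^sub>R X (cinv c y) c)"
    by (rule smooth_on_scaleR[OF openin_image[OF assms(1) c] _ vfield_smooth[OF assms(3) c]])
      (use assms(2) c in \<open>auto simp only: smooth_fun_def\<close>)
  then show "smooth_on (snd c ` (U \<inter> fst c)) (\<lambda>y. (f (cinv c y) *\<^sub>R X (cinv c y)) c)" by simp
qed (use assms in \<open>auto intro: tspace_scaleR vfield_tspace\<close>)

lemma vfield_coord_vec: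
  assumes "c \<in> A" shows "vfield A (fst c) (coord_vec A c i)"
  unfolding vfield_def
proof (intro conjI ballI)
  show "coord_vec A c i p \<in> tspace A p" if "p \<in> fst c" for p using coord_vec_tspace assms that .
  fix c' assume c': "c' \<in> A"
  have eq: "snd c' ` (fst c \<inter> fst c') = overlap c' c" by (auto simp: overlap_def)
  have "smooth_on (overlap c' c) (\<lambda>y. fderiv (trans c c') (trans c' c y) (axis i 1))"
    by (rule smooth_on_compose[OF open_overlap[OF c' assms] open_overlap[OF assms c']
          smooth_on_frechet[OF smooth_trans[OF assms c']] smooth_trans[OF c' assms]])
      (use c' in \<open>auto simp: overlap_def trans_def\<close>)
  moreover have "fderiv (trans c c') (trans c' c y) (axis i 1) = coord_vec A c i (cinv c' y) c'"
    if "y \<in> overlap c' c" for y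
    using that c' by (auto simp: overlap_def coord_vec_eq dtrans_def trans_def)
  ultimately show "smooth_on (snd c' ` (fst c \<inter> fst c')) (\<lambda>y. coord_vec A c i (cinv c' y) c')"
    unfolding eq using smooth_on_cong[OF open_overlap[OF c' assms]] by (metis (no_types, lifting))
qed

text \<open>Derivative of the transformation law. The summand with the second derivative of the
  coordinate change is what prevents the derivative of a vector field from being a tangent
  vector.\<close>

lemma vfield_derivative_dtrans:
  assumes U: "openin (mtop A) U" "vfield A U X" and p: "p \<in> U" "c \<in> A" "p \<in> fst c" "c' \<in> A" "p \<in> fst c'"
  shows "fderiv (\<lambda>y. X (cinv c' y) c') (snd c' p) (dtrans c c' p w)
    = fderiv (\<lambda>y. fderiv (trans c c') y (X p c)) (snd c p) w
      + dtrans c c' p (fderiv (\<lambda>y. X (cinv c y) c) (snd c p) w)"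
proof -
  let ?y = "snd c p"
  let ?X = "\<lambda>c y. X (cinv c y) c"
  let ?S = "snd c ` (U \<inter> fst c) \<inter> overlap c c'"
  have S: "open ?S" "?y \<in> ?S"
    using openin_image[OF U(1) p(2)] open_overlap[OF p(2,4)] p overlapI by auto
  have "(?X c' has_derivative fderiv (?X c') (snd c' p)) (at (trans c c' ?y))"
    using vfield_has_derivative[OF U(2) p(4,1,5)] p by (simp add: trans_chart)
  from has_derivative_compose[OF has_derivative_trans[OF p(2,4,3,5)] this]
  have 1: "((\<lambda>y. ?X c' (trans c c' y)) has_derivative
     (\<lambda>w. fderiv (?X c') (snd c' p) (dtrans c c' p w))) (at ?y)" .
  have "((\<lambda>y. fderiv (trans c c') y (?X c y)) has_derivative
    (\<lambda>w. fderiv (\<lambda>z. fderiv (trans c c') z (?X c ?y)) ?y w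
       + fderiv (trans c c') ?y (fderiv (?X c) ?y w))) (at ?y)"
    by (rule has_derivative_frechet_apply[OF open_overlap[OF p(2,4)] smooth_trans[OF p(2,4)]
          overlapI[OF p(3,5)] vfield_has_derivative[OF U(2) p(2,1,3)]])
  then have "((\<lambda>y. ?X c' (trans c c' y)) has_derivative
    (\<lambda>w. fderiv (\<lambda>z. fderiv (trans c c') z (?X c ?y)) ?y w
       + fderiv (trans c c') ?y (fderiv (?X c) ?y w))) (at ?y)"
  proof (rule has_derivative_transform_within_open[OF _ S])
    fix y assume "y \<in> ?S"
    then obtain q where q: "y = snd c q" "q \<in> U" "q \<in> fst c" "q \<in> fst c'"
      using inj_chart[OF p(2)] by (auto simp: overlap_def inj_on_def)
    show "fderiv (trans c c') y (?X c y) = ?X c' (trans c c' y)"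
      using tspace_dtrans[OF vfield_tspace[OF U(2) q(2)] p(2,4) q(3,4)] q p
      by (simp add: trans_chart dtrans_def)
  qed
  from has_derivative_unique[OF 1 this] p show ?thesis
    by (simp add: dtrans_def fun_eq_iff)
qed

text \<open>In the bracket the terms with second derivatives of the coordinate change cancel, since
  these derivatives are symmetric.\<close>

lemma lie_bracket_tspace:
  assumes U: "openin (mtop A) U" "vfield A U X" "vfield A U Y" and p: "p \<in> U"
  shows "lie_bracket A X Y p \<in> tspace A p"
proof (rule tspaceI)
  fix c c' assume c: "c \<in> A" "c' \<in> A" "p \<in> fst c" "p \<in> fst c'"
  let ?X = "\<lambda>c y. X (cinv c y) c" and ?Y = "\<lambda>c y. Y (cinv c y) c"
  let ?D2 = "\<lambda>v w. fderiv (\<lambda>y. fderiv (trans c c') y v) (snd c p) w"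
  have X: "X p c' = dtrans c c' p (X p c)" and Y: "Y p c' = dtrans c c' p (Y p c)"
    using tspace_dtrans c vfield_tspace U p by blast+
  have sym: "?D2 (Y p c) (X p c) = ?D2 (X p c) (Y p c)"
    by (rule fderiv_symmetric[OF open_overlap[OF c(1,2)] overlapI[OF c(3,4)]
          smooth_onD[OF smooth_trans[OF c(1,2)]]])
  show "lie_bracket A X Y p c' = dtrans c c' p (lie_bracket A X Y p c)"
    using vfield_derivative_dtrans[OF U(1,2) p c(1,3,2,4), of "Y p c"]
      vfield_derivative_dtrans[OF U(1,3) p c(1,3,2,4), of "X p c"] c
    by (simp add: lie_bracket_def X Y sym linear_diff[OF linear_dtrans])
qed (auto simp: lie_bracket_def)

end

section \<open>The metric and its Lie derivative in coordinates\<close>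

locale pseudo_riemannian = smooth_atlas A for A :: "('m, 'i::finite) chart set" +
  fixes g :: "'m \<Rightarrow> ('m, 'i) tvec \<Rightarrow> ('m, 'i) tvec \<Rightarrow> real"
  assumes metric: "pseudo_metric A g"
begin

lemma mcarrierI: "c \<in> A \<Longrightarrow> p \<in> fst c \<Longrightarrow> p \<in> mcarrier A"
  by (auto simp: mcarrier_def)

lemma
  assumes "p \<in> mcarrier A" "v \<in> tspace A p" "w \<in> tspace A p"
  shows metric_add_left: "\<And>v'. v' \<in> tspace A p \<Longrightarrow> g p (v + v') w = g p v w + g p v' w"
    and metric_scaleR_left: "g p (r *\<^sub>R v) w = r * g p v w"
    and metric_sym: "g p v w = g p w v"
proof -
  note m = metric[unfolded pseudo_metric_def, THEN conjunct1, rule_format, OF assms(1,2)]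
  show "g p (v + v') w = g p v w + g p v' w" if "v' \<in> tspace A p" for v'
    by (rule m[OF that assms(3), THEN conjunct1])
  show "g p (r *\<^sub>R v) w = r * g p v w" by (rule m[OF assms(2,3), THEN conjunct2, THEN conjunct1])
  show "g p v w = g p w v" by (rule m[OF assms(2,3), THEN conjunct2, THEN conjunct2])
qed

lemma metric_nondegenerate:
  assumes "p \<in> mcarrier A" "v \<in> tspace A p" "\<And>w. w \<in> tspace A p \<Longrightarrow> g p v w = 0"
  shows "v = 0"
  using metric[unfolded pseudo_metric_def, THEN conjunct2, THEN conjunct1, rule_format, OF assms(1,2)] assms(3)
  by simp

lemma metric_smooth:
  assumes "openin (mtop A) U" "vfield A U X" "vfield A U Y"
  shows "smooth_fun A U (\<lambda>p. g p (X p) (Y p))"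
  using metric[unfolded pseudo_metric_def, THEN conjunct2, THEN conjunct2, rule_format] assms by simp

lemma metric_add_right: "p \<in> mcarrier A \<Longrightarrow> v \<in> tspace A p \<Longrightarrow> v' \<in> tspace A p \<Longrightarrow> w \<in> tspace A p \<Longrightarrow>
    g p w (v + v') = g p w v + g p w v'"
  by (metis metric_add_left metric_sym tspace_add)

lemma metric_scaleR_right: "p \<in> mcarrier A \<Longrightarrow> v \<in> tspace A p \<Longrightarrow> w \<in> tspace A p \<Longrightarrow>
    g p w (r *\<^sub>R v) = r * g p w v"
  by (metis metric_scaleR_left metric_sym tspace_scaleR)

lemma metric_zero_left: "p \<in> mcarrier A \<Longrightarrow> w \<in> tspace A p \<Longrightarrow> g p 0 w = 0"
  using metric_scaleR_left[of p 0 w 0] tspace_zero by simp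

lemma metric_sum_left: "p \<in> mcarrier A \<Longrightarrow> (\<And>i. i \<in> I \<Longrightarrow> f i \<in> tspace A p) \<Longrightarrow> w \<in> tspace A p \<Longrightarrow>
    g p (\<Sum>i\<in>I. f i) w = (\<Sum>i\<in>I. g p (f i) w)"
  by (induction I rule: infinite_finite_induct)
    (auto simp: metric_add_left tspace_sum metric_zero_left)

lemma metric_sum_right: "p \<in> mcarrier A \<Longrightarrow> (\<And>i. i \<in> I \<Longrightarrow> f i \<in> tspace A p) \<Longrightarrow> w \<in> tspace A p \<Longrightarrow>
    g p w (\<Sum>i\<in>I. f i) = (\<Sum>i\<in>I. g p w (f i))"
  by (subst metric_sym) (auto simp: metric_sum_left tspace_sum intro!: sum.cong metric_sym)

definition gram :: "('m, 'i) chart \<Rightarrow> 'i \<Rightarrow> 'i \<Rightarrow> 'm \<Rightarrow> real" where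
  "gram c i j p = g p (coord_vec A c i p) (coord_vec A c j p)"

lemma metric_gram:
  assumes "c \<in> A" "p \<in> fst c" "v \<in> tspace A p" "w \<in> tspace A p"
  shows "g p v w = (\<Sum>i\<in>UNIV. \<Sum>j\<in>UNIV. v c $ i * w c $ j * gram c i j p)"
proof -
  have c: "coord_vec A c i p \<in> tspace A p" for i by (rule coord_vec_tspace[OF assms(1,2)])
  note p = mcarrierI[OF assms(1,2)]
  have "g p v w = g p (\<Sum>i\<in>UNIV. (v c $ i) *\<^sub>R coord_vec A c i p) (\<Sum>j\<in>UNIV. (w c $ j) *\<^sub>R coord_vec A c j p)"
    using tspace_expand[OF assms(3,1,2)] tspace_expand[OF assms(4,1,2)] by simp
  also have "\<dots> = (\<Sum>i\<in>UNIV. \<Sum>j\<in>UNIV. v c $ i * w c $ j * gram c i j p)"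
    using p c by (subst sum.swap) (simp add: metric_sum_left metric_sum_right tspace_sum tspace_scaleR
        metric_scaleR_left metric_scaleR_right gram_def sum_distrib_left mult.assoc mult.left_commute)
  finally show ?thesis .
qed

lemma gram_has_derivative:
  assumes "c \<in> A" "p \<in> fst c"
  shows "((gram c i j \<circ> cinv c) has_derivative fderiv (gram c i j \<circ> cinv c) (snd c p)) (at (snd c p))"
proof -
  have "smooth_fun A (fst c) (gram c i j)"
    unfolding gram_def by (intro metric_smooth openin_chart vfield_coord_vec assms)
  then show ?thesis using smooth_fun_has_derivative assms by blast
qed

text \<open>If the coordinate derivatives of \<open>Z\<close> along \<open>X p\<close> and
  \<open>Y p\<close> vanish, the brackets reduce to the derivatives of \<open>X\<close> and
  \<open>Y\<close> along \<open>Z\<close>, which cancel against the product rule. Only these two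
  directions and only the point \<open>p\<close> are restricted: on the zero section of D the field
  \<open>u\<close> is constant along base directions but in general not along fibre
  directions.\<close>

lemma lie_metric_gram:
  assumes U: "openin (mtop A) U" "vfield A U X" "vfield A U Y" "vfield A U Z"
    and p: "p \<in> U" "c \<in> A" "p \<in> fst c"
    and Z: "fderiv (\<lambda>y. Z (cinv c y) c) (snd c p) (X p c) = 0"
      "fderiv (\<lambda>y. Z (cinv c y) c) (snd c p) (Y p c) = 0"
  shows "lie_metric A Z g X Y p =
    (\<Sum>i\<in>UNIV. \<Sum>j\<in>UNIV. X p c $ i * Y p c $ j * fderiv (gram c i j \<circ> cinv c) (snd c p) (Z p c))"
proof -
  let ?y = "snd c p"
  let ?S = "snd c ` (U \<inter> fst c)"
  let ?DX = "fderiv (\<lambda>y. X (cinv c y) c) ?y"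
  let ?DY = "fderiv (\<lambda>y. Y (cinv c y) c) ?y"
  let ?Dg = "\<lambda>i j. fderiv (gram c i j \<circ> cinv c) ?y"
  note t = vfield_tspace[OF U(2) p(1)] vfield_tspace[OF U(3) p(1)] vfield_tspace[OF U(4) p(1)]
  have S: "open ?S" "?y \<in> ?S" using openin_image[OF U(1) p(2)] p by auto
  have comp: "((\<lambda>y. X (cinv c y) c $ i) has_derivative (\<lambda>w. ?DX w $ i)) (at ?y)"
    "((\<lambda>y. Y (cinv c y) c $ i) has_derivative (\<lambda>w. ?DY w $ i)) (at ?y)" for i
    using vfield_has_derivative[OF U(2) p(2,1,3)] vfield_has_derivative[OF U(3) p(2,1,3)]
    by (auto intro: bounded_linear.has_derivative[OF bounded_linear_vec_nth])
  have "((\<lambda>y. \<Sum>i\<in>UNIV. \<Sum>j\<in>UNIV. X (cinv c y) c $ i * Y (cinv c y) c $ j * (gram c i j \<circ> cinv c) y) has_derivative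
     (\<lambda>w. \<Sum>i\<in>UNIV. \<Sum>j\<in>UNIV. (X p c $ i * Y p c $ j) * ?Dg i j w + (X p c $ i * ?DY w $ j + ?DX w $ i * Y p c $ j) * gram c i j p)) (at ?y)"
    using has_derivative_mult[OF has_derivative_mult[OF comp(1) comp(2)] gram_has_derivative[OF p(2,3)]] p
    by (intro has_derivative_sum) simp
  then have "(((\<lambda>q. g q (X q) (Y q)) \<circ> cinv c) has_derivative
     (\<lambda>w. \<Sum>i\<in>UNIV. \<Sum>j\<in>UNIV. (X p c $ i * Y p c $ j) * ?Dg i j w + (X p c $ i * ?DY w $ j + ?DX w $ i * Y p c $ j) * gram c i j p)) (at ?y)"
    by (rule has_derivative_transform_within_open[OF _ S])
      (use U p in \<open>auto simp: metric_gram[of c] vfield_tspace\<close>)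
  from tderiv_eq[OF p(2,3) t(3) this]
  have 1: "tderiv A (Z p) (\<lambda>q. g q (X q) (Y q)) p = (\<Sum>i\<in>UNIV. \<Sum>j\<in>UNIV. (X p c $ i * Y p c $ j) * ?Dg i j (Z p c)
      + (X p c $ i * ?DY (Z p c) $ j + ?DX (Z p c) $ i * Y p c $ j) * gram c i j p)" .
  have br: "lie_bracket A Z X p c = ?DX (Z p c)" "lie_bracket A Z Y p c = ?DY (Z p c)"
    using p Z by (auto simp: lie_bracket_def)
  have 2: "g p (lie_bracket A Z X p) (Y p) = (\<Sum>i\<in>UNIV. \<Sum>j\<in>UNIV. ?DX (Z p c) $ i * Y p c $ j * gram c i j p)"
    using metric_gram[OF p(2,3) lie_bracket_tspace[OF U(1,4,2) p(1)] t(2)] by (simp add: br)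
  have 3: "g p (X p) (lie_bracket A Z Y p) = (\<Sum>i\<in>UNIV. \<Sum>j\<in>UNIV. X p c $ i * ?DY (Z p c) $ j * gram c i j p)"
    using metric_gram[OF p(2,3) t(1) lie_bracket_tspace[OF U(1,4,3) p(1)]] by (simp add: br)
  show ?thesis
    unfolding lie_metric_def 1 2 3 by (simp add: sum.distrib algebra_simps)
qed

end

section \<open>Adapted charts and the total space of the distribution\<close>

locale almost_contact = pseudo_riemannian A g
  for A :: "('m, 'i::{finite, linorder}) chart set" and g +
  fixes \<phi> \<xi> \<eta>
  assumes manifold: "smooth_manifold A"
    and almost_contact: "almost_contact_metric A \<phi> \<xi> \<eta> g"
begin

abbreviation n :: 'i where "n \<equiv> last_idx"
abbreviation "e \<equiv> e_frame A \<eta>"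
abbreviation "\<Gamma>n \<equiv> Gamma_n A \<eta>"

lemma xi_vfield: "vfield A (mcarrier A) \<xi>"
  and one_form_eta: "one_form A \<eta>"
  using almost_contact unfolding almost_contact_metric_def by blast+

lemma xi_tspace: "p \<in> mcarrier A \<Longrightarrow> \<xi> p \<in> tspace A p"
  by (rule vfield_tspace[OF xi_vfield])

lemma acm_pointwise:
  assumes "p \<in> mcarrier A"
  shows eta_xi: "\<eta> p (\<xi> p) = 1" and phi_xi: "\<phi> p (\<xi> p) = 0"
    and metric_phi: "\<And>v w. v \<in> tspace A p \<Longrightarrow> w \<in> tspace A p \<Longrightarrow>
       g p (\<phi> p v) (\<phi> p w) = g p v w - \<eta> p v * \<eta> p w"
    and phi_tspace: "\<And>v. v \<in> tspace A p \<Longrightarrow> \<phi> p v \<in> tspace A p"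
  using assms almost_contact unfolding almost_contact_metric_def endo_field_def by blast+

lemma eta_add: "p \<in> mcarrier A \<Longrightarrow> v \<in> tspace A p \<Longrightarrow> w \<in> tspace A p \<Longrightarrow> \<eta> p (v + w) = \<eta> p v + \<eta> p w"
  and eta_scaleR: "p \<in> mcarrier A \<Longrightarrow> v \<in> tspace A p \<Longrightarrow> \<eta> p (r *\<^sub>R v) = r * \<eta> p v"
  using one_form_eta unfolding one_form_def by blast+

lemma eta_zero: "p \<in> mcarrier A \<Longrightarrow> \<eta> p 0 = 0"
  using eta_scaleR[of p 0 0] tspace_zero by simp

lemma eta_diff:
  assumes "p \<in> mcarrier A" "v \<in> tspace A p" "w \<in> tspace A p"
  shows "\<eta> p (v - w) = \<eta> p v - \<eta> p w"
  using eta_add[OF assms(1) tspace_diff[OF assms(2,3)] assms(3)] by simp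

lemma eta_sum: "p \<in> mcarrier A \<Longrightarrow> (\<And>i. i \<in> I \<Longrightarrow> f i \<in> tspace A p) \<Longrightarrow>
    \<eta> p (\<Sum>i\<in>I. f i) = (\<Sum>i\<in>I. \<eta> p (f i))"
  by (induction I rule: infinite_finite_induct) (auto simp: eta_add tspace_sum eta_zero)

text \<open>Insert \<open>\<xi>\<close> into the compatibility of \<open>g\<close> with
  \<open>\<phi>\<close>; since \<open>\<phi>\<close> annihilates it, the left side is 0.\<close>

lemma metric_xi:
  assumes "p \<in> mcarrier A" "v \<in> tspace A p"
  shows "g p v (\<xi> p) = \<eta> p v"
proof -
  note x = xi_tspace[OF assms(1)]
  have "g p (\<phi> p v) (\<phi> p (\<xi> p)) = 0"
    using metric_sym[OF assms(1) tspace_zero phi_tspace[OF assms]] metric_zero_left[OF assms(1) phi_tspace[OF assms]]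
    by (simp add: phi_xi[OF assms(1)])
  then show ?thesis using metric_phi[OF assms x] eta_xi[OF assms(1)] by simp
qed

text \<open>The field does not vanish because \<open>\<eta> p (\<xi> p) = 1\<close>, so
  \<open>flow_box\<close> applies to its coordinate expression. The resulting chart lies in
  \<open>A\<close> because the atlas is maximal, for which compatibility with every chart of
  \<open>A\<close> is verified in both directions.\<close>

lemma adapted_cover:
  assumes p: "p \<in> mcarrier A"
  shows "\<exists>c. adapted A \<xi> c \<and> p \<in> fst c"
proof -
  obtain c where c: "c \<in> A" "p \<in> fst c" using p by (auto simp: mcarrier_def)
  let ?W = "snd c ` fst c"
  define X where "X = (\<lambda>y. \<xi> (cinv c y) c)"
  have "mcarrier A \<inter> fst c = fst c" using c by (auto simp: mcarrier_def)
  then have smX: "smooth_on ?W X" using vfield_smooth[OF xi_vfield c(1)] by (simp add: X_def)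
  have "\<xi> p c \<noteq> 0"
  proof
    assume "\<xi> p c = 0"
    then have "\<xi> p = 0" using tspace_eqI[OF xi_tspace[OF p] tspace_zero c] by simp
    then show False using eta_xi[OF p] eta_zero[OF p] by simp
  qed
  then have nz: "X (snd c p) \<noteq> 0" using c by (simp add: X_def)
  obtain U :: "(real ^ ('i::{finite, linorder})) set" and V \<Phi> \<Psi> where fb: "open U" "open V" "snd c p \<in> V" "V \<subseteq> ?W" "homeomorphism U V \<Phi> \<Psi>"
    "smooth_on U \<Phi>" "smooth_on V \<Psi>" "\<And>y. y \<in> U \<Longrightarrow> fderiv \<Phi> y (axis n 1) = X (\<Phi> y)"
    by (rule flow_box[OF open_chart[OF c(1)] smX imageI[OF c(2)] nz, where n=n]) (rule that; assumption)
  have hom: "\<And>y. y \<in> U \<Longrightarrow> \<Psi> (\<Phi> y) = y" "\<And>x. x \<in> V \<Longrightarrow> \<Phi> (\<Psi> x) = x"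
    "\<And>y. y \<in> U \<Longrightarrow> \<Phi> y \<in> V" "\<And>x. x \<in> V \<Longrightarrow> \<Psi> x \<in> U"
    using homeomorphism_apply1[OF fb(5)] homeomorphism_apply2[OF fb(5)]
      homeomorphism_image1[OF fb(5)] homeomorphism_image2[OF fb(5)] by blast+
  define c1 where "c1 = ({q \<in> fst c. snd c q \<in> V}, \<lambda>q. \<Psi> (snd c q))"
  have inj1: "inj_on (snd c1) (fst c1)"
    using inj_chart[OF c(1)] hom(2) by (auto simp: c1_def inj_on_def) metis
  have mem: "cinv c x \<in> fst c" "snd c (cinv c x) = x" if "x \<in> V" for x
    using chart_cinv[OF c(1), of x] fb(4) that by auto
  have cinv1: "cinv c1 y = cinv c (\<Phi> y)" if "y \<in> U" for y
  proof -
    have "cinv c (\<Phi> y) \<in> fst c1" "snd c1 (cinv c (\<Phi> y)) = y"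
      using mem[OF hom(3)[OF that]] hom that by (auto simp: c1_def)
    then show ?thesis unfolding cinv_def[of c1] using inv_into_f_f[OF inj1] by metis
  qed
  have im1: "snd c1 ` (fst c1 \<inter> fst c') = {y \<in> U. \<Phi> y \<in> overlap c c'}" for c' :: "('m, 'i) chart"
  proof
    show "snd c1 ` (fst c1 \<inter> fst c') \<subseteq> {y \<in> U. \<Phi> y \<in> overlap c c'}"
      using hom by (auto simp: c1_def overlap_def)
    show "{y \<in> U. \<Phi> y \<in> overlap c c'} \<subseteq> snd c1 ` (fst c1 \<inter> fst c')"
    proof safe
      fix y assume y: "y \<in> U" "\<Phi> y \<in> overlap c c'"
      then obtain q where "q \<in> fst c" "q \<in> fst c'" "\<Phi> y = snd c q" by (auto simp: overlap_def)
      then have "q \<in> fst c1 \<inter> fst c'" "snd c1 q = y"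
        using hom(1,3)[OF y(1)] by (auto simp: c1_def)
      then show "y \<in> snd c1 ` (fst c1 \<inter> fst c')" by blast
    qed
  qed
  have open1: "open {y \<in> U. \<Phi> y \<in> overlap c c'}" if "c' \<in> A" for c'
    using continuous_open_preimage[OF smooth_on_continuous[OF fb(6)] fb(1) open_overlap[OF c(1) that]]
    by (simp add: vimage_def Int_def)
  have "is_chart c1"
    unfolding is_chart_def
  proof
    show "inj_on (snd c1) (fst c1)" by (rule inj1)
    have "{y \<in> U. \<Phi> y \<in> overlap c c} = U" using hom fb(4) by (auto simp: overlap_def)
    then have "snd c1 ` (fst c1 \<inter> fst c) = U" using im1[of c] by simp
    moreover have "fst c1 \<inter> fst c = fst c1" by (auto simp: c1_def)
    ultimately show "open (snd c1 ` fst c1)" using fb(1) by simp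
  qed
  moreover have "fst c1 \<subseteq> mcarrier A" using c by (auto simp: c1_def mcarrier_def)
  moreover have "compatible c1 c'" if c': "c' \<in> A" for c'
  proof -
    let ?S = "{y \<in> U. \<Phi> y \<in> overlap c c'}"
    have "smooth_on ?S (\<lambda>y. trans c c' (\<Phi> y))"
      by (rule smooth_on_compose[OF open1[OF c'] open_overlap[OF c(1) c'] smooth_trans[OF c(1) c'] smooth_on_subset[OF fb(6)]]) auto
    moreover have "trans c c' (\<Phi> y) = (snd c' \<circ> cinv c1) y" if "y \<in> ?S" for y
      using that cinv1 by (simp add: trans_def)
    ultimately have "smooth_on ?S (snd c' \<circ> cinv c1)"
      using smooth_on_cong[OF open1[OF c'], of "\<lambda>y. trans c c' (\<Phi> y)" "snd c' \<circ> cinv c1"] by blast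
    then show ?thesis unfolding compatible_def im1 using open1[OF c'] by blast
  qed
  moreover have "compatible c' c1" if c': "c' \<in> A" for c'
  proof -
    let ?S = "{y \<in> overlap c' c. trans c' c y \<in> V}"
    have im: "snd c' ` (fst c' \<inter> fst c1) = ?S"
      using c' by (auto simp: c1_def overlap_def trans_def)
    have opn: "open ?S"
      using continuous_open_preimage[OF smooth_on_continuous[OF smooth_trans[OF c' c(1)]] open_overlap[OF c' c(1)] fb(2)]
      by (simp add: vimage_def Int_def)
    have "smooth_on ?S (\<lambda>y. \<Psi> (trans c' c y))"
      by (rule smooth_on_compose[OF opn fb(2,7) smooth_on_subset[OF smooth_trans[OF c' c(1)]]]) auto
    then show ?thesis unfolding compatible_def im using opn by (simp add: c1_def trans_def o_def)
  qed
  ultimately have c1A: "c1 \<in> A"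
    using manifold unfolding smooth_manifold_def by blast
  have "\<xi> q = coord_vec A c1 n q" if q: "q \<in> fst c1" for q
  proof (rule tspace_eqI)
    show "q \<in> fst c" using q by (auto simp: c1_def)
    then show "\<xi> q \<in> tspace A q" using c xi_tspace by (auto simp: mcarrier_def)
    show "coord_vec A c1 n q \<in> tspace A q" by (rule coord_vec_tspace[OF c1A q])
    let ?y = "snd c1 q"
    have y: "?y \<in> U" "\<Phi> ?y = snd c q" using q hom by (auto simp: c1_def)
    have "fderiv (trans c1 c) ?y = fderiv \<Phi> ?y"
    proof (rule fderiv_cong[OF fb(1) y(1)])
      show "trans c1 c y = \<Phi> y" if "y \<in> U" for y
        using cinv1[OF that] mem[OF hom(3)[OF that]] by (simp add: trans_def)
    qed
    then show "\<xi> q c = coord_vec A c1 n q c"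
      using fb(8)[OF y(1)] \<open>q \<in> fst c\<close> c by (simp add: coord_vec_eq dtrans_def X_def y)
  qed (rule c(1))
  then have "adapted A \<xi> c1" using c1A by (simp add: adapted_def)
  then show ?thesis using c fb(3) by (auto simp: c1_def)
qed

lemma adaptedD: "adapted A \<xi> c \<Longrightarrow> c \<in> A"
  by (simp add: adapted_def)

lemma xi_adapted: "adapted A \<xi> c \<Longrightarrow> p \<in> fst c \<Longrightarrow> \<xi> p = coord_vec A c n p"
  by (simp add: adapted_def)

lemma xi_adapted_chart: "adapted A \<xi> c \<Longrightarrow> p \<in> fst c \<Longrightarrow> \<xi> p c = axis n 1"
  using xi_adapted adaptedD by simp

text \<open>The index type contains \<open>n\<close> itself, although the frame of D runs over the
  other indices. The value at \<open>n\<close> makes \<open>e_frame\<close> vanish there and is the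
  coefficient of the last component in \<open>\<eta>\<close>.\<close>

lemma Gamma_last: "adapted A \<xi> c \<Longrightarrow> p \<in> fst c \<Longrightarrow> \<Gamma>n c n p = 1"
  using eta_xi[OF mcarrierI[OF adaptedD]] by (simp add: Gamma_n_def xi_adapted)

lemma e_tspace:
  assumes "adapted A \<xi> c" "p \<in> fst c" shows "e c a p \<in> tspace A p"
  unfolding e_frame_def
  by (intro tspace_diff tspace_scaleR coord_vec_tspace adaptedD[OF assms(1)] assms(2))

lemma e_frame_chart:
  assumes "adapted A \<xi> c" "p \<in> fst c"
  shows "e c a p c = axis a 1 - \<Gamma>n c a p *\<^sub>R axis n 1"
  using assms adaptedD by (simp add: e_frame_def)

lemma eta_e_frame:
  assumes "adapted A \<xi> c" "p \<in> fst c" shows "\<eta> p (e c a p) = 0"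
proof -
  have c: "coord_vec A c i p \<in> tspace A p" for i by (rule coord_vec_tspace[OF adaptedD[OF assms(1)] assms(2)])
  show ?thesis
    using Gamma_last[OF assms] mcarrierI[OF adaptedD[OF assms(1)] assms(2)] c
    by (simp add: e_frame_def eta_diff eta_scaleR tspace_scaleR) (simp add: Gamma_n_def)
qed

lemma eta_chart:
  assumes "adapted A \<xi> c" "p \<in> fst c" "v \<in> tspace A p"
  shows "\<eta> p v = (\<Sum>i\<in>UNIV. v c $ i * \<Gamma>n c i p)"
proof -
  note c = adaptedD[OF assms(1)]
  have "\<eta> p v = \<eta> p (\<Sum>i\<in>UNIV. (v c $ i) *\<^sub>R coord_vec A c i p)"
    using tspace_expand[OF assms(3) c assms(2)] by simp
  then show ?thesis
    using mcarrierI[OF c assms(2)] coord_vec_tspace[OF c assms(2)]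
    by (simp add: eta_sum tspace_scaleR eta_scaleR Gamma_n_def)
qed

text \<open>The equation \<open>\<eta> p v = 0\<close> determines the component \<open>n\<close>
  from the others, its coefficient being 1. Hence the fibre coordinates of a point of the total
  space determine its vector.\<close>

lemma D_eqI:
  assumes "adapted A \<xi> c" "p \<in> fst c" "v \<in> tspace A p" "w \<in> tspace A p" "\<eta> p v = 0" "\<eta> p w = 0"
    and "\<And>a. a \<noteq> n \<Longrightarrow> v c $ a = w c $ a"
  shows "v = w"
proof (rule tspace_eqI[OF assms(3,4) adaptedD[OF assms(1)] assms(2)])
  have split: "\<eta> p v = v c $ n + (\<Sum>i\<in>UNIV - {n}. v c $ i * \<Gamma>n c i p)" if "v \<in> tspace A p" for v
    using eta_chart[OF assms(1,2) that] sum.remove[of UNIV n "\<lambda>i. v c $ i * \<Gamma>n c i p"]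
      Gamma_last[OF assms(1,2)] by simp
  have "(\<Sum>i\<in>UNIV - {n}. v c $ i * \<Gamma>n c i p) = (\<Sum>i\<in>UNIV - {n}. w c $ i * \<Gamma>n c i p)"
    using assms(7) by (intro sum.cong) auto
  then have "v c $ n = w c $ n"
    using split[OF assms(3)] split[OF assms(4)] assms(5,6) by simp
  then show "v c = w c" using assms(7) by (metis vec_eq_iff)
qed

end

section \<open>Coordinate vectors of the total space\<close>

lemma Rep_Base [simp]: "Rep_tot_idx (Base i) = Inl i"
  by (simp add: Base_def Abs_tot_idx_inverse)

lemma Rep_Fib [simp]: "a \<noteq> last_idx \<Longrightarrow> Rep_tot_idx (Fib a) = Inr a"
  by (simp add: Fib_def Abs_tot_idx_inverse)

lemma tot_idx_cases:
  obtains i where "k = Base i" | a where "k = Fib a" "a \<noteq> last_idx"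
proof (cases "Rep_tot_idx k")
  case (Inl i)
  then have "k = Base i" by (metis Base_def Rep_tot_idx_inverse)
  then show ?thesis by (rule that(1))
next
  case (Inr a)
  then have "k = Fib a" "a \<noteq> last_idx"
    using Rep_tot_idx[of k] by (auto simp: Fib_def) (metis Rep_tot_idx_inverse)
  then show ?thesis by (rule that(2))
qed

lemma Base_eq_iff [simp]: "Base i = Base j \<longleftrightarrow> i = j"
  by (metis Rep_Base sum.inject(1))

lemma Base_neq_Fib: "a \<noteq> last_idx \<Longrightarrow> Base i \<noteq> Fib a"
  by (metis Rep_Base Rep_Fib sum.distinct(1))

definition base_part :: "real ^ ('i::{finite, linorder}) tot_idx \<Rightarrow> real ^ ('i::{finite, linorder})" where
  "base_part w = (\<chi> i. w $ Base i)"

text \<open>The entry at \<open>last_idx\<close> is a filler: there is no fibre coordinate with that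
  index, and the last component of a vector of D follows from the others.\<close>

definition fib_part :: "real ^ ('i::{finite, linorder}) tot_idx \<Rightarrow> real ^ ('i::{finite, linorder})" where
  "fib_part w = (\<chi> a. if a = last_idx then 0 else w $ Fib a)"

definition join :: "real ^ ('i::{finite, linorder}) \<Rightarrow> real ^ ('i::{finite, linorder}) \<Rightarrow> real ^ ('i::{finite, linorder}) tot_idx" where
  "join x v = (\<chi> k. case Rep_tot_idx k of Inl i \<Rightarrow> x $ i | Inr a \<Rightarrow> v $ a)"

lemma join_nth [simp]: "join x v $ Base i = x $ i" "a \<noteq> last_idx \<Longrightarrow> join x v $ Fib a = v $ a"
  by (auto simp: join_def)

lemma tot_vec_eqI:
  assumes "\<And>i. v $ Base i = w $ Base i" "\<And>a. a \<noteq> last_idx \<Longrightarrow> v $ Fib a = w $ Fib a"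
  shows "v = w"
proof -
  have "v $ k = w $ k" for k by (cases k rule: tot_idx_cases) (use assms in auto)
  then show ?thesis by (simp add: vec_eq_iff)
qed

lemma base_part_join [simp]: "base_part (join x v) = x"
  by (simp add: base_part_def vec_eq_iff)

lemma linear_parts: "linear base_part" "linear fib_part" "linear (\<lambda>x. join x 0)" "linear (join 0)"
  by (auto intro!: linearI tot_vec_eqI simp: base_part_def fib_part_def vec_eq_iff)

lemma bounded_linear_parts: "bounded_linear base_part" "bounded_linear fib_part"
    "bounded_linear (\<lambda>x. join x 0)" "bounded_linear (join 0)"
  using linear_parts by (auto simp: linear_conv_bounded_linear)

lemma join_split: "join x v = join x 0 + join 0 v"
  by (rule tot_vec_eqI) auto

lemma open_base_part: "open S \<Longrightarrow> open {w. base_part w \<in> S}"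
  by (rule open_vimage[of S base_part, unfolded vimage_def])
    (auto intro: linear_continuous_on[OF bounded_linear_parts(1)])

context almost_contact
begin

abbreviation "B \<equiv> D_atlas A \<xi> \<eta>"
abbreviation "Dc \<equiv> D_chart A \<eta>"

lemma D_chart_mem:
  assumes "c \<in> A"
  shows "z \<in> fst (Dc c) \<longleftrightarrow> fst z \<in> fst c \<and> snd z \<in> tspace A (fst z) \<and> \<eta> (fst z) (snd z) = 0"
  using mcarrierI[OF assms] by (auto simp: D_chart_def D_total_def)

lemma D_chart_eq: "snd (Dc c) z = join (snd c (fst z)) (snd z c)"
  unfolding D_chart_def join_def e_comp_def by simp

text \<open>Every choice of fibre coordinates is attained, by the combination of the fields
  \<open>e_frame\<close> with these coefficients. So the image of a chart is the base image times
  the full fibre, in particular open.\<close>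

lemma D_chart_image:
  assumes c: "adapted A \<xi> c" and V: "V \<subseteq> fst c"
  shows "snd (Dc c) ` {z \<in> fst (Dc c). fst z \<in> V} = {w. base_part w \<in> snd c ` V}"
proof (intro equalityI subsetI)
  fix w assume "w \<in> {w. base_part w \<in> snd c ` V}"
  then obtain p where p: "p \<in> V" "base_part w = snd c p" by blast
  then have pc: "p \<in> fst c" using V by blast
  note pm = mcarrierI[OF adaptedD[OF c] pc]
  define v where "v = (\<Sum>a\<in>- {n}. w $ Fib a *\<^sub>R e c a p)"
  have v: "v \<in> tspace A p"
    unfolding v_def by (intro tspace_sum tspace_scaleR e_tspace[OF c pc])
  have "\<eta> p v = 0"
    using e_tspace[OF c pc] eta_e_frame[OF c pc] pm
    by (simp add: v_def eta_sum tspace_scaleR eta_scaleR)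
  then have z: "(p, v) \<in> fst (Dc c)" using v pc D_chart_mem[OF adaptedD[OF c]] by simp
  have "v c $ b = w $ Fib b" if "b \<noteq> n" for b
  proof -
    have "v c $ b = (\<Sum>a\<in>- {n}. w $ Fib a * (if b = a then 1 else 0))"
      using that by (simp add: v_def sum_apply e_frame_chart[OF c pc] axis_def)
    also have "\<dots> = w $ Fib b" using that by (simp add: if_distrib[of "\<lambda>x. _ * x"] cong: if_cong)
    finally show ?thesis .
  qed
  then have "snd (Dc c) (p, v) = w"
    unfolding D_chart_eq using p(2) by (intro tot_vec_eqI) (auto simp: base_part_def vec_eq_iff)
  then show "w \<in> snd (Dc c) ` {z \<in> fst (Dc c). fst z \<in> V}" using z p(1) by force
qed (auto simp: D_chart_eq)

lemma D_chart_inj: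
  assumes c: "adapted A \<xi> c" shows "inj_on (snd (Dc c)) (fst (Dc c))"
proof (rule inj_onI)
  fix z z' assume z: "z \<in> fst (Dc c)" "z' \<in> fst (Dc c)" and eq: "snd (Dc c) z = snd (Dc c) z'"
  note z = z[unfolded D_chart_mem[OF adaptedD[OF c]]]
  have "snd c (fst z) = snd c (fst z')" using eq by (metis D_chart_eq base_part_join)
  then have f: "fst z = fst z'" using inj_chart[OF adaptedD[OF c]] z by (auto simp: inj_on_def)
  have "snd z c $ a = snd z' c $ a" if "a \<noteq> n" for a
    using arg_cong[OF eq, of "\<lambda>w. w $ Fib a"] that by (simp add: D_chart_eq)
  then have "snd z = snd z'" using D_eqI[OF c, of "fst z" "snd z" "snd z'"] z f by auto
  then show "z = z'" using f by (simp add: prod_eq_iff)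
qed

lemma D_cinv:
  assumes "adapted A \<xi> c" "z \<in> fst (Dc c)" shows "cinv (Dc c) (snd (Dc c) z) = z"
  unfolding cinv_def by (rule inv_into_f_f[OF D_chart_inj[OF assms(1)] assms(2)])

lemma D_atlas_atlas: "atlas B"
  unfolding atlas_def
proof (intro conjI ballI)
  fix C assume "C \<in> B"
  then obtain c where c: "adapted A \<xi> c" "C = Dc c" by (auto simp: D_atlas_def)
  have "{z \<in> fst (Dc c). fst z \<in> fst c} = fst (Dc c)"
    using D_chart_mem[OF adaptedD[OF c(1)]] by auto
  then have "snd (Dc c) ` fst (Dc c) = {w. base_part w \<in> snd c ` fst c}"
    using D_chart_image[OF c(1) order_refl] by simp
  then show "is_chart C"
    unfolding is_chart_def c(2) using D_chart_inj[OF c(1)] open_base_part[OF open_chart[OF adaptedD[OF c(1)]]] by simp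
next
  fix C C' assume "C \<in> B" "C' \<in> B"
  then obtain c c' where c: "adapted A \<xi> c" "C = Dc c" "adapted A \<xi> c'" "C' = Dc c'"
    by (auto simp: D_atlas_def)
  note cA = adaptedD[OF c(1)] adaptedD[OF c(3)]
  let ?S = "{w. base_part w \<in> overlap c c'}"
  have "fst C \<inter> fst C' = {z \<in> fst (Dc c). fst z \<in> fst c \<inter> fst c'}"
    using D_chart_mem[OF cA(1)] D_chart_mem[OF cA(2)] by (auto simp: c)
  then have im: "snd C ` (fst C \<inter> fst C') = ?S"
    using D_chart_image[OF c(1), of "fst c \<inter> fst c'"] by (simp add: c overlap_def)
  have S: "open ?S" by (rule open_base_part[OF open_overlap[OF cA]])
  let ?T = "\<lambda>w. join (trans c c' (base_part w)) (fderiv (trans c c') (base_part w) (fib_part w))"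
  have eq: "?T w = (snd C' \<circ> cinv C) w" if "w \<in> ?S" for w
  proof -
    have "w \<in> snd C ` (fst C \<inter> fst C')" unfolding im by (rule that)
    then obtain z where "w = snd C z" "z \<in> fst C \<inter> fst C'" by (rule imageE)
    then have z: "z \<in> fst C" "z \<in> fst C'" "w = snd (Dc c) z" by (simp_all add: c(2))
    then have z': "fst z \<in> fst c" "fst z \<in> fst c'" "snd z \<in> tspace A (fst z)" "\<eta> (fst z) (snd z) = 0"
      using D_chart_mem[OF cA(1)] D_chart_mem[OF cA(2)] by (auto simp: c)
    have bw: "base_part w = snd c (fst z)" using z by (simp add: D_chart_eq)
    note lin = linear_dtrans[OF cA z'(1,2)]
    \<comment> \<open>Both charts are adapted, so the derivative of the coordinate change fixes the
      direction \<open>n\<close>. Replacing the last component by the filler 0 of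
      \<open>fib_part\<close> therefore affects only the last component of the image, which is not a
      coordinate of the total space.\<close>
    have xi: "dtrans c c' (fst z) (axis n 1) = axis n 1"
      using tspace_dtrans[OF xi_tspace[OF mcarrierI[OF cA(1) z'(1)]] cA z'(1,2)]
        xi_adapted_chart[OF c(1) z'(1)] xi_adapted_chart[OF c(3) z'(2)] by simp
    have "fib_part w = snd z c - (snd z c $ n) *\<^sub>R axis n 1"
      by (auto simp: z(3) D_chart_eq fib_part_def vec_eq_iff axis_def)
    then have "dtrans c c' (fst z) (fib_part w) = snd z c' - (snd z c $ n) *\<^sub>R axis n 1"
      using tspace_dtrans[OF z'(3) cA z'(1,2)] by (simp add: linear_diff[OF lin] linear_scale[OF lin] xi)
    then have "dtrans c c' (fst z) (fib_part w) $ a = snd z c' $ a" if "a \<noteq> n" for a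
      using that by (simp add: axis_def)
    moreover have "cinv C w = z" unfolding z(3) c(2) by (rule D_cinv[OF c(1)]) (use z c in simp)
    ultimately show ?thesis
      using trans_chart[OF cA(1) z'(1), of c']
      by (intro tot_vec_eqI) (auto simp: bw dtrans_def c(4) D_chart_eq)
  qed
  have lin: "smooth_on ?S base_part" "smooth_on ?S fib_part"
    using smooth_on_linear[OF S bounded_linear_parts(1) smooth_on_id[OF S]]
      smooth_on_linear[OF S bounded_linear_parts(2) smooth_on_id[OF S]] by auto
  have "smooth_on ?S (\<lambda>w. join (trans c c' (base_part w)) 0 + join 0 (fderiv (trans c c') (base_part w) (fib_part w)))"
    using lin
    by (intro smooth_on_add[OF S] smooth_on_linear[OF S bounded_linear_parts(3)] smooth_on_linear[OF S bounded_linear_parts(4)]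
        smooth_on_compose[OF S open_overlap[OF cA] smooth_trans[OF cA]]
        smooth_on_frechet_apply[OF S open_overlap[OF cA] smooth_trans[OF cA]]) auto
  then have "smooth_on ?S ?T" by (subst join_split)
  then have "smooth_on ?S (snd C' \<circ> cinv C)" using smooth_on_cong[OF S, of ?T "snd C' \<circ> cinv C"] eq by blast
  then show "compatible C C'" unfolding compatible_def im using S by blast
qed

end

section \<open>The prolonged structure\<close>

text \<open>Two derivatives on different spaces are compared through one-variable functions along
  lines. This relates the prolonged metric on the zero section to the metric on the base; with a
  constant second function it shows that a derivative vanishes.\<close>

lemma derivative_eq_along_line:
  fixes f :: "'a::real_normed_vector \<Rightarrow> 'b::real_normed_vector" and h :: "'c::real_normed_vector \<Rightarrow> 'b"
  assumes "(f has_derivative D) (at y)" "(h has_derivative E) (at x)" "0 < e"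
    and "\<And>s. \<bar>s\<bar> < e \<Longrightarrow> f (y + s *\<^sub>R v) = h (x + s *\<^sub>R w)"
  shows "D v = E w"
proof -
  have "((\<lambda>s. f (y + s *\<^sub>R v)) has_vector_derivative E w) (at 0)"
    by (rule has_vector_derivative_transform_within_open[OF has_vector_derivative_line[OF assms(2)], of "{-e<..<e}"])
      (use assms(3,4) in auto)
  then show ?thesis using has_vector_derivative_line[OF assms(1)] vector_derivative_unique_at by blast
qed

lemma derivative_constant_line:
  assumes "(f has_derivative D) (at y)" "0 < e" "\<And>s. \<bar>s\<bar> < e \<Longrightarrow> f (y + s *\<^sub>R v) = k"
  shows "D v = 0"
  by (rule derivative_eq_along_line[OF assms(1) has_derivative_const assms(2,3)])

lemma constant_along_line:
  fixes f :: "'a::real_normed_vector \<Rightarrow> 'b::real_normed_vector"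
  assumes der: "\<And>y. y \<in> S \<Longrightarrow> (f has_derivative D y) (at y)" "\<And>y. y \<in> S \<Longrightarrow> D y v = 0"
    and line: "\<And>t. \<bar>t\<bar> < e \<Longrightarrow> y + t *\<^sub>R v \<in> S" and s: "\<bar>s\<bar> < e"
  shows "f (y + s *\<^sub>R v) = f y"
proof -
  have "f (y + s *\<^sub>R v) = f (y + 0 *\<^sub>R v)"
  proof (rule has_derivative_zero_unique[of "{-e<..<e}" "\<lambda>t. f (y + t *\<^sub>R v)"])
    show "((\<lambda>t. f (y + t *\<^sub>R v)) has_derivative (\<lambda>h. 0)) (at t within {-e<..<e})"
      if "t \<in> {-e<..<e}" for t
    proof -
      have m: "y + t *\<^sub>R v \<in> S" using line that by auto
      have "((\<lambda>t. y + t *\<^sub>R v) has_derivative (\<lambda>h. h *\<^sub>R v)) (at t)"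
        by (auto intro!: derivative_eq_intros)
      from has_derivative_compose[OF this der(1)[OF m]]
      have "((\<lambda>t. f (y + t *\<^sub>R v)) has_derivative (\<lambda>h. 0)) (at t)"
        using linear_scale[OF has_derivative_linear[OF der(1)[OF m]]] der(2)[OF m] by simp
      then show ?thesis by (rule has_derivative_at_withinI)
    qed
  qed (use s in auto)
  then show ?thesis by simp
qed

lemma sum_axis_axis:
  "(\<Sum>k\<in>UNIV. \<Sum>l\<in>UNIV. axis i 1 $ k * axis j 1 $ l * (h k l :: real)) = h i j"
proof -
  have "(\<Sum>l\<in>UNIV. axis i 1 $ k * axis j 1 $ l * h k l) = axis i 1 $ k * h k j" for k
    by (simp add: axis_def if_distrib[of "\<lambda>x. _ * x"] if_distrib[of "\<lambda>x. x * _"] mult.assoc cong: if_cong)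
  then show ?thesis by (simp add: axis_def if_distrib[of "\<lambda>x. x * _"] cong: if_cong)
qed

section \<open>K-contact structures and the frame of D in adapted charts\<close>

context almost_contact
begin

text \<open>Infinitesimal form of independence of the last coordinate. The image of a chart may meet
  a line in direction \<open>n\<close> in several pieces, so the coefficients need not agree along
  the whole line; only short translations are used.\<close>

definition shift_invariant :: "('m, 'i) chart \<Rightarrow> bool" where
  "shift_invariant c \<longleftrightarrow> (\<forall>p\<in>fst c. \<forall>i j.
     fderiv (gram c i j \<circ> cinv c) (snd c p) (axis n 1) = 0)"

text \<open>The field \<open>\<xi>\<close> has constant components in an adapted chart, so
  \<open>lie_metric_gram\<close> applies to all \<open>X\<close> and \<open>Y\<close>. Coordinate
  fields recover the single coefficients; conversely every point lies in an adapted chart by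
  \<open>adapted_cover\<close>.\<close>

lemma almost_K_contact_iff:
  "almost_K_contact A \<xi> g \<longleftrightarrow> (\<forall>c. adapted A \<xi> c \<longrightarrow> shift_invariant c)"
proof -
  have lie: "lie_metric A \<xi> g X Y p = (\<Sum>i\<in>UNIV. \<Sum>j\<in>UNIV. X p c $ i * Y p c $ j *
      fderiv (gram c i j \<circ> cinv c) (snd c p) (axis n 1))"
    if U: "openin (mtop A) U" "vfield A U X" "vfield A U Y" and p: "p \<in> U" and c: "adapted A \<xi> c" "p \<in> fst c"
    for U X Y p c
  proof -
    note cA = adaptedD[OF c(1)]
    have xiU: "vfield A U \<xi>" using vfield_subset[OF xi_vfield] U(1) by (simp add: openin_mtop)
    have y: "snd c p \<in> snd c ` fst c" using c by blast
    have "fderiv (\<lambda>y. \<xi> (cinv c y) c) (snd c p) = fderiv (\<lambda>y. axis n 1) (snd c p)"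
      by (rule fderiv_cong[OF open_chart[OF cA] y])
        (use chart_cinv[OF cA] xi_adapted_chart[OF c(1)] in auto)
    then show ?thesis
      using lie_metric_gram[OF U xiU p cA c(2)] xi_adapted_chart[OF c] by simp
  qed
  show ?thesis
  proof
    assume K: "almost_K_contact A \<xi> g"
    show "\<forall>c. adapted A \<xi> c \<longrightarrow> shift_invariant c"
      unfolding shift_invariant_def
    proof (intro allI impI ballI)
      fix c p i j assume c: "adapted A \<xi> c" "p \<in> fst c"
      note cA = adaptedD[OF c(1)]
      note s = openin_chart[OF cA] vfield_coord_vec[OF cA, of i] vfield_coord_vec[OF cA, of j]
      have "lie_metric A \<xi> g (coord_vec A c i) (coord_vec A c j) p = 0"
        using K s c(2) unfolding almost_K_contact_def by blast
      then show "fderiv (gram c i j \<circ> cinv c) (snd c p) (axis n 1) = 0"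
        using lie[OF s c(2) c] coord_vec_self[OF cA c(2)] by (simp add: sum_axis_axis)
    qed
  next
    assume inv: "\<forall>c. adapted A \<xi> c \<longrightarrow> shift_invariant c"
    show "almost_K_contact A \<xi> g"
      unfolding almost_K_contact_def
    proof (intro allI impI ballI)
      fix U X Y p assume U: "openin (mtop A) U \<and> vfield A U X \<and> vfield A U Y" and p: "p \<in> U"
      have "p \<in> mcarrier A" using U p by (auto simp: openin_mtop)
      then obtain c where c: "adapted A \<xi> c" "p \<in> fst c" using adapted_cover by blast
      then show "lie_metric A \<xi> g X Y p = 0"
        using lie[of U X Y p c] U p inv[rule_format, OF c(1), unfolded shift_invariant_def] by simp
    qed
  qed
qed

lemma e_frame_last: "adapted A \<xi> c \<Longrightarrow> p \<in> fst c \<Longrightarrow> e c n p = 0"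
  by (simp add: e_frame_def Gamma_last)

lemma coord_vec_split:
  "adapted A \<xi> c \<Longrightarrow> p \<in> fst c \<Longrightarrow> coord_vec A c i p = e c i p + \<Gamma>n c i p *\<^sub>R \<xi> p"
  by (simp add: e_frame_def xi_adapted)

text \<open>D is orthogonal to \<open>\<xi>\<close>, which has square length 1, because
  \<open>g p v (\<xi> p) = \<eta> p v\<close>.\<close>

lemma gram_split:
  assumes c: "adapted A \<xi> c" "p \<in> fst c"
  shows "gram c i j p = g p (e c i p) (e c j p) + \<Gamma>n c i p * \<Gamma>n c j p"
proof -
  note p = mcarrierI[OF adaptedD[OF c(1)] c(2)]
  note t = e_tspace[OF c] xi_tspace[OF p]
  have "g p (\<xi> p) (e c j p) = 0" for j
    using metric_xi[OF p t(1)] eta_e_frame[OF c] metric_sym[OF p t(2) t(1)] by simp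
  then show ?thesis
    unfolding gram_def coord_vec_split[OF c]
    using p t metric_xi[OF p] eta_e_frame[OF c] eta_xi[OF p]
    by (simp add: metric_add_left metric_add_right metric_scaleR_left metric_scaleR_right tspace_scaleR tspace_add)
qed

text \<open>As \<open>\<eta>\<close> is the pairing with \<open>\<xi>\<close>, the functions that
  define the frame are themselves coefficients of the metric, so invariance of the latter passes to
  the frame.\<close>

lemma Gamma_gram:
  assumes c: "adapted A \<xi> c" "p \<in> fst c"
  shows "\<Gamma>n c i p = gram c i n p"
  using metric_xi[OF mcarrierI[OF adaptedD[OF c(1)] c(2)] coord_vec_tspace[OF adaptedD[OF c(1)] c(2)]]
  by (simp add: gram_def Gamma_n_def xi_adapted[OF c])

lemma smooth_fun_Gamma: "adapted A \<xi> c \<Longrightarrow> smooth_fun A (fst c) (\<Gamma>n c a)"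
  using one_form_eta[unfolded one_form_def, THEN conjunct2, rule_format, OF conjI[OF openin_chart vfield_coord_vec]]
    adaptedD unfolding Gamma_n_def[abs_def] by simp

lemma e_frame_Dsection:
  assumes c: "adapted A \<xi> c" shows "Dsection A \<eta> (fst c) (e c a)"
proof -
  note cA = adaptedD[OF c]
  have "smooth_fun A (fst c) (\<lambda>p. - \<Gamma>n c a p)"
    unfolding smooth_fun_def
  proof
    fix c' assume c': "c' \<in> A"
    have "smooth_on (snd c' ` (fst c \<inter> fst c')) (\<Gamma>n c a \<circ> cinv c')"
      using smooth_fun_Gamma[OF c] c' by (simp add: smooth_fun_def)
    from smooth_on_linear[OF openin_image[OF openin_chart[OF cA] c'] bounded_linear_minus[OF bounded_linear_ident] this]
    show "smooth_on (snd c' ` (fst c \<inter> fst c')) ((\<lambda>p. - \<Gamma>n c a p) \<circ> cinv c')"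
      by (simp add: o_def)
  qed
  from vfield_add[OF openin_chart[OF cA] vfield_coord_vec[OF cA]
      vfield_scaleR[OF openin_chart[OF cA] this vfield_coord_vec[OF cA]]]
  have "vfield A (fst c) (\<lambda>p. coord_vec A c a p + - \<Gamma>n c a p *\<^sub>R coord_vec A c n p)" .
  moreover have "(\<lambda>p. coord_vec A c a p + - \<Gamma>n c a p *\<^sub>R coord_vec A c n p) = e c a"
    by (simp add: fun_eq_iff e_frame_def)
  ultimately show ?thesis using eta_e_frame[OF c] by (simp add: Dsection_def)
qed

text \<open>For an indefinite metric a subspace can be degenerate. D is not: a vector of D is
  automatically orthogonal to \<open>\<xi>\<close>, which together with the fields
  \<open>e_frame\<close> spans the tangent space.\<close>

lemma D_nondegenerate:
  assumes c: "adapted A \<xi> c" "p \<in> fst c" and v: "v \<in> tspace A p" "\<eta> p v = 0"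
    and orth: "\<And>a. g p v (e c a p) = 0"
  shows "v = 0"
proof -
  note p = mcarrierI[OF adaptedD[OF c(1)] c(2)]
  note t = e_tspace[OF c] xi_tspace[OF p]
  have "g p v (coord_vec A c i p) = 0" for i
    unfolding coord_vec_split[OF c]
    using p v t orth metric_xi[OF p v(1)] by (simp add: metric_add_right metric_scaleR_right tspace_scaleR)
  then have z: "g p v (\<Sum>i\<in>UNIV. (w c $ i) *\<^sub>R coord_vec A c i p) = 0" for w
    using p v coord_vec_tspace[OF adaptedD[OF c(1)] c(2)]
    by (simp add: metric_sum_right metric_scaleR_right tspace_scaleR)
  have "g p v w = 0" if "w \<in> tspace A p" for w
    by (subst tspace_expand[OF that adaptedD[OF c(1)] c(2)]) (rule z)
  then show ?thesis by (rule metric_nondegenerate[OF p v(1)])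
qed

text \<open>In the chart, \<open>e c a\<close> differs from a constant by a multiple of
  \<open>axis n 1\<close>, so all its derivatives are multiples of that vector. The projection of
  the bracket to D is therefore 0, which makes the connection symmetric on this frame.\<close>

lemma e_frame_bracket:
  assumes c: "adapted A \<xi> c" "p \<in> fst c"
  shows "\<exists>r. lie_bracket A (e c a) (e c b) p = r *\<^sub>R \<xi> p"
proof -
  note cA = adaptedD[OF c(1)]
  note p = mcarrierI[OF cA c(2)]
  have v: "vfield A (fst c) (e c a)" for a using e_frame_Dsection[OF c(1)] by (simp add: Dsection_def)
  have "\<exists>k. fderiv (\<lambda>y. e c a (cinv c y) c) (snd c p) w = k *\<^sub>R axis n 1" for a w
  proof -
    let ?G = "\<Gamma>n c a \<circ> cinv c"
    let ?D = "fderiv ?G (snd c p)"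
    have "(?G has_derivative ?D) (at (snd c p))"
      by (rule smooth_fun_has_derivative[OF smooth_fun_Gamma[OF c(1)] cA c(2,2)])
    then have "((\<lambda>y. axis a 1 - ?G y *\<^sub>R axis n 1) has_derivative (\<lambda>w. 0 - ?D w *\<^sub>R axis n 1)) (at (snd c p))"
      by (intro has_derivative_diff has_derivative_const has_derivative_scaleR_left)
    then have "((\<lambda>y. e c a (cinv c y) c) has_derivative (\<lambda>w. 0 - ?D w *\<^sub>R axis n 1)) (at (snd c p))"
      by (rule has_derivative_transform_within_open[OF _ open_chart[OF cA]])
        (use c chart_cinv[OF cA] e_frame_chart[OF c(1)] in auto)
    from frechet_derivative_at[OF this, symmetric] show ?thesis
      by (intro exI[of _ "- ?D w"]) simp
  qed
  then obtain k l where "lie_bracket A (e c a) (e c b) p c = k *\<^sub>R axis n 1 - l *\<^sub>R axis n 1"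
    using cA c(2) unfolding lie_bracket_def by metis
  then have "lie_bracket A (e c a) (e c b) p c = ((k - l) *\<^sub>R \<xi> p) c"
    by (simp add: xi_adapted_chart[OF c] scaleR_left_diff_distrib)
  from tspace_eqI[OF lie_bracket_tspace[OF openin_chart[OF cA] v v c(2)] tspace_scaleR[OF xi_tspace[OF p]] cA c(2) this]
  show ?thesis by blast
qed

text \<open>The bound \<open>e\<close> serves all \<open>y\<close> near the point, not just the
  point itself: an identity under a translation must hold on a neighbourhood before it can be
  differentiated.\<close>

lemma shift_domain:
  assumes "c \<in> A" "p \<in> fst c"
  shows "\<exists>e>0. \<forall>y v. dist (snd c p) y < e \<longrightarrow> norm v < e \<longrightarrow> y + v \<in> snd c ` fst c"
proof -
  obtain e where e: "0 < e" "ball (snd c p) e \<subseteq> snd c ` fst c"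
    using open_chart[OF assms(1)] assms(2) openE by blast
  have "y + v \<in> snd c ` fst c" if "dist (snd c p) y < e / 2" "norm v < e / 2" for y v
  proof -
    have "dist (snd c p) (y + v) \<le> dist (snd c p) y + norm v"
      using dist_triangle[of "snd c p" "y + v" y] by (simp add: dist_norm)
    then show ?thesis using that e by auto
  qed
  then show ?thesis using e(1) by (intro exI[of _ "e / 2"]) auto
qed

lemma metric_diff_left:
  assumes "p \<in> mcarrier A" "v \<in> tspace A p" "v' \<in> tspace A p" "w \<in> tspace A p"
  shows "g p (v - v') w = g p v w - g p v' w"
  using metric_add_left[OF assms(1) tspace_diff[OF assms(2,3)] assms(4,3)] by simp

lemma gram_shift:
  assumes c: "adapted A \<xi> c" "shift_invariant c"
    and line: "\<And>t. \<bar>t\<bar> < d \<Longrightarrow> y + t *\<^sub>R axis n 1 \<in> snd c ` fst c" and s: "\<bar>s\<bar> < d"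
  shows "gram c i j (cinv c (y + s *\<^sub>R axis n 1)) = gram c i j (cinv c y)"
proof -
  note cA = adaptedD[OF c(1)]
  have "(gram c i j \<circ> cinv c) (y + s *\<^sub>R axis n 1) = (gram c i j \<circ> cinv c) y"
  proof (rule constant_along_line[OF _ _ line s])
    fix y assume "y \<in> snd c ` fst c"
    then obtain q where q: "q \<in> fst c" "y = snd c q" by blast
    show "(gram c i j \<circ> cinv c has_derivative fderiv (gram c i j \<circ> cinv c) y) (at y)"
      unfolding q(2) by (rule gram_has_derivative[OF cA q(1)])
    show "fderiv (gram c i j \<circ> cinv c) y (axis n 1) = 0"
      unfolding q(2) using c(2) q(1) by (simp add: shift_invariant_def)
  qed
  then show ?thesis by simp
qed

text \<open>Solves \<open>gram_split\<close> for the inner product on D. The result involves only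
  coefficients of the metric, so its invariance under translation can be read off from
  theirs.\<close>

lemma e_frame_gram:
  assumes "adapted A \<xi> c" "p \<in> fst c"
  shows "g p (e c i p) (e c j p) = gram c i j p - gram c i n p * gram c j n p"
  using gram_split[OF assms, of i j] by (simp add: Gamma_gram[OF assms])

end

section \<open>The metric and the frame on the total space\<close>

locale prolonged = almost_contact A g \<phi> \<xi> \<eta>
  for A :: "('m, 'i::{finite, linorder}) chart set" and g \<phi> \<xi> \<eta> +
  fixes nab N J u lam G
  assumes connection: "\<And>U. openin (mtop A) U \<Longrightarrow> intrinsic_metric_connection A \<xi> \<eta> g U (nab U)"
    and N_endo: "N_endomorphism A \<xi> \<eta> g N"
    and prolonged: "prolonged_structure A \<xi> \<eta> g nab N J u lam G"
begin

sublocale D: pseudo_riemannian B G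
proof
  show "atlas B" by (rule D_atlas_atlas)
  show "pseudo_metric B G" using prolonged unfolding prolonged_structure_def by (elim conjE)
qed

lemma u_vfield: "vfield B (D_total A \<eta>) u"
  using prolonged unfolding prolonged_structure_def by (elim conjE)

lemma D_chart_in: "adapted A \<xi> c \<Longrightarrow> Dc c \<in> B"
  by (auto simp: D_atlas_def)

abbreviation "eps \<equiv> eps_frame A \<xi> \<eta> nab"
abbreviation "ver \<equiv> vert_frame A \<xi> \<eta>"

lemma prolonged_frame:
  assumes "adapted A \<xi> c" "z \<in> fst (Dc c)"
  shows u_eq: "u z = u_frame A \<xi> \<eta> N c z"
    and G_u_u: "G z (u z) (u z) = 1"
    and G_eps_u: "\<And>a. a \<noteq> n \<Longrightarrow> G z (eps c a z) (u z) = 0"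
    and G_u_ver: "\<And>a. a \<noteq> n \<Longrightarrow> G z (u z) (ver c a z) = 0"
    and G_eps_eps: "\<And>a b. a \<noteq> n \<Longrightarrow> b \<noteq> n \<Longrightarrow> G z (eps c a z) (eps c b z) = g (fst z) (e c a (fst z)) (e c b (fst z))"
    and G_ver_ver: "\<And>a b. a \<noteq> n \<Longrightarrow> b \<noteq> n \<Longrightarrow> G z (ver c a z) (ver c b z) = g (fst z) (e c a (fst z)) (e c b (fst z))"
    and G_eps_ver: "\<And>a b. a \<noteq> n \<Longrightarrow> b \<noteq> n \<Longrightarrow> G z (eps c a z) (ver c b z) = 0"
  using prolonged[unfolded prolonged_structure_def, THEN conjunct2, THEN conjunct2, THEN conjunct2,
      THEN conjunct2, THEN conjunct2, rule_format, OF conjI[OF assms]]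
  by simp_all

text \<open>The chart of the total space has full fibres, so a translation of the base coordinates
  by \<open>v\<close> with unchanged fibre coordinates stays in it whenever the base point
  does.\<close>

lemma cinv_D_chart_shift:
  assumes c: "adapted A \<xi> c" and z: "z \<in> fst (Dc c)" and x: "snd c (fst z) + v \<in> snd c ` fst c"
  shows "cinv (Dc c) (snd (Dc c) z + join v 0) \<in> fst (Dc c)"
    and "snd (Dc c) (cinv (Dc c) (snd (Dc c) z + join v 0)) = snd (Dc c) z + join v 0"
    and "fst (cinv (Dc c) (snd (Dc c) z + join v 0)) = cinv c (snd c (fst z) + v)"
proof -
  let ?w = "snd (Dc c) z + join v 0"
  note cA = adaptedD[OF c]
  have bw: "base_part ?w = snd c (fst z) + v"
    by (simp add: linear_add[OF linear_parts(1)] D_chart_eq)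
  have "{z \<in> fst (Dc c). fst z \<in> fst c} = fst (Dc c)" using D_chart_mem[OF cA] by auto
  then have "?w \<in> snd (Dc c) ` fst (Dc c)" using D_chart_image[OF c order_refl] x bw by simp
  then obtain z' where z': "z' \<in> fst (Dc c)" "?w = snd (Dc c) z'" by blast
  then have "cinv (Dc c) ?w = z'" using D_cinv[OF c] by simp
  moreover have "base_part ?w = snd c (fst z')" unfolding z'(2) by (simp add: D_chart_eq)
  then have "fst z' = cinv c (snd c (fst z) + v)"
    using bw z'(1) D_chart_mem[OF cA] cinv_chart[OF cA] by metis
  ultimately show "cinv (Dc c) ?w \<in> fst (Dc c)" "snd (Dc c) (cinv (Dc c) ?w) = ?w"
    "fst (cinv (Dc c) ?w) = cinv c (snd c (fst z) + v)"
    using z' by auto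
qed

section \<open>The zero section\<close>

lemma zero_section:
  assumes c: "adapted A \<xi> c" "p \<in> fst c"
  shows "(p, 0) \<in> fst (Dc c)" "snd (Dc c) (p, 0) = join (snd c p) 0"
  using D_chart_mem[OF adaptedD[OF c(1)], of "(p, 0)"] tspace_zero eta_zero[OF mcarrierI[OF adaptedD[OF c(1)] c(2)]] c(2)
  by (simp_all add: D_chart_eq)

lemma zero_section_shift:
  assumes c: "adapted A \<xi> c" "p \<in> fst c" and x: "snd c p + v \<in> snd c ` fst c"
  shows "cinv (Dc c) (snd (Dc c) (p, 0) + join v 0) = (cinv c (snd c p + v), 0)"
proof -
  let ?q = "cinv c (snd c p + v)"
  have q: "?q \<in> fst c" "snd c ?q = snd c p + v" using chart_cinv[OF adaptedD[OF c(1)] x] by auto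
  have "snd (Dc c) (?q, 0) = snd (Dc c) (p, 0) + join v 0"
    by (rule tot_vec_eqI) (auto simp: zero_section(2)[OF c] zero_section(2)[OF c(1) q(1)] q(2))
  then show ?thesis using D_cinv[OF c(1) zero_section(1)[OF c(1) q(1)]] by simp
qed

lemma u_zero_section:
  assumes c: "adapted A \<xi> c" "p \<in> fst c"
  shows "u (p, 0) = coord_vec B (Dc c) (Base n) (p, 0)"
  unfolding u_eq[OF c(1) zero_section(1)[OF c]] u_frame_def
  by (simp add: zero_section(2)[OF c])

text \<open>Where the fibre coordinates vanish, \<open>eps\<close> has no connection term, and the
  base coordinate fields split as \<open>E i\<close> plus a multiple of \<open>u\<close>, exactly
  like \<open>coord_vec_split\<close> on the base. On these pieces \<open>G\<close> has the values
  that \<open>g\<close> has on \<open>e_frame\<close> and \<open>\<xi>\<close>.\<close>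

lemma gram_zero_section:
  assumes c: "adapted A \<xi> c" "p \<in> fst c"
  shows "D.gram (Dc c) (Base i) (Base j) (p, 0) = gram c i j p"
proof -
  let ?z = "(p, 0)"
  note z = zero_section[OF c]
  note zm = D.mcarrierI[OF D_chart_in[OF c(1)] z(1)]
  \<comment> \<open>The prescribed values of \<open>G\<close> cover the indices other than
    \<open>n\<close>; at \<open>n\<close> this vector is 0, as \<open>e_frame\<close> is, so the
    formulas below hold for all indices.\<close>
  define E where "E i = coord_vec B (Dc c) (Base i) ?z - \<Gamma>n c i p *\<^sub>R u ?z" for i
  have cv: "coord_vec B (Dc c) k ?z \<in> tspace B ?z" for k
    by (rule D.coord_vec_tspace[OF D_chart_in[OF c(1)] z(1)])
  have t: "u ?z \<in> tspace B ?z" "E i \<in> tspace B ?z" for i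
    unfolding E_def u_zero_section[OF c] by (intro D.tspace_diff D.tspace_scaleR cv)+
  have En: "E n = 0" using Gamma_last[OF c] by (simp add: E_def u_zero_section[OF c])
  have Ea: "E a = eps c a ?z" for a
    unfolding E_def eps_frame_def u_zero_section[OF c] by (simp add: z(2))
  have Eu: "G ?z (E i) (u ?z) = 0" for i
    using G_eps_u[OF c(1) z(1), of i, folded Ea] D.metric_zero_left[OF zm t(1)] En by (cases "i = n") simp_all
  have EE: "G ?z (E i) (E j) = g p (e c i p) (e c j p)" for i j
  proof -
    note p = mcarrierI[OF adaptedD[OF c(1)] c(2)]
    note et = e_tspace[OF c]
    have "G ?z (E i) 0 = 0" "g p (e c i p) 0 = 0"
      using D.metric_sym[OF zm t(2) D.tspace_zero] D.metric_zero_left[OF zm t(2)]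
        metric_sym[OF p et tspace_zero] metric_zero_left[OF p et] by simp_all
    then show ?thesis
      using G_eps_eps[OF c(1) z(1), of i j, folded Ea] D.metric_zero_left[OF zm t(2)] metric_zero_left[OF p et]
      by (cases "i = n"; cases "j = n") (simp_all add: En e_frame_last[OF c])
  qed
  have cE: "coord_vec B (Dc c) (Base i) ?z = E i + \<Gamma>n c i p *\<^sub>R u ?z" for i by (simp add: E_def)
  have uE: "G ?z (u ?z) (E j) = 0" for j using Eu D.metric_sym[OF zm t(1) t(2)] by simp
  show ?thesis
    unfolding D.gram_def cE gram_split[OF c]
    using zm t G_u_u[OF c(1) z(1)]
    by (simp add: D.metric_add_left D.metric_add_right D.metric_scaleR_left D.metric_scaleR_right
        D.tspace_scaleR D.tspace_add EE Eu uE)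
qed

lemma join_axis: "join (s *\<^sub>R axis i 1) 0 = s *\<^sub>R axis (Base i) 1"
  by (rule tot_vec_eqI) (auto simp: axis_def Base_neq_Fib[THEN not_sym])

text \<open>The Lie derivative is evaluated on base coordinate fields only. A translation in a base
  direction stays on the zero section, where \<open>u\<close> has constant components, so the
  derivative condition of \<open>lie_metric_gram\<close> holds for these arguments.\<close>

lemma prolonged_K_contact_imp_shift_invariant:
  assumes K: "almost_K_contact B u G" and c: "adapted A \<xi> c"
  shows "shift_invariant c"
  unfolding shift_invariant_def
proof (intro ballI allI)
  fix p i j assume p: "p \<in> fst c"
  note cA = adaptedD[OF c] and C = D_chart_in[OF c] and z = zero_section[OF c p]
  let ?z = "(p, 0)" and ?C = "Dc c"
  let ?X = "\<lambda>i. coord_vec B ?C (Base i)"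
  note X = D.vfield_coord_vec[OF C]
  have uU: "vfield B (fst ?C) u"
    by (rule D.vfield_subset[OF u_vfield]) (auto simp: D_chart_def)
  obtain d where d: "0 < d" "\<And>y v. dist (snd c p) y < d \<Longrightarrow> norm v < d \<Longrightarrow> y + v \<in> snd c ` fst c"
    using shift_domain[OF cA p] by blast
  have sh: "cinv ?C (snd ?C ?z + s *\<^sub>R axis (Base i) 1) = (cinv c (snd c p + s *\<^sub>R axis i 1), 0)"
    "cinv c (snd c p + s *\<^sub>R axis i 1) \<in> fst c" if "\<bar>s\<bar> < d" for s i
  proof -
    have x: "snd c p + s *\<^sub>R axis i 1 \<in> snd c ` fst c" using d that by (simp add: norm_axis_1)
    show "cinv ?C (snd ?C ?z + s *\<^sub>R axis (Base i) 1) = (cinv c (snd c p + s *\<^sub>R axis i 1), 0)"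
      using zero_section_shift[OF c p x] by (simp add: join_axis)
    show "cinv c (snd c p + s *\<^sub>R axis i 1) \<in> fst c" using chart_cinv[OF cA x] by blast
  qed
  have Du: "fderiv (\<lambda>y. u (cinv ?C y) ?C) (snd ?C ?z) (axis (Base i) 1) = 0" for i
  proof (rule derivative_constant_line[OF D.vfield_has_derivative[OF uU C z(1) z(1)] d(1)])
    show "u (cinv ?C (snd ?C ?z + s *\<^sub>R axis (Base i) 1)) ?C = axis (Base n) 1" if "\<bar>s\<bar> < d" for s
      unfolding sh(1)[OF that] u_zero_section[OF c sh(2)[OF that]]
      by (rule D.coord_vec_self[OF C zero_section(1)[OF c sh(2)[OF that]]])
  qed
  have Xz: "?X i ?z ?C = axis (Base i) 1" for i by (rule D.coord_vec_self[OF C z(1)])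
  have "lie_metric B u G (?X i) (?X j) ?z = 0"
    using K D.openin_chart[OF C] X z(1) unfolding almost_K_contact_def by blast
  then have "fderiv (D.gram ?C (Base i) (Base j) \<circ> cinv ?C) (snd ?C ?z) (axis (Base n) 1) = 0"
    using D.lie_metric_gram[OF D.openin_chart[OF C] X X uU z(1) C z(1), of "Base i" "Base j"]
    by (simp add: Xz Du u_zero_section[OF c p] D.coord_vec_self[OF C z(1)] sum_axis_axis)
  \<comment> \<open>Along the line in direction \<open>n\<close> the two coefficient functions
    coincide by \<open>gram_zero_section\<close>, so their derivatives in this direction
    agree.\<close>
  moreover have "fderiv (D.gram ?C (Base i) (Base j) \<circ> cinv ?C) (snd ?C ?z) (axis (Base n) 1)
      = fderiv (gram c i j \<circ> cinv c) (snd c p) (axis n 1)"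
    by (rule derivative_eq_along_line[OF D.gram_has_derivative[OF C z(1)] gram_has_derivative[OF cA p] d(1)])
      (simp add: sh gram_zero_section[OF c])
  ultimately show "fderiv (gram c i j \<circ> cinv c) (snd c p) (axis n 1) = 0" by simp
qed

section \<open>Translation invariance of the connection\<close>

abbreviation "nabla c a b \<equiv> nab (fst c) (e c a) (e c b)"

text \<open>\<open>N\<close> represents half of the Lie derivative of \<open>g\<close> on D, which
  vanishes here, and \<open>g\<close> is nondegenerate on D.\<close>

lemma N_e_frame_zero:
  assumes K: "almost_K_contact A \<xi> g" and c: "adapted A \<xi> c" "p \<in> fst c"
  shows "N p (e c b p) = 0"
proof -
  note cA = adaptedD[OF c(1)]
  note p = mcarrierI[OF cA c(2)]
  have "N p (e c b p) \<in> tspace A p \<and> \<eta> p (N p (e c b p)) = 0"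
    using N_endo[unfolded N_endomorphism_def, THEN conjunct1, rule_format, OF p
        e_tspace[OF c, of b] e_tspace[OF c, of b]] eta_e_frame[OF c] by blast
  moreover have "g p (N p (e c b p)) (e c a p) = 0" for a
  proof -
    have "vfield A (fst c) (e c k)" for k using e_frame_Dsection[OF c(1)] by (simp add: Dsection_def)
    then have "lie_metric A \<xi> g (e c b) (e c a) p = 0"
      using K openin_chart[OF cA] c(2) unfolding almost_K_contact_def by blast
    moreover have "g p (N p (e c b p)) (e c a p) = lie_metric A \<xi> g (e c b) (e c a) p / 2"
      by (rule N_endo[unfolded N_endomorphism_def, THEN conjunct2, THEN conjunct2, rule_format,
            OF conjI[OF openin_chart[OF cA] conjI[OF e_frame_Dsection[OF c(1)] e_frame_Dsection[OF c(1)]]] c(2)])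
    ultimately show ?thesis by simp
  qed
  ultimately show ?thesis using D_nondegenerate[OF c] by blast
qed

lemma connection_frame:
  assumes c: "adapted A \<xi> c" "p \<in> fst c"
  shows nab_tspace: "nabla c a b p \<in> tspace A p"
    and nab_eta: "\<eta> p (nabla c a b p) = 0"
    and nab_metric: "tderiv A (e c d p) (\<lambda>q. g q (e c a q) (e c b q)) p
        = g p (nabla c d a p) (e c b p) + g p (e c a p) (nabla c d b p)"
    and nab_sym: "nabla c a b p = nabla c b a p"
proof -
  note cA = adaptedD[OF c(1)]
  note pm = mcarrierI[OF cA c(2)]
  have f: "smooth_fun A (fst c) (\<lambda>_. 0)"
    unfolding smooth_fun_def smooth_on_def o_def
    using Ck_on_const[OF openin_image[OF openin_chart[OF cA]]] by blast
  note s = e_frame_Dsection[OF c(1)]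
  note con = connection[OF openin_chart[OF cA], unfolded intrinsic_metric_connection_def, rule_format,
      OF conjI[OF s conjI[OF s conjI[OF s f]]], of a b d]
  have D: "Dsection A \<eta> (fst c) (nabla c a b)" using con by (rule conjunct1)
  then show "nabla c a b p \<in> tspace A p" "\<eta> p (nabla c a b p) = 0"
    using c(2) vfield_tspace unfolding Dsection_def by blast+
  note con = con[THEN conjunct2, rule_format, OF c(2)]
  show "tderiv A (e c d p) (\<lambda>q. g q (e c a q) (e c b q)) p
        = g p (nabla c d a p) (e c b p) + g p (e c a p) (nabla c d b p)"
    using con by (elim conjE)
  obtain r where r: "lie_bracket A (e c a) (e c b) p = r *\<^sub>R \<xi> p" using e_frame_bracket[OF c] by blast
  have "nabla c a b p - nabla c b a p =
      lie_bracket A (e c a) (e c b) p - \<eta> p (lie_bracket A (e c a) (e c b) p) *\<^sub>R \<xi> p"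
    using con by (elim conjE)
  also have "\<dots> = 0" using eta_scaleR[OF pm xi_tspace[OF pm]] eta_xi[OF pm] by (simp add: r)
  finally show "nabla c a b p = nabla c b a p" by simp
qed

lemma e_metric_has_derivative:
  assumes c: "adapted A \<xi> c" "p \<in> fst c"
  shows "(((\<lambda>q. g q (e c a q) (e c b q)) \<circ> cinv c) has_derivative
    fderiv ((\<lambda>q. g q (e c a q) (e c b q)) \<circ> cinv c) (snd c p)) (at (snd c p))"
proof (rule smooth_fun_has_derivative[OF _ adaptedD[OF c(1)] c(2,2)])
  show "smooth_fun A (fst c) (\<lambda>q. g q (e c a q) (e c b q))"
    using e_frame_Dsection[OF c(1)]
    by (intro metric_smooth openin_chart adaptedD[OF c(1)]) (simp_all add: Dsection_def)
qed

text \<open>Written with the fixed chart \<open>c\<close> instead of \<open>tderiv\<close>, which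
  picks a chart at each point, so that values at two points of \<open>c\<close> can be compared
  directly.\<close>

definition dmetric :: "('m, 'i) chart \<Rightarrow> 'i \<Rightarrow> 'i \<Rightarrow> 'i \<Rightarrow> 'm \<Rightarrow> real" where
  "dmetric c d a b p =
     fderiv ((\<lambda>q. g q (e c a q) (e c b q)) \<circ> cinv c) (snd c p) (e c d p c)"

text \<open>The bracket terms of the usual formula are absent, because the connection is symmetric
  on this frame. The three derivatives expand by the metric condition into six terms, of which four
  cancel in pairs.\<close>

lemma koszul:
  assumes c: "adapted A \<xi> c" "p \<in> fst c"
  shows "2 * g p (nabla c a b p) (e c d p)
    = dmetric c a b d p + dmetric c b a d p - dmetric c d a b p"
proof -
  note pm = mcarrierI[OF adaptedD[OF c(1)] c(2)]
  define K where "K a b d = g p (nabla c a b p) (e c d p)" for a b d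
  have "dmetric c d a b p = K d a b + K d b a" for a b d
    using tderiv_eq[OF adaptedD[OF c(1)] c(2) e_tspace[OF c] e_metric_has_derivative[OF c]]
      nab_metric[OF c] metric_sym[OF pm e_tspace[OF c] nab_tspace[OF c]]
    by (simp add: dmetric_def K_def)
  moreover have "K a b d = K b a d" for a b d using nab_sym[OF c, of a b] by (simp add: K_def)
  ultimately show ?thesis unfolding K_def[symmetric] by simp
qed

abbreviation "shift c p s \<equiv> cinv c (snd c p + s *\<^sub>R axis n 1)"

text \<open>The Christoffel symbols are never solved for: by \<open>koszul\<close> the inner
  products of the connection vector with the frame are determined by invariant quantities, and
  nondegeneracy on D then identifies the vector itself.\<close>

lemma shift_structure:
  assumes c: "adapted A \<xi> c" "shift_invariant c" and p: "p \<in> fst c"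
  obtains d where "0 < d"
    "\<And>s. \<bar>s\<bar> < d \<Longrightarrow> snd c p + s *\<^sub>R axis n 1 \<in> snd c ` fst c"
    "\<And>s i j. \<bar>s\<bar> < d \<Longrightarrow> gram c i j (shift c p s) = gram c i j p"
    "\<And>s a b. \<bar>s\<bar> < d \<Longrightarrow> nabla c a b (shift c p s) c
        = nabla c a b p c"
proof -
  note cA = adaptedD[OF c(1)]
  note pm = mcarrierI[OF cA p]
  let ?x = "snd c p" and ?v = "axis n 1 :: real ^ 'i::{finite, linorder}"
  obtain d where d: "0 < d" "\<And>y v. dist ?x y < d \<Longrightarrow> norm v < d \<Longrightarrow> y + v \<in> snd c ` fst c"
    using shift_domain[OF cA p] by blast
  have dom: "y + s *\<^sub>R ?v \<in> snd c ` fst c" if "dist ?x y < d" "\<bar>s\<bar> < d" for y s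
    using d(2)[OF that(1), of "s *\<^sub>R ?v"] that(2) by (simp add: norm_axis_1)
  have gm: "gram c i j (cinv c (y + s *\<^sub>R ?v)) = gram c i j (cinv c y)" if "dist ?x y < d" "\<bar>s\<bar> < d" for y s i j
    by (rule gram_shift[OF c dom[OF that(1)] that(2)])
  have main: "nabla c a b (shift c p s) c = nabla c a b p c"
    if s: "\<bar>s\<bar> < d" for s a b
  proof -
    define q where "q = shift c p s"
    have q: "q \<in> fst c" "snd c q = ?x + s *\<^sub>R ?v"
      using chart_cinv[OF cA dom[of ?x s]] s d(1) by (auto simp: q_def)
    have gq: "gram c i j q = gram c i j p" for i j
      using gm[of ?x s i j] s d(1) p cA by (simp add: q_def)
    have \<Gamma>q: "\<Gamma>n c i q = \<Gamma>n c i p" for i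
      by (simp add: Gamma_gram[OF c(1) q(1)] Gamma_gram[OF c(1) p] gq)
    have eq: "e c i q c = e c i p c" for i
      by (simp add: e_frame_chart[OF c(1) q(1)] e_frame_chart[OF c(1) p] \<Gamma>q)
    \<comment> \<open>Composition with the translation by \<open>s\<close> leaves \<open>?F\<close>
      unchanged on a ball around the coordinates of \<open>p\<close>, and a translation has the
      identity as derivative; so \<open>?F\<close> has the same derivative at both points.\<close>
    have dm: "dmetric c k i j q = dmetric c k i j p" for i j k
    proof -
      let ?F = "(\<lambda>q. g q (e c i q) (e c j q)) \<circ> cinv c"
      let ?Dq = "fderiv ?F (snd c q)"
      have "(?F has_derivative ?Dq) (at (?x + s *\<^sub>R ?v))"
        using e_metric_has_derivative[OF c(1) q(1)] by (simp add: q(2))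
      moreover have "((\<lambda>y. y + s *\<^sub>R ?v) has_derivative (\<lambda>h. h)) (at ?x)"
        by (auto intro!: derivative_eq_intros)
      ultimately have "((\<lambda>y. ?F (y + s *\<^sub>R ?v)) has_derivative ?Dq) (at ?x)"
        using has_derivative_compose[of "\<lambda>y. y + s *\<^sub>R ?v" "\<lambda>h. h" ?x UNIV ?F ?Dq] by simp
      then have "(?F has_derivative ?Dq) (at ?x)"
      proof (rule has_derivative_transform_within_open[of _ _ _ _ "ball ?x d"])
        fix y assume y: "y \<in> ball ?x d"
        then have m: "cinv c (y + s *\<^sub>R ?v) \<in> fst c" "cinv c y \<in> fst c"
          using chart_cinv[OF cA dom[of y s]] chart_cinv[OF cA dom[of y 0]] s d(1) by auto
        show "?F (y + s *\<^sub>R ?v) = ?F y"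
          using gm[of y s] y s by (simp add: e_frame_gram[OF c(1) m(1)] e_frame_gram[OF c(1) m(2)])
      qed (use d(1) in auto)
      then have "?Dq = fderiv ?F ?x" by (rule frechet_derivative_at)
      then show ?thesis by (simp add: dmetric_def eq)
    qed
    define w where "w = nabla c a b p"
    define w' where "w' = nabla c a b q"
    \<comment> \<open>The vector at \<open>p\<close> with the components that \<open>w'\<close> has
      at \<open>q\<close>: nondegeneracy can only compare vectors at the same point.\<close>
    define v where "v = (\<Sum>i\<in>UNIV. (w' c $ i) *\<^sub>R coord_vec A c i p)"
    have w: "w \<in> tspace A p" "\<eta> p w = 0" and w': "w' \<in> tspace A q" "\<eta> q w' = 0"
      using nab_tspace nab_eta c(1) p q(1) by (simp_all add: w_def w'_def)
    have v: "v \<in> tspace A p"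
      unfolding v_def by (intro tspace_sum tspace_scaleR coord_vec_tspace cA p)
    have vc: "v c = w' c" using cA p by (simp add: v_def sum_apply vec_expand)
    have \<eta>v: "\<eta> p v = 0"
      using eta_chart[OF c(1) q(1) w'(1)] w'(2) by (simp add: eta_chart[OF c(1) p v] vc \<Gamma>q)
    have "g p v (e c k p) = g p w (e c k p)" for k
    proof -
      have "g p v (e c k p) = g q w' (e c k q)"
        using metric_gram[OF cA p v e_tspace[OF c(1) p]]
          metric_gram[OF cA q(1) w'(1) e_tspace[OF c(1) q(1)]] by (simp add: vc eq gq)
      then show ?thesis
        using koszul[OF c(1) p, of a b k] koszul[OF c(1) q(1), of a b k] by (simp add: dm w_def w'_def)
    qed
    then have "v - w = 0"
      using D_nondegenerate[OF c(1) p tspace_diff[OF v w(1)]] pm v w \<eta>v e_tspace[OF c(1) p]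
      by (simp add: eta_diff metric_diff_left)
    then show ?thesis using vc unfolding w_def w'_def q_def by simp
  qed
  show ?thesis
    by (rule that[OF d(1) _ _ main]) (use dom[of ?x] gm[of ?x] d(1) p cA in simp_all)
qed

section \<open>The prolonged metric of a K-contact structure\<close>

definition frame :: "('m, 'i) chart \<Rightarrow> 'i tot_idx \<Rightarrow> 'm \<times> ('m, 'i) tvec \<Rightarrow> ('m \<times> ('m, 'i) tvec, 'i tot_idx) tvec" where
  "frame c k z = (case Rep_tot_idx k of Inl i \<Rightarrow> if i = n then u z else eps c i z | Inr a \<Rightarrow> ver c a z)"

lemma frame_simps:
  "frame c (Base n) z = u z" "i \<noteq> n \<Longrightarrow> frame c (Base i) z = eps c i z" "a \<noteq> n \<Longrightarrow> frame c (Fib a) z = ver c a z"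
  by (auto simp: frame_def)

lemma D_coord_vec_tspace:
  "adapted A \<xi> c \<Longrightarrow> z \<in> fst (Dc c) \<Longrightarrow> coord_vec B (Dc c) k z \<in> tspace B z"
  by (rule D.coord_vec_tspace[OF D_chart_in])

lemma frame_tspace:
  assumes c: "adapted A \<xi> c" "z \<in> fst (Dc c)"
  shows "frame c k z \<in> tspace B z"
proof -
  have "z \<in> D_total A \<eta>" using c(2) by (simp add: D_chart_def)
  then have "u z \<in> tspace B z" by (rule D.vfield_tspace[OF u_vfield])
  moreover have "ver c a z \<in> tspace B z" "eps c a z \<in> tspace B z" for a
    unfolding vert_frame_def eps_frame_def
    by (intro D.tspace_diff D.tspace_sum D.tspace_scaleR D_coord_vec_tspace[OF c])+
  ultimately show ?thesis by (auto simp: frame_def split: sum.split)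
qed

lemma frame_chart:
  assumes c: "adapted A \<xi> c" "z \<in> fst (Dc c)"
  shows ver_chart: "ver c a z (Dc c) = axis (Fib a) 1"
    and eps_chart: "eps c a z (Dc c) = axis (Base a) 1 - \<Gamma>n c a (fst z) *\<^sub>R axis (Base n) 1
     - (\<Sum>b\<in>- {n}. \<Sum>d\<in>- {n}. (nabla c a d (fst z) c $ b * snd (Dc c) z $ Fib d) *\<^sub>R axis (Fib b) 1)"
  by (simp_all add: eps_frame_def vert_frame_def D.coord_vec_self[OF D_chart_in[OF c(1)] c(2)]
      sum_apply Christoffel_def e_comp_def)

lemma u_K_contact:
  assumes K: "almost_K_contact A \<xi> g" and c: "adapted A \<xi> c" "z \<in> fst (Dc c)"
  shows "u z (Dc c) = axis (Base n) 1"
proof -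
  have p: "fst z \<in> fst c" using c D_chart_mem[OF adaptedD[OF c(1)]] by blast
  have "u z = coord_vec B (Dc c) (Base n) z"
    unfolding u_eq[OF c] u_frame_def N_comp_def N_e_frame_zero[OF K c(1) p] by (simp add: e_comp_def)
  then show ?thesis by (simp add: D.coord_vec_self[OF D_chart_in[OF c(1)] c(2)])
qed

text \<open>The frame is triangular with respect to the coordinate vectors: \<open>ver\<close> and,
  by the K-contact condition, \<open>u\<close> are coordinate vectors, and \<open>eps\<close> is one
  up to a combination of these.\<close>

lemma frame_span:
  assumes K: "almost_K_contact A \<xi> g" and c: "adapted A \<xi> c" "z \<in> fst (Dc c)"
  shows "axis k 1 \<in> span (range (\<lambda>k. frame c k z (Dc c)))" (is "_ \<in> span ?S")
proof -
  have "frame c k z (Dc c) \<in> span ?S" for k by (rule span_base) simp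
  note f = this[of "Base n"] this[of "Base a" for a] this[of "Fib a" for a]
  have Fib: "axis (Fib a) 1 \<in> span ?S" if "a \<noteq> n" for a
    using f(3)[of a] that by (simp add: frame_simps ver_chart[OF c])
  have Bn: "axis (Base n) 1 \<in> span ?S"
    using f(1) by (simp add: frame_simps u_K_contact[OF K c])
  have Ba: "axis (Base a) 1 \<in> span ?S" if a: "a \<noteq> n" for a
  proof -
    let ?r = "\<Sum>b\<in>- {n}. \<Sum>d\<in>- {n}. (nabla c a d (fst z) c $ b * snd (Dc c) z $ Fib d) *\<^sub>R axis (Fib b) (1::real)"
    have "?r \<in> span ?S" using Fib by (intro span_sum span_scale) auto
    then have "eps c a z (Dc c) + \<Gamma>n c a (fst z) *\<^sub>R axis (Base n) 1 + ?r \<in> span ?S"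
      using f(2)[of a] a by (intro span_add span_scale Bn) (simp_all add: frame_simps)
    then show ?thesis by (simp add: eps_chart[OF c])
  qed
  show ?thesis
  proof (cases k rule: tot_idx_cases)
    case (1 i)
    then show ?thesis using Ba Bn by (cases "i = n") auto
  next
    case (2 a)
    then show ?thesis using Fib by simp
  qed
qed

text \<open>The prescribed inner products of the frame are 0, 1 or values of \<open>g\<close> on
  \<open>e_frame\<close>, so they depend on the point only through the latter.\<close>

lemma frame_metric:
  assumes c: "adapted A \<xi> c" "z \<in> fst (Dc c)" "z' \<in> fst (Dc c)"
    and gr: "\<And>a b. g (fst z') (e c a (fst z')) (e c b (fst z')) = g (fst z) (e c a (fst z)) (e c b (fst z))"
  shows "G z' (frame c k z') (frame c l z') = G z (frame c k z) (frame c l z)"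
proof -
  have sym: "G y (frame c k y) (frame c l y) = G y (frame c l y) (frame c k y)" if "y \<in> fst (Dc c)" for k l y
    by (rule D.metric_sym[OF D.mcarrierI[OF D_chart_in[OF c(1)] that] frame_tspace[OF c(1) that] frame_tspace[OF c(1) that]])
  have uu: "G y (frame c (Base n) y) (frame c (Base n) y) = 1"
    and ue: "i \<noteq> n \<Longrightarrow> G y (frame c (Base i) y) (frame c (Base n) y) = 0"
    and uv: "i \<noteq> n \<Longrightarrow> G y (frame c (Base n) y) (frame c (Fib i) y) = 0"
    and ev: "i \<noteq> n \<Longrightarrow> j \<noteq> n \<Longrightarrow> G y (frame c (Base i) y) (frame c (Fib j) y) = 0"
    and ee: "i \<noteq> n \<Longrightarrow> j \<noteq> n \<Longrightarrow> G y (frame c (Base i) y) (frame c (Base j) y) = g (fst y) (e c i (fst y)) (e c j (fst y))"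
    and vv: "i \<noteq> n \<Longrightarrow> j \<noteq> n \<Longrightarrow> G y (frame c (Fib i) y) (frame c (Fib j) y) = g (fst y) (e c i (fst y)) (e c j (fst y))"
    if y: "y \<in> fst (Dc c)" for y i j
    using G_u_u[OF c(1) y] G_eps_u[OF c(1) y, of i] G_u_ver[OF c(1) y, of i] G_eps_ver[OF c(1) y, of i j]
      G_eps_eps[OF c(1) y, of i j] G_ver_ver[OF c(1) y, of i j]
    by (simp_all add: frame_simps)
  note r = uu[OF c(2)] uu[OF c(3)] ue[OF c(2)] ue[OF c(3)] uv[OF c(2)] uv[OF c(3)] ev[OF c(2)] ev[OF c(3)]
    ee[OF c(2)] ee[OF c(3)] vv[OF c(2)] vv[OF c(3)]
  have BB: "G z' (frame c (Base i) z') (frame c (Base j) z') = G z (frame c (Base i) z) (frame c (Base j) z)" for i j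
    using sym[OF c(2), of "Base n" "Base j"] sym[OF c(3), of "Base n" "Base j"]
    by (cases "i = n"; cases "j = n") (simp_all add: r gr)
  have BF: "G z' (frame c (Base i) z') (frame c (Fib b) z') = G z (frame c (Base i) z) (frame c (Fib b) z)"
    if "b \<noteq> n" for i b
    using that by (cases "i = n") (simp_all add: r)
  show ?thesis
  proof (cases k rule: tot_idx_cases; cases l rule: tot_idx_cases)
    fix i b assume "k = Fib b" "b \<noteq> n" "l = Base i"
    then show ?thesis using BF sym[OF c(2)] sym[OF c(3)] by metis
  qed (simp_all add: BB BF r gr)
qed

text \<open>The coefficients in the coordinate fields involve the connection and the fibre
  coordinates; comparing bilinear forms on a spanning set avoids writing them out. The translated
  point keeps the fibre coordinates, and \<open>shift_structure\<close> keeps the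
  connection.\<close>

lemma D_gram_shift:
  assumes K: "almost_K_contact A \<xi> g" and c: "adapted A \<xi> c" "z \<in> fst (Dc c)"
  shows "fderiv (D.gram (Dc c) k l \<circ> cinv (Dc c)) (snd (Dc c) z) (axis (Base n) 1) = 0"
proof -
  note cA = adaptedD[OF c(1)]
  have p: "fst z \<in> fst c" using c D_chart_mem[OF cA] by blast
  have inv: "shift_invariant c" using K c(1) almost_K_contact_iff by blast
  obtain d where d: "0 < d"
    "\<And>s. \<bar>s\<bar> < d \<Longrightarrow> snd c (fst z) + s *\<^sub>R axis n 1 \<in> snd c ` fst c"
    "\<And>s i j. \<bar>s\<bar> < d \<Longrightarrow> gram c i j (shift c (fst z) s) = gram c i j (fst z)"
    "\<And>s a b. \<bar>s\<bar> < d \<Longrightarrow> nabla c a b (shift c (fst z) s) c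
        = nabla c a b (fst z) c"
    using shift_structure[OF c(1) inv p] by blast
  show ?thesis
  proof (rule derivative_constant_line[OF D.gram_has_derivative[OF D_chart_in[OF c(1)] c(2)] d(1)])
    fix s :: real assume s: "\<bar>s\<bar> < d"
    define z' where "z' = cinv (Dc c) (snd (Dc c) z + s *\<^sub>R axis (Base n) 1)"
    define q where "q = shift c (fst z) s"
    have z': "z' \<in> fst (Dc c)" "snd (Dc c) z' = snd (Dc c) z + s *\<^sub>R axis (Base n) 1" "fst z' = q"
      using cinv_D_chart_shift[OF c(1) c(2) d(2)[OF s]] by (simp_all add: join_axis z'_def q_def)
    have q: "q \<in> fst c" using z' D_chart_mem[OF cA] by blast
    have gq: "gram c i j q = gram c i j (fst z)" for i j unfolding q_def by (rule d(3)[OF s])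
    have nq: "nabla c a b q c = nabla c a b (fst z) c" for a b
      unfolding q_def by (rule d(4)[OF s])
    have fc: "frame c k z' (Dc c) = frame c k z (Dc c)" for k
    proof (cases k rule: tot_idx_cases)
      case (1 i)
      have "eps c i z' (Dc c) = eps c i z (Dc c)"
        unfolding eps_chart[OF c(1) z'(1)] eps_chart[OF c]
        by (simp add: z' nq Gamma_gram[OF c(1) q] Gamma_gram[OF c(1) p] gq axis_def Base_neq_Fib[THEN not_sym])
      then show ?thesis
        using 1 by (cases "i = n") (simp_all add: frame_simps u_K_contact[OF K c(1) z'(1)] u_K_contact[OF K c])
    next
      case (2 a)
      then show ?thesis by (simp add: frame_simps ver_chart[OF c(1) z'(1)] ver_chart[OF c])
    qed
    \<comment> \<open>\<open>G\<close> at \<open>y\<close> as a bilinear form on coordinate vectors.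
      On this fixed space the metrics at \<open>z\<close> and \<open>z'\<close> can be compared,
      although they live on different tangent spaces.\<close>
    define b where "b y v w = (\<Sum>k\<in>UNIV. \<Sum>l\<in>UNIV. v $ k * w $ l * D.gram (Dc c) k l y)"
      for y and v w :: "real ^ ('i::{finite, linorder}) tot_idx"
    have bil: "bilinear (b y)" for y
      unfolding bilinear_def b_def
      by (auto intro!: linearI simp: sum.distrib sum_distrib_left algebra_simps)
    \<comment> \<open>The frame spans, and has the same coordinates and Gram matrix at \<open>z\<close> and \<open>z'\<close>.\<close>
    have bf: "b z' (frame c k z (Dc c)) (frame c l z (Dc c)) = b z (frame c k z (Dc c)) (frame c l z (Dc c))" for k l
    proof -
      have "b z' (frame c k z' (Dc c)) (frame c l z' (Dc c)) = G z' (frame c k z') (frame c l z')"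
        unfolding b_def
        by (rule D.metric_gram[OF D_chart_in[OF c(1)] z'(1) frame_tspace[OF c(1) z'(1)] frame_tspace[OF c(1) z'(1)], symmetric])
      also have "\<dots> = G z (frame c k z) (frame c l z)"
        by (rule frame_metric[OF c z'(1)])
          (simp add: z'(3) e_frame_gram[OF c(1) q] e_frame_gram[OF c(1) p] gq)
      also have "\<dots> = b z (frame c k z (Dc c)) (frame c l z (Dc c))"
        unfolding b_def
        by (rule D.metric_gram[OF D_chart_in[OF c(1)] c(2) frame_tspace[OF c] frame_tspace[OF c]])
      finally show ?thesis by (simp add: fc)
    qed
    have "b z' (axis k 1) (axis l 1) = b z (axis k 1) (axis l 1)"
      by (rule bilinear_eq[OF bil bil order_refl order_refl frame_span[OF K c] frame_span[OF K c]])
        (use bf in auto)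
    then show "(D.gram (Dc c) k l \<circ> cinv (Dc c)) (snd (Dc c) z + s *\<^sub>R axis (Base n) 1) = D.gram (Dc c) k l z"
      by (simp add: b_def sum_axis_axis z'_def)
  qed
qed

text \<open>Here \<open>u\<close> is a coordinate field on the whole chart, so its derivative
  vanishes in every direction and \<open>X\<close>, \<open>Y\<close> can be arbitrary. All charts of
  the total space come from adapted charts, so every point is reached.\<close>

lemma K_contact_imp_prolonged_K_contact:
  assumes K: "almost_K_contact A \<xi> g"
  shows "almost_K_contact B u G"
  unfolding almost_K_contact_def
proof (intro allI impI ballI)
  fix U X Y z assume U: "openin (mtop B) U \<and> vfield B U X \<and> vfield B U Y" and z: "z \<in> U"
  then have UB: "U \<subseteq> mcarrier B" by (simp add: D.openin_mtop)
  then obtain c where c: "adapted A \<xi> c" "z \<in> fst (Dc c)"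
    using z by (auto simp: mcarrier_def D_atlas_def)
  note C = D_chart_in[OF c(1)]
  have "mcarrier B \<subseteq> D_total A \<eta>" by (auto simp: mcarrier_def D_atlas_def D_chart_def)
  then have uU: "vfield B U u" using D.vfield_subset[OF u_vfield] UB by blast
  have "snd (Dc c) z \<in> snd (Dc c) ` fst (Dc c)" using c by blast
  then have "fderiv (\<lambda>y. u (cinv (Dc c) y) (Dc c)) (snd (Dc c) z)
      = fderiv (\<lambda>y. axis (Base n) 1) (snd (Dc c) z)"
    by (rule fderiv_cong[OF D.open_chart[OF C]])
      (use D.chart_cinv[OF C] u_K_contact[OF K c(1)] in auto)
  then show "lie_metric B u G X Y z = 0"
    using D.lie_metric_gram[OF _ _ _ uU z C c(2), of X Y] U u_K_contact[OF K c] D_gram_shift[OF K c] by simp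
qed

end

theorem theorem4:
  fixes A :: "('m, 'i::{finite, linorder}) chart set"
  assumes "smooth_manifold A"
    and "odd CARD('i)"
    and "contact_metric A \<phi> \<xi> \<eta> g"
    and "\<And>U. openin (mtop A) U \<Longrightarrow> intrinsic_metric_connection A \<xi> \<eta> g U (nab U)"
    and "N_endomorphism A \<xi> \<eta> g N"
    and "prolonged_structure A \<xi> \<eta> g nab N J u lam G"
  shows "almost_K_contact (D_atlas A \<xi> \<eta>) u G \<longleftrightarrow> almost_K_contact A \<xi> g"
proof -
  have acm: "almost_contact_metric A \<phi> \<xi> \<eta> g" using assms(3) by (simp add: contact_metric_def)
  interpret prolonged A g \<phi> \<xi> \<eta> nab N J u lam G
  proof
    show "atlas A" using assms(1) by (simp add: smooth_manifold_def)
    show "pseudo_metric A g" using acm unfolding almost_contact_metric_def by (elim conjE)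
  qed (use assms acm in simp_all)
  show ?thesis
    using prolonged_K_contact_imp_shift_invariant K_contact_imp_prolonged_K_contact almost_K_contact_iff by blast
qed

end
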